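(* Let $R=\bigoplus_{\alpha\in\Gamma}R_{\alpha}$ be a gr-Noetherian domain. Then the following conditions are equivalent: (1) $\text{h-}\dim(R)\leq 1$; (2) every homogeneous overring $T$ of $R$ is a gGD domain; (3) $R$ is a gGD domain.
   Context: All rings are commutative with identity. $\Gamma$ is a nonzero torsionless commutative cancellative monoid, written additively (torsionless is equivalent to the existence of a total order compatible with the monoid operation), with quotient group $\langle\Gamma\rangle$. A graded domain $R=\bigoplus_{\alpha\in\Gamma}R_\alpha$ is an integral domain graded by such a monoid; $H=\bigcup_{\alpha\in\Gamma}(R_\alpha\setminus\{0\})$ is its set of nonzero homogeneous elements. The homogeneous quotient field $R_H$ is graded by $\langle\Gamma\rangle$ via $\deg(a/b)=\deg(a)-\deg(b)$. A homogeneous overring of $R$ is a ring $T$ with $R\subseteq T\subseteq R_H$ and $T=\bigoplus_{\alpha\in\langle\Gamma\rangle}(T\cap(R_H)_\alpha)$; it is a $\langle\Gamma\rangle$-graded domain. An ideal is homogeneous if it is generated by homogeneous elements. For a homogeneous overring $T$ of $R$, the extension $R\subseteq T$ satisfies gGD (graded going-down) if, whenever $P_0\subseteq P$ are homogeneous prime ideals of $R$ and $Q$ is a homogeneous prime ideal of $T$ with $Q\cap R=P$, there is a homogeneous prime ideal $Q_0$ of $T$ with $Q_0\subseteq Q$ and $Q_0\cap R=P_0$. $R$ is a gGD domain if $R\subseteq T$ satisfies gGD for every homogeneous overring $T$ of $R$. $R$ is gr-Noetherian if its homogeneous ideals satisfy the ascending chain condition. The h-height of a homogeneous prime ideal $P$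 is the supremum of the lengths of chains of homogeneous prime ideals descending from $P$, and $\text{h-}\dim(R)$ is the supremum of the h-heights of the homogeneous prime ideals of $R$. *)

theory Defs
  imports "HOL-Algebra.Algebra" "HOL-Library.Extended_Nat"
begin

text \<open>
  Every integral domain is regarded as a subring \<open>R\<close> of a field \<open>K\<close> (for instance of its quotient
  field), so that \<open>R\<^sub>H\<close> and all overrings of \<open>R\<close> are subsets of \<open>K\<close>.  Likewise a cancellative
  commutative monoid is regarded as a submonoid \<open>\<Gamma>\<close> of an abelian group (for instance of its
  quotient group).  The homogeneous component of degree \<open>\<alpha>\<close> of \<open>R\<close> is \<open>A \<alpha>\<close>; the values of \<open>A\<close>
  outside \<open>\<Gamma>\<close> are irrelevant.
\<close>

definition quotient_group :: "'g::ab_group_add set \<Rightarrow> 'g set" where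
  "quotient_group \<Gamma> = {\<alpha> - \<beta> | \<alpha> \<beta>. \<alpha> \<in> \<Gamma> \<and> \<beta> \<in> \<Gamma>}"

definition torsionless :: "'g::ab_group_add set \<Rightarrow> bool" where
  "torsionless \<Gamma> \<longleftrightarrow>
    (\<forall>\<alpha>\<in>\<Gamma>. \<forall>\<beta>\<in>\<Gamma>. \<forall>n::nat. n > 0 \<longrightarrow> (\<Sum>i<n. \<alpha>) = (\<Sum>i<n. \<beta>) \<longrightarrow> \<alpha> = \<beta>)"

definition direct_sum ::
  "('a, 'm) ring_scheme \<Rightarrow> 'g set \<Rightarrow> 'a set \<Rightarrow> ('g \<Rightarrow> 'a set) \<Rightarrow> bool" where
  "direct_sum K \<Gamma> R A \<longleftrightarrow>
    (\<forall>\<alpha>\<in>\<Gamma>. subgroup (A \<alpha>) (add_monoid (K\<lparr>carrier := R\<rparr>))) \<and>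
    (\<forall>x\<in>R. \<exists>!f. (\<forall>\<alpha>\<in>\<Gamma>. f \<alpha> \<in> A \<alpha>) \<and> (\<forall>\<alpha>. \<alpha> \<notin> \<Gamma> \<longrightarrow> f \<alpha> = \<zero>\<^bsub>K\<^esub>) \<and>
        finite {\<alpha>. f \<alpha> \<noteq> \<zero>\<^bsub>K\<^esub>} \<and> x = (\<Oplus>\<^bsub>K\<^esub>\<alpha>\<in>{\<alpha>. f \<alpha> \<noteq> \<zero>\<^bsub>K\<^esub>}. f \<alpha>))"

locale graded_domain = field K for K (structure) +
  fixes \<Gamma> :: "'g::ab_group_add set" and R and A
  assumes zero_in_monoid: "0 \<in> \<Gamma>"
    and add_in_monoid: "\<lbrakk> \<alpha> \<in> \<Gamma>; \<beta> \<in> \<Gamma> \<rbrakk> \<Longrightarrow> \<alpha> + \<beta> \<in> \<Gamma>"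
    and monoid_nonzero: "\<Gamma> \<noteq> {0}"
    and monoid_torsionless: "torsionless \<Gamma>"
    and subdomain: "subdomain R K"
    and direct_sum: "direct_sum K \<Gamma> R A"
    and component_mult:
      "\<lbrakk> \<alpha> \<in> \<Gamma>; \<beta> \<in> \<Gamma>; a \<in> A \<alpha>; b \<in> A \<beta> \<rbrakk> \<Longrightarrow> a \<otimes> b \<in> A (\<alpha> + \<beta>)"

definition nonzero_homogeneous ::
  "('a, 'm) ring_scheme \<Rightarrow> 'g set \<Rightarrow> ('g \<Rightarrow> 'a set) \<Rightarrow> 'a set" where
  "nonzero_homogeneous K \<Gamma> A = (\<Union>\<alpha>\<in>\<Gamma>. A \<alpha> - {\<zero>\<^bsub>K\<^esub>})"

definition homogeneous_quotient_field ::
  "('a, 'm) ring_scheme \<Rightarrow> 'g set \<Rightarrow> 'a set \<Rightarrow> ('g \<Rightarrow> 'a set) \<Rightarrow> 'a set" where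
  "homogeneous_quotient_field K \<Gamma> R A =
    {a \<otimes>\<^bsub>K\<^esub> inv\<^bsub>K\<^esub> b | a b. a \<in> R \<and> b \<in> nonzero_homogeneous K \<Gamma> A}"

text \<open>
  The component of \<open>R\<^sub>H\<close> of degree \<open>\<alpha>\<close>.  Zero is added explicitly because \<open>\<alpha>\<close> need not be the
  difference of the degrees of two nonzero homogeneous elements.
\<close>

definition quotient_component ::
  "('a, 'm) ring_scheme \<Rightarrow> 'g::ab_group_add set \<Rightarrow> ('g \<Rightarrow> 'a set) \<Rightarrow> 'g \<Rightarrow> 'a set" where
  "quotient_component K \<Gamma> A \<alpha> =
    insert \<zero>\<^bsub>K\<^esub> {a \<otimes>\<^bsub>K\<^esub> inv\<^bsub>K\<^esub> b | a b. \<exists>\<beta>\<in>\<Gamma>. \<exists>\<gamma>\<in>\<Gamma>.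
      a \<in> A \<beta> - {\<zero>\<^bsub>K\<^esub>} \<and> b \<in> A \<gamma> - {\<zero>\<^bsub>K\<^esub>} \<and> \<beta> - \<gamma> = \<alpha>}"

definition overring_component ::
  "('a, 'm) ring_scheme \<Rightarrow> 'g::ab_group_add set \<Rightarrow> ('g \<Rightarrow> 'a set) \<Rightarrow> 'a set \<Rightarrow> 'g \<Rightarrow> 'a set" where
  "overring_component K \<Gamma> A T \<alpha> = T \<inter> quotient_component K \<Gamma> A \<alpha>"

definition homogeneous_overring ::
  "('a, 'm) ring_scheme \<Rightarrow> 'g::ab_group_add set \<Rightarrow> 'a set \<Rightarrow> ('g \<Rightarrow> 'a set) \<Rightarrow> 'a set \<Rightarrow> bool" where
  "homogeneous_overring K \<Gamma> R A T \<longleftrightarrow>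
    subring T K \<and> R \<subseteq> T \<and> T \<subseteq> homogeneous_quotient_field K \<Gamma> R A \<and>
    direct_sum K (quotient_group \<Gamma>) T (overring_component K \<Gamma> A T)"

definition homogeneous_ideal ::
  "('a, 'm) ring_scheme \<Rightarrow> 'g set \<Rightarrow> 'a set \<Rightarrow> ('g \<Rightarrow> 'a set) \<Rightarrow> 'a set \<Rightarrow> bool" where
  "homogeneous_ideal K \<Gamma> R A I \<longleftrightarrow>
    ideal I (K\<lparr>carrier := R\<rparr>) \<and>
    (\<exists>S. S \<subseteq> nonzero_homogeneous K \<Gamma> A \<and> I = Idl\<^bsub>K\<lparr>carrier := R\<rparr>\<^esub> S)"

definition homogeneous_prime ::
  "('a, 'm) ring_scheme \<Rightarrow> 'g set \<Rightarrow> 'a set \<Rightarrow> ('g \<Rightarrow> 'a set) \<Rightarrow> 'a set \<Rightarrow> bool" where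
  "homogeneous_prime K \<Gamma> R A P \<longleftrightarrow>
    homogeneous_ideal K \<Gamma> R A P \<and> primeideal P (K\<lparr>carrier := R\<rparr>)"

definition gr_Noetherian ::
  "('a, 'm) ring_scheme \<Rightarrow> 'g set \<Rightarrow> 'a set \<Rightarrow> ('g \<Rightarrow> 'a set) \<Rightarrow> bool" where
  "gr_Noetherian K \<Gamma> R A \<longleftrightarrow>
    (\<forall>I :: nat \<Rightarrow> 'a set.
      (\<forall>n. homogeneous_ideal K \<Gamma> R A (I n) \<and> I n \<subseteq> I (Suc n)) \<longrightarrow>
      (\<exists>N. \<forall>n\<ge>N. I n = I N))"

definition h_height ::
  "('a, 'm) ring_scheme \<Rightarrow> 'g set \<Rightarrow> 'a set \<Rightarrow> ('g \<Rightarrow> 'a set) \<Rightarrow> 'a set \<Rightarrow> enat" where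
  "h_height K \<Gamma> R A P =
    Sup {enat n | n. \<exists>C :: nat \<Rightarrow> 'a set. C 0 = P \<and>
      (\<forall>i\<le>n. homogeneous_prime K \<Gamma> R A (C i)) \<and> (\<forall>i<n. C (Suc i) \<subset> C i)}"

definition h_dim ::
  "('a, 'm) ring_scheme \<Rightarrow> 'g set \<Rightarrow> 'a set \<Rightarrow> ('g \<Rightarrow> 'a set) \<Rightarrow> enat" where
  "h_dim K \<Gamma> R A = Sup (h_height K \<Gamma> R A ` {P. homogeneous_prime K \<Gamma> R A P})"

definition satisfies_gGD ::
  "('a, 'm) ring_scheme \<Rightarrow> 'g::ab_group_add set \<Rightarrow> 'a set \<Rightarrow> ('g \<Rightarrow> 'a set) \<Rightarrow> 'a set \<Rightarrow> bool" where
  "satisfies_gGD K \<Gamma> R A T \<longleftrightarrow>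
    (let prime_R = homogeneous_prime K \<Gamma> R A;
         prime_T = homogeneous_prime K (quotient_group \<Gamma>) T (overring_component K \<Gamma> A T)
     in \<forall>P\<^sub>0 P Q. prime_R P\<^sub>0 \<and> prime_R P \<and> P\<^sub>0 \<subseteq> P \<and> prime_T Q \<and> Q \<inter> R = P \<longrightarrow>
          (\<exists>Q\<^sub>0. prime_T Q\<^sub>0 \<and> Q\<^sub>0 \<subseteq> Q \<and> Q\<^sub>0 \<inter> R = P\<^sub>0))"

definition gGD_domain ::
  "('a, 'm) ring_scheme \<Rightarrow> 'g::ab_group_add set \<Rightarrow> 'a set \<Rightarrow> ('g \<Rightarrow> 'a set) \<Rightarrow> bool" where
  "gGD_domain K \<Gamma> R A \<longleftrightarrow>
    (\<forall>T. homogeneous_overring K \<Gamma> R A T \<longrightarrow> satisfies_gGD K \<Gamma> R A T)"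

lemma quotient_component_mult:
  fixes K (structure)
  assumes "graded_domain K \<Gamma> R A" "x \<in> quotient_component K \<Gamma> A \<alpha>" "y \<in> quotient_component K \<Gamma> A \<beta>"
  shows "x \<otimes>\<^bsub>K\<^esub> y \<in> quotient_component K \<Gamma> A (\<alpha> + \<beta>)"
proof -
  interpret graded_domain K \<Gamma> R A by fact
  have RK: "R \<subseteq> carrier K" using subdomain by (meson subdomainE(1))
  have AR: "A \<gamma> \<subseteq> R" if "\<gamma> \<in> \<Gamma>" for \<gamma>
    using direct_sum that unfolding direct_sum_def
    using subgroup.subset by fastforce
  have AK: "a \<in> carrier K" if "\<gamma> \<in> \<Gamma>" "a \<in> A \<gamma>" for \<gamma> a using RK AR that by blast
  show ?thesis
  proof (cases "x = \<zero> \<or> y = \<zero>")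
    case True
    have "quotient_component K \<Gamma> A \<delta> \<subseteq> carrier K" for \<delta>
      unfolding quotient_component_def using AK by (auto simp: field_Units)
    then have "x \<in> carrier K" "y \<in> carrier K" using assms by auto
    with True have "x \<otimes> y = \<zero>" by auto
    then show ?thesis by (simp add: quotient_component_def)
  next
    case False
    then obtain a b \<beta>1 \<gamma>1 where x: "x = a \<otimes> inv b" "\<beta>1 \<in> \<Gamma>" "\<gamma>1 \<in> \<Gamma>" "a \<in> A \<beta>1 - {\<zero>}" "b \<in> A \<gamma>1 - {\<zero>}" "\<beta>1 - \<gamma>1 = \<alpha>"
      using assms(2) unfolding quotient_component_def by blast
    from False obtain c d \<beta>2 \<gamma>2 where y: "y = c \<otimes> inv d" "\<beta>2 \<in> \<Gamma>" "\<gamma>2 \<in> \<Gamma>" "c \<in> A \<beta>2 - {\<zero>}" "d \<in> A \<gamma>2 - {\<zero>}" "\<beta>2 - \<gamma>2 = \<beta>"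
      using assms(3) unfolding quotient_component_def by blast
    have ck: "a \<in> carrier K" "c \<in> carrier K" using x y AK by auto
    have bu: "b \<in> Units K" "d \<in> Units K" using x y AK by (auto simp: field_Units)
    then have bk: "b \<in> carrier K" "d \<in> carrier K" by auto
    have iv: "inv (b \<otimes> d) = inv b \<otimes> inv d"
    proof (rule comm_inv_char)
      have "(b \<otimes> d) \<otimes> (inv b \<otimes> inv d) = (b \<otimes> inv b) \<otimes> (d \<otimes> inv d)"
        using bu bk by (simp add: m_ac del: Units_r_inv Units_l_inv)
      also have "\<dots> = \<one>" using bu by simp
      finally show "(b \<otimes> d) \<otimes> (inv b \<otimes> inv d) = \<one>" .
    qed (use bu bk in auto)
    have e: "x \<otimes> y = (a \<otimes> c) \<otimes> inv (b \<otimes> d)"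
      unfolding x(1) y(1) iv using ck bu by (simp add: m_ac)
    have "a \<otimes> c \<in> A (\<beta>1 + \<beta>2) - {\<zero>}" "b \<otimes> d \<in> A (\<gamma>1 + \<gamma>2) - {\<zero>}"
      using x y component_mult ck bk by (auto dest: integral)
    moreover have "(\<beta>1 + \<beta>2) - (\<gamma>1 + \<gamma>2) = \<alpha> + \<beta>" using x y by auto
    ultimately show ?thesis unfolding quotient_component_def e
      using add_in_monoid x y by blast
  qed
qed

lemma graded_domain_overring:
  assumes gd: "graded_domain K \<Gamma> R A" and ov: "homogeneous_overring K \<Gamma> R A T"
  shows "graded_domain K (quotient_group \<Gamma>) T (overring_component K \<Gamma> A T)"
proof -
  interpret graded_domain K \<Gamma> R A by fact
  let ?G = "quotient_group \<Gamma>"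
  have sub: "\<Gamma> \<subseteq> ?G" unfolding quotient_group_def using zero_in_monoid by force
  have "torsionless ?G"
    unfolding torsionless_def
  proof (intro ballI allI impI)
    fix \<alpha> \<beta> and n :: nat
    assume "\<alpha> \<in> ?G" "\<beta> \<in> ?G" and n: "n > 0" and e: "(\<Sum>i<n. \<alpha>) = (\<Sum>i<n. \<beta>)"
    then obtain a b c d where ab: "\<alpha> = a - b" "\<beta> = c - d" "a \<in> \<Gamma>" "b \<in> \<Gamma>" "c \<in> \<Gamma>" "d \<in> \<Gamma>"
      unfolding quotient_group_def by blast
    have "(\<Sum>i<n. a) + (\<Sum>i<n. d) = (\<Sum>i<n. c) + (\<Sum>i<n. b)"
      using e unfolding ab by (simp add: sum_subtractf algebra_simps)
    then have "(\<Sum>i<n. a + d) = (\<Sum>i<n. c + b)" by (simp add: sum.distrib)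
    then have "a + d = c + b" using monoid_torsionless n add_in_monoid ab unfolding torsionless_def by blast
    then show "\<alpha> = \<beta>" unfolding ab by (simp add: algebra_simps)
  qed
  moreover have "?G \<noteq> {0}" using sub monoid_nonzero zero_in_monoid by auto
  moreover have "\<alpha> + \<beta> \<in> ?G" if ab0: "\<alpha> \<in> ?G" "\<beta> \<in> ?G" for \<alpha> \<beta>
  proof -
    obtain a b c d where ab: "\<alpha> = a - b" "\<beta> = c - d" "a \<in> \<Gamma>" "b \<in> \<Gamma>" "c \<in> \<Gamma>" "d \<in> \<Gamma>"
      using ab0 unfolding quotient_group_def by blast
    have "\<alpha> + \<beta> = (a + c) - (b + d)" unfolding ab by simp
    then show ?thesis using ab add_in_monoid unfolding quotient_group_def by blast
  qed
  moreover have "subring T K" using ov unfolding homogeneous_overring_def by auto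
  moreover from this have "subdomain T K" using subring_is_domain subdomain_iff subringE(1) by blast
  ultimately show ?thesis
    using ov sub zero_in_monoid quotient_component_mult[OF gd] subringE(6)[of T K]
    unfolding graded_domain_def graded_domain_axioms_def homogeneous_overring_def
    by (auto simp: field_axioms overring_component_def)
qed

end

theory Submission
  imports Defs
begin

text \<open>
  A homogeneous prime of \<open>R\<close> of h-height at least two is incompatible with graded going-down,
  and h-dimension at most one is inherited by all homogeneous overrings; in h-dimension at most
  one, going-down holds for a trivial reason, because the only proper containments of primes
  start at the zero ideal.

  \<^bold>\<open>Going-down forces dimension at most one.\<close>  Let \<open>M\<close> be a homogeneous prime of a gGD domain
  \<open>R\<close>.  The homogeneous primes inside \<open>M\<close> form a chain (\<open>going_down_primes_comparable\<close>): if \<open>P\<close>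
  and \<open>P'\<close> were incomparable, choose homogeneous \<open>c \<in> P - P'\<close> and \<open>a \<in> P' - P\<close>.  One of the rings
  \<open>R[a/c]\<close> and \<open>R[c/a]\<close> has a homogeneous prime lying over \<open>M\<close> (\<open>adjoin_proper_or\<close>).  In
  \<open>R[a/c]\<close> every prime containing \<open>c\<close> contains \<open>a\<close>, so going-down to \<open>P\<close> fails; in \<open>R[c/a]\<close>
  going-down to \<open>P'\<close> fails.  Suppose now that \<open>P\<close> is a homogeneous prime properly inside \<open>M\<close> and
  pick a homogeneous \<open>a \<in> M - P\<close>.  The intersection \<open>P'\<close> of the homogeneous primes between \<open>a\<close>
  and \<open>M\<close> is prime, since these primes form a chain, it is minimal over \<open>a\<close>, and it contains
  \<open>P\<close>.  The graded principal ideal theorem (\<open>principal_ideal_theorem\<close>) gives \<open>P = 0\<close>.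

  \<^bold>\<open>Dimension at most one passes to overrings.\<close>  This is the dimension part of the
  Krull--Akizuki theorem in graded form (\<open>krull_akizuki_one_dimensional\<close>).

  Both the principal ideal theorem and the Krull--Akizuki theorem rest on one chain condition:
  if \<open>P\<close> is minimal over \<open>a\<close>, then after localising at \<open>P\<close> the ring \<open>R/a\<close> is graded Artinian
  (\<open>saturated_chain_stabilises\<close>).  It is proved by Noetherian induction on homogeneous ideals,
  without lengths.  Localisations are never formed: an ideal of the localisation at \<open>P\<close> is
  represented by an ideal of \<open>R\<close> that is saturated for the homogeneous elements outside \<open>P\<close>.

  All rings live inside the graded field \<open>R\<^sub>H\<close>, and an ideal or overring is homogeneous iff it
  contains the homogeneous components of its elements.  The arguments therefore work with
  ordinary elements, and gradedness enters only through closure properties of such subsets.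
  The torsionless hypothesis is used in one place: a product of elements outside a homogeneous
  ideal that is prime on homogeneous elements stays outside (\<open>gprimeI\<close>), because two finite
  sets of degrees have a sum attained only once (\<open>unique_sum\<close>).
\<close>

section \<open>Unique sums in torsion-free abelian groups\<close>

definition nmult :: "nat \<Rightarrow> 'g::ab_group_add \<Rightarrow> 'g" where
  "nmult n x = (\<Sum>i<n. x)"

lemma nmult_simps [simp]:
  "nmult 0 x = 0" "nmult (Suc n) x = x + nmult n x" "nmult n 0 = 0" "nmult n (- x) = - nmult n x"
  by (simp_all add: nmult_def sum_negf)

lemma nmult_add: "nmult (m + n) x = nmult m x + nmult n x"
  by (induction m) (auto simp: algebra_simps)

lemma nmult_mult: "nmult (m * n) x = nmult m (nmult n x)"
  by (induction m) (auto simp: nmult_add)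

definition additive_subgrp :: "'g::ab_group_add set \<Rightarrow> bool" where
  "additive_subgrp G \<longleftrightarrow> 0 \<in> G \<and> (\<forall>x\<in>G. \<forall>y\<in>G. x + y \<in> G) \<and> (\<forall>x\<in>G. - x \<in> G)"

definition torsion_free :: "'g::ab_group_add set \<Rightarrow> bool" where
  "torsion_free G \<longleftrightarrow> (\<forall>x\<in>G. \<forall>n>0. nmult n x = 0 \<longrightarrow> x = 0)"

definition positive_cone :: "'g::ab_group_add set \<Rightarrow> bool" where
  "positive_cone P \<longleftrightarrow> 0 \<in> P \<and> (\<forall>x\<in>P. \<forall>y\<in>P. x + y \<in> P) \<and> (\<forall>x\<in>P. - x \<in> P \<longrightarrow> x = 0)"

lemma nmult_in_cone: "positive_cone P \<Longrightarrow> x \<in> P \<Longrightarrow> nmult n x \<in> P"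
  by (induction n) (auto simp: positive_cone_def)

lemma positive_cone_adjoin:
  assumes P: "positive_cone P" and nk: "\<And>k. k > 0 \<Longrightarrow> - nmult k x \<notin> P"
  shows "positive_cone {p + nmult n x | p n. p \<in> P}"
  unfolding positive_cone_def
proof (intro conjI ballI impI)
  have "0 = 0 + nmult 0 x" by simp
  then show "0 \<in> {p + nmult n x | p n. p \<in> P}" using P unfolding positive_cone_def by blast
next
  fix y z assume "y \<in> {p + nmult n x | p n. p \<in> P}" "z \<in> {p + nmult n x | p n. p \<in> P}"
  then obtain p n q m where "y = p + nmult n x" "z = q + nmult m x" and pq: "p \<in> P" "q \<in> P" by blast
  then have "y + z = (p + q) + nmult (n + m) x" by (simp add: nmult_add algebra_simps)
  moreover have "p + q \<in> P" using P pq unfolding positive_cone_def by blast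
  ultimately show "y + z \<in> {p + nmult n x | p n. p \<in> P}" by blast
next
  fix y assume "y \<in> {p + nmult n x | p n. p \<in> P}" "- y \<in> {p + nmult n x | p n. p \<in> P}"
  then obtain p n q m where y: "y = p + nmult n x" "- y = q + nmult m x" and pq: "p \<in> P" "q \<in> P" by blast
  have "(p + nmult n x) + (q + nmult m x) = 0" using y by (metis add.right_inverse)
  then have e: "p + q = - nmult (n + m) x"
    by (simp add: nmult_add algebra_simps eq_neg_iff_add_eq_0)
  moreover have "p + q \<in> P" using P pq unfolding positive_cone_def by blast
  ultimately have nm: "n + m = 0" using nk by (metis neq0_conv)
  then have "p + q = 0" using e by simp
  then have "q = - p" by (simp add: eq_neg_iff_add_eq_0 add.commute)
  then have "p = 0" using P pq unfolding positive_cone_def by blast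
  then show "y = 0" using y nm by simp
qed

text \<open>
  A maximal cone is total: if neither \<open>x\<close> nor \<open>- x\<close> lies in it, neither can be adjoined, so
  \<open>- k x\<close> and \<open>l x\<close> both lie in the cone for some positive \<open>k\<close> and \<open>l\<close>, and then \<open>k l x = 0\<close>.
\<close>

lemma total_cone_exists:
  assumes G: "additive_subgrp G" and tf: "torsion_free G"
  shows "\<exists>P. positive_cone P \<and> P \<subseteq> G \<and> (\<forall>x\<in>G. x \<in> P \<or> - x \<in> P)"
proof -
  define Z where "Z = {P. positive_cone P \<and> P \<subseteq> G}"
  have "\<exists>M\<in>Z. \<forall>Y\<in>Z. M \<subseteq> Y \<longrightarrow> Y = M"
  proof (rule subset_Zorn_nonempty)
    have "{0} \<in> Z" using G by (auto simp: Z_def positive_cone_def additive_subgrp_def)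
    then show "Z \<noteq> {}" by blast
  next
    fix \<C> assume ne: "\<C> \<noteq> {}" and ch: "subset.chain Z \<C>"
    have mem: "positive_cone P" "P \<subseteq> G" if "P \<in> \<C>" for P
      using ch that unfolding subset_chain_def Z_def by auto
    have tot: "P \<subseteq> Q \<or> Q \<subseteq> P" if "P \<in> \<C>" "Q \<in> \<C>" for P Q
      using ch that unfolding subset_chain_def Z_def by auto
    have "positive_cone (\<Union>\<C>)"
      unfolding positive_cone_def
    proof (intro conjI ballI impI)
      show "0 \<in> \<Union>\<C>" using ne mem unfolding positive_cone_def by blast
      have common: "\<exists>P\<in>\<C>. x \<in> P \<and> y \<in> P" if "x \<in> \<Union>\<C>" "y \<in> \<Union>\<C>" for x y
        using that tot by blast
      show "x + y \<in> \<Union>\<C>" if "x \<in> \<Union>\<C>" "y \<in> \<Union>\<C>" for x y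
        using common[OF that] mem(1) unfolding positive_cone_def by blast
      show "x = 0" if "x \<in> \<Union>\<C>" "- x \<in> \<Union>\<C>" for x
        using common[OF that] mem(1) unfolding positive_cone_def by blast
    qed
    then show "\<Union>\<C> \<in> Z" using mem by (auto simp: Z_def)
  qed
  then obtain P where P: "positive_cone P" "P \<subseteq> G"
    and max: "\<And>Y. positive_cone Y \<Longrightarrow> Y \<subseteq> G \<Longrightarrow> P \<subseteq> Y \<Longrightarrow> Y = P" unfolding Z_def by auto
  have key: "\<exists>k>0. - nmult k x \<in> P" if x: "x \<in> G" "x \<notin> P" for x
  proof (rule ccontr)
    assume "\<not> ?thesis"
    then have c: "positive_cone {p + nmult n x | p n. p \<in> P}" using positive_cone_adjoin[OF P(1)] by blast
    have nG: "nmult n x \<in> G" for n using x G by (induction n) (auto simp: additive_subgrp_def)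
    then have "{p + nmult n x | p n. p \<in> P} \<subseteq> G" using P(2) G unfolding additive_subgrp_def by blast
    moreover have "P \<subseteq> {p + nmult n x | p n. p \<in> P}"
    proof
      fix p assume "p \<in> P"
      moreover have "p = p + nmult 0 x" by simp
      ultimately show "p \<in> {p + nmult n x | p n. p \<in> P}" by blast
    qed
    ultimately have e: "{p + nmult n x | p n. p \<in> P} = P" using max c by blast
    have "x = 0 + nmult 1 x" by simp
    moreover have "0 \<in> P" using P unfolding positive_cone_def by blast
    ultimately have "x \<in> {p + nmult n x | p n. p \<in> P}" by blast
    with e x show False by blast
  qed
  have "x \<in> P \<or> - x \<in> P" if x: "x \<in> G" for x
  proof (rule ccontr)
    assume n: "\<not> ?thesis"
    have "- x \<in> G" using x G unfolding additive_subgrp_def by blast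
    then obtain k l where k: "k > 0" "- nmult k x \<in> P" and l: "l > 0" "- nmult l (- x) \<in> P"
      using key x n by blast
    have "nmult l (- nmult k x) \<in> P" using k nmult_in_cone P by blast
    then have 1: "- nmult (l * k) x \<in> P" by (simp add: nmult_mult)
    have "nmult k (nmult l x) \<in> P" using l nmult_in_cone P by simp
    then have "nmult (l * k) x \<in> P" by (simp add: nmult_mult[symmetric] mult.commute)
    with 1 have "nmult (l * k) x = 0" using P unfolding positive_cone_def by blast
    then have "x = 0" using tf x k l unfolding torsion_free_def by (metis mult_pos_pos)
    then show False using n P unfolding positive_cone_def by blast
  qed
  then show ?thesis using P by blast
qed

text \<open>
  For a total order compatible with addition, the sum of the two maxima is attained only once.
\<close>

lemma unique_sum:
  assumes G: "additive_subgrp G" and tf: "torsion_free G"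
    and F: "finite F" "F \<noteq> {}" "F \<subseteq> G" and E: "finite E" "E \<noteq> {}" "E \<subseteq> G"
  shows "\<exists>\<alpha>\<in>F. \<exists>\<beta>\<in>E. \<forall>\<gamma>\<in>F. \<forall>\<delta>\<in>E. \<gamma> + \<delta> = \<alpha> + \<beta> \<longrightarrow> \<gamma> = \<alpha>"
proof -
  obtain P where P: "positive_cone P" and tot: "\<And>x. x \<in> G \<Longrightarrow> x \<in> P \<or> - x \<in> P"
    using total_cone_exists[OF G tf] by blast
  have max: "\<exists>\<alpha>\<in>F. \<forall>\<gamma>\<in>F. \<alpha> - \<gamma> \<in> P" if "finite F" "F \<noteq> {}" "F \<subseteq> G" for F
    using that
  proof (induction F rule: finite_ne_induct)
    case (singleton x)
    then show ?case using P by (auto simp: positive_cone_def)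
  next
    case (insert x F)
    then obtain \<alpha> where a: "\<alpha> \<in> F" "\<And>\<gamma>. \<gamma> \<in> F \<Longrightarrow> \<alpha> - \<gamma> \<in> P" by auto
    have "\<alpha> \<in> G" "- x \<in> G" using a insert.prems G unfolding additive_subgrp_def by auto
    then have "\<alpha> + - x \<in> G" using G unfolding additive_subgrp_def by blast
    then have "\<alpha> - x \<in> P \<or> x - \<alpha> \<in> P" using tot[of "\<alpha> + - x"] by simp
    then show ?case
    proof
      assume "x - \<alpha> \<in> P"
      have "x - \<gamma> \<in> P" if "\<gamma> \<in> F" for \<gamma>
      proof -
        have "(x - \<alpha>) + (\<alpha> - \<gamma>) \<in> P" using \<open>x - \<alpha> \<in> P\<close> a(2)[OF that] P unfolding positive_cone_def by blast
        then show ?thesis by simp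
      qed
      moreover have "x - x \<in> P" using P unfolding positive_cone_def by simp
      ultimately show ?thesis by blast
    qed (use a in blast)
  qed
  obtain \<alpha> \<beta> where a: "\<alpha> \<in> F" "\<And>\<gamma>. \<gamma> \<in> F \<Longrightarrow> \<alpha> - \<gamma> \<in> P" and b: "\<beta> \<in> E" "\<And>\<delta>. \<delta> \<in> E \<Longrightarrow> \<beta> - \<delta> \<in> P"
    using max[OF F] max[OF E] by blast
  have "\<gamma> = \<alpha>" if "\<gamma> \<in> F" "\<delta> \<in> E" "\<gamma> + \<delta> = \<alpha> + \<beta>" for \<gamma> \<delta>
  proof -
    have "\<beta> - \<delta> = - (\<alpha> - \<gamma>)" using that(3) by (simp add: algebra_simps)
    then have "- (\<alpha> - \<gamma>) \<in> P" using b that by metis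
    then have "\<alpha> - \<gamma> = 0" using a that P unfolding positive_cone_def by blast
    then show ?thesis by simp
  qed
  then show ?thesis using a(1) b(1) by blast
qed

section \<open>Graded fields\<close>

text \<open>
  The components \<open>C \<alpha>\<close> are indexed by the whole group, with \<open>C \<alpha>\<close> zero for degrees that do not
  occur.  The ambient field \<open>K\<close> may be larger than the sum of the components; only that sum,
  called \<open>gspan\<close> below, is graded.
\<close>

locale gr_field = field K for K (structure) +
  fixes C :: "'g::ab_group_add \<Rightarrow> 'a set"
  assumes C_carrier: "C \<alpha> \<subseteq> carrier K"
    and C_zero: "\<zero> \<in> C \<alpha>"
    and C_minus: "x \<in> C \<alpha> \<Longrightarrow> y \<in> C \<alpha> \<Longrightarrow> x \<ominus> y \<in> C \<alpha>"
    and C_one: "\<one> \<in> C 0"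
    and C_mult: "x \<in> C \<alpha> \<Longrightarrow> y \<in> C \<beta> \<Longrightarrow> x \<otimes> y \<in> C (\<alpha> + \<beta>)"
    and C_inv: "x \<in> C \<alpha> \<Longrightarrow> x \<noteq> \<zero> \<Longrightarrow> inv x \<in> C (- \<alpha>)"
    and C_indep: "\<lbrakk>finite F; \<And>\<alpha>. \<alpha> \<in> F \<Longrightarrow> f \<alpha> \<in> C \<alpha>; (\<Oplus>\<alpha>\<in>F. f \<alpha>) = \<zero>; \<alpha> \<in> F\<rbrakk> \<Longrightarrow> f \<alpha> = \<zero>"
    and C_torsion: "torsion_free {\<alpha>. C \<alpha> \<noteq> {\<zero>}}"
begin

lemma C_in [simp, intro]: "x \<in> C \<alpha> \<Longrightarrow> x \<in> carrier K"
  using C_carrier by blast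

lemma C_neg: "x \<in> C \<alpha> \<Longrightarrow> \<ominus> x \<in> C \<alpha>"
  using C_minus[OF C_zero, of x \<alpha>] by (simp add: a_minus_def)

lemma C_add: "x \<in> C \<alpha> \<Longrightarrow> y \<in> C \<alpha> \<Longrightarrow> x \<oplus> y \<in> C \<alpha>"
  using C_minus[of x \<alpha> "\<ominus> y"] C_neg by (simp add: a_minus_def)

text \<open>
  A decomposition is a finitely supported family, presented together with a finite set
  containing the support so that sums of families need no bookkeeping.
\<close>

definition decomposes :: "'g set \<Rightarrow> 'a \<Rightarrow> ('g \<Rightarrow> 'a) \<Rightarrow> bool" where
  "decomposes F x f \<longleftrightarrow> finite F \<and> (\<forall>\<alpha>. f \<alpha> \<in> C \<alpha>) \<and> (\<forall>\<alpha>. \<alpha> \<notin> F \<longrightarrow> f \<alpha> = \<zero>) \<and> x = (\<Oplus>\<alpha>\<in>F. f \<alpha>)"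

lemma decomposes_mono:
  assumes "decomposes F x f" "F \<subseteq> E" "finite E"
  shows "decomposes E x f"
proof -
  have "(\<Oplus>\<alpha>\<in>F. f \<alpha>) = (\<Oplus>\<alpha>\<in>E. f \<alpha>)"
    using assms unfolding decomposes_def
    by (intro add.finprod_mono_neutral_cong_left) auto
  then show ?thesis using assms unfolding decomposes_def by auto
qed

lemma decomposes_carrier: "decomposes F x f \<Longrightarrow> x \<in> carrier K"
  unfolding decomposes_def by (auto intro!: finsum_closed)

lemma decomposes_add:
  assumes "decomposes F x f" "decomposes E y g"
  shows "decomposes (F \<union> E) (x \<oplus> y) (\<lambda>\<alpha>. f \<alpha> \<oplus> g \<alpha>)"
proof -
  have "finite (F \<union> E)" using assms unfolding decomposes_def by auto
  then have d: "decomposes (F \<union> E) x f" "decomposes (F \<union> E) y g"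
    using assms decomposes_mono by blast+
  have "(\<Oplus>\<alpha>\<in>F \<union> E. f \<alpha> \<oplus> g \<alpha>) = (\<Oplus>\<alpha>\<in>F \<union> E. f \<alpha>) \<oplus> (\<Oplus>\<alpha>\<in>F \<union> E. g \<alpha>)"
    using d unfolding decomposes_def by (intro finsum_addf) auto
  then show ?thesis using d C_add unfolding decomposes_def by auto
qed

lemma decomposes_mult:
  assumes "decomposes F x f" "c \<in> C \<delta>"
  shows "decomposes ((+) \<delta> ` F) (c \<otimes> x) (\<lambda>\<alpha>. c \<otimes> f (\<alpha> - \<delta>))"
proof -
  have "c \<otimes> (\<Oplus>\<alpha>\<in>F. f \<alpha>) = (\<Oplus>\<alpha>\<in>F. c \<otimes> f \<alpha>)"
    using assms unfolding decomposes_def by (intro finsum_rdistr) auto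
  also have "\<dots> = (\<Oplus>\<alpha>\<in>(+) \<delta> ` F. c \<otimes> f (\<alpha> - \<delta>))"
    using assms unfolding decomposes_def
    by (subst finsum_reindex) (auto simp: Pi_def intro!: m_closed)
  moreover have "c \<otimes> f (\<alpha> - \<delta>) \<in> C \<alpha>" for \<alpha>
    using C_mult[of c \<delta> "f (\<alpha> - \<delta>)" "\<alpha> - \<delta>"] assms unfolding decomposes_def by simp
  moreover have "c \<otimes> f (\<alpha> - \<delta>) = \<zero>" if "\<alpha> \<notin> (+) \<delta> ` F" for \<alpha>
  proof -
    have "\<alpha> - \<delta> \<notin> F" using that by (metis image_eqI add.commute diff_add_cancel)
    then show ?thesis using assms unfolding decomposes_def by auto
  qed
  ultimately show ?thesis using assms unfolding decomposes_def by auto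
qed

lemma decomposes_single:
  assumes "x \<in> C \<alpha>" shows "decomposes {\<alpha>} x (\<lambda>\<beta>. if \<beta> = \<alpha> then x else \<zero>)"
  unfolding decomposes_def using assms C_zero by auto

lemma decomposes_unique:
  assumes "decomposes F x f" "decomposes E x g" shows "f = g"
proof -
  have "decomposes ((+) 0 ` E) (\<ominus> \<one> \<otimes> x) (\<lambda>\<alpha>. \<ominus> \<one> \<otimes> g (\<alpha> - 0))"
    using decomposes_mult[OF assms(2), of "\<ominus> \<one>" 0] C_neg[OF C_one] by simp
  from decomposes_add[OF assms(1) this]
  have d: "decomposes (F \<union> E) (x \<oplus> \<ominus> \<one> \<otimes> x) (\<lambda>\<alpha>. f \<alpha> \<oplus> \<ominus> \<one> \<otimes> g \<alpha>)" by simp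
  have z: "y \<oplus> \<ominus> \<one> \<otimes> y = \<zero>" if "y \<in> carrier K" for y using that by (simp add: l_minus r_neg)
  have x: "x \<in> carrier K" using assms decomposes_carrier by blast
  show ?thesis
  proof
    fix \<alpha>
    have fg: "f \<alpha> \<in> carrier K" "g \<alpha> \<in> carrier K" using assms unfolding decomposes_def by auto
    have "f \<alpha> \<oplus> \<ominus> \<one> \<otimes> g \<alpha> = \<zero>"
    proof (cases "\<alpha> \<in> F \<union> E")
      case True
      then show ?thesis
        using d z[OF x] C_indep[of "F \<union> E" "\<lambda>\<alpha>. f \<alpha> \<oplus> \<ominus> \<one> \<otimes> g \<alpha>" \<alpha>] unfolding decomposes_def by auto
    next
      case False
      then show ?thesis using d unfolding decomposes_def by blast
    qed
    then show "f \<alpha> = g \<alpha>" using fg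
      by (metis add.inv_closed add.inv_equality l_minus l_one minus_minus one_closed)
  qed
qed

definition gspan :: "'a set" where
  "gspan = {x. \<exists>F f. decomposes F x f}"

definition hcomp :: "'g \<Rightarrow> 'a \<Rightarrow> 'a" where
  "hcomp \<alpha> x = (THE f. \<exists>F. decomposes F x f) \<alpha>"

lemma hcomp_eq: 
  assumes "decomposes F x f" shows "hcomp \<alpha> x = f \<alpha>"
proof -
  have "(THE f. \<exists>F. decomposes F x f) = f" using assms decomposes_unique by blast
  then show ?thesis unfolding hcomp_def by simp
qed

lemma gspan_decomposes:
  assumes "x \<in> gspan"
  obtains F where "decomposes F x (\<lambda>\<alpha>. hcomp \<alpha> x)"
proof -
  obtain F f where d: "decomposes F x f" using assms unfolding gspan_def by blast
  have "(\<lambda>\<alpha>. hcomp \<alpha> x) = f" using hcomp_eq[OF d] by blast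
  then show ?thesis using d that by simp
qed

lemma gspan_carrier [simp]: "x \<in> gspan \<Longrightarrow> x \<in> carrier K"
  unfolding gspan_def using decomposes_carrier by blast

lemma hcomp_in_C: "x \<in> gspan \<Longrightarrow> hcomp \<alpha> x \<in> C \<alpha>"
  by (metis gspan_decomposes decomposes_def)

lemma hcomp_carrier [simp]: "x \<in> gspan \<Longrightarrow> hcomp \<alpha> x \<in> carrier K"
  using hcomp_in_C by blast

lemma C_gspan: "x \<in> C \<alpha> \<Longrightarrow> x \<in> gspan"
  unfolding gspan_def using decomposes_single by blast

lemma hcomp_C: "x \<in> C \<alpha> \<Longrightarrow> hcomp \<beta> x = (if \<beta> = \<alpha> then x else \<zero>)"
  using hcomp_eq[OF decomposes_single] by simp

lemma hcomp_add:
  assumes "x \<in> gspan" "y \<in> gspan"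
  shows "x \<oplus> y \<in> gspan" "hcomp \<alpha> (x \<oplus> y) = hcomp \<alpha> x \<oplus> hcomp \<alpha> y"
proof -
  obtain F E where "decomposes F x (\<lambda>\<alpha>. hcomp \<alpha> x)" "decomposes E y (\<lambda>\<alpha>. hcomp \<alpha> y)"
    using assms gspan_decomposes by metis
  note d = decomposes_add[OF this]
  then show "x \<oplus> y \<in> gspan" unfolding gspan_def by blast
  show "hcomp \<alpha> (x \<oplus> y) = hcomp \<alpha> x \<oplus> hcomp \<alpha> y" using hcomp_eq[OF d] .
qed

lemma hcomp_mult:
  assumes "x \<in> gspan" "c \<in> C \<delta>"
  shows "c \<otimes> x \<in> gspan" "hcomp \<alpha> (c \<otimes> x) = c \<otimes> hcomp (\<alpha> - \<delta>) x"
proof -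
  obtain F where "decomposes F x (\<lambda>\<alpha>. hcomp \<alpha> x)"
    using assms gspan_decomposes by metis
  note d = decomposes_mult[OF this assms(2)]
  then show "c \<otimes> x \<in> gspan" unfolding gspan_def by blast
  show "hcomp \<alpha> (c \<otimes> x) = c \<otimes> hcomp (\<alpha> - \<delta>) x" using hcomp_eq[OF d] .
qed

lemma hcomp_minus:
  assumes "x \<in> gspan" "y \<in> gspan"
  shows "x \<ominus> y \<in> gspan" "hcomp \<alpha> (x \<ominus> y) = hcomp \<alpha> x \<ominus> hcomp \<alpha> y"
proof -
  have m: "x \<ominus> y = x \<oplus> \<ominus> \<one> \<otimes> y" using assms by (simp add: l_minus a_minus_def)
  note c = hcomp_mult[OF assms(2) C_neg[OF C_one]]
  show "x \<ominus> y \<in> gspan" unfolding m using hcomp_add[OF assms(1) c(1)] by blast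
  show "hcomp \<alpha> (x \<ominus> y) = hcomp \<alpha> x \<ominus> hcomp \<alpha> y" 
    unfolding m hcomp_add(2)[OF assms(1) c(1)] c(2) using assms by (simp add: l_minus a_minus_def)
qed

lemma gspan_zero: "\<zero> \<in> gspan" "hcomp \<alpha> \<zero> = \<zero>"
  using C_gspan[OF C_zero] hcomp_C[OF C_zero, of _ \<alpha>] by simp_all

lemma hcomp_finsum:
  assumes "finite I" "\<And>i. i \<in> I \<Longrightarrow> f i \<in> gspan"
  shows "(\<Oplus>i\<in>I. f i) \<in> gspan" "hcomp \<alpha> (\<Oplus>i\<in>I. f i) = (\<Oplus>i\<in>I. hcomp \<alpha> (f i))"
proof -
  have "(\<Oplus>i\<in>I. f i) \<in> gspan \<and> hcomp \<alpha> (\<Oplus>i\<in>I. f i) = (\<Oplus>i\<in>I. hcomp \<alpha> (f i))"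
    using assms
  proof (induction I rule: finite_induct)
    case (insert i I)
    then have "(\<Oplus>i\<in>insert i I. f i) = f i \<oplus> (\<Oplus>i\<in>I. f i)" by (intro finsum_insert) auto
    moreover have "(\<Oplus>i\<in>insert i I. hcomp \<alpha> (f i)) = hcomp \<alpha> (f i) \<oplus> (\<Oplus>i\<in>I. hcomp \<alpha> (f i))"
      using insert by (intro finsum_insert) auto
    ultimately show ?case using insert hcomp_add by auto
  qed (simp add: gspan_zero)
  then show "(\<Oplus>i\<in>I. f i) \<in> gspan" "hcomp \<alpha> (\<Oplus>i\<in>I. f i) = (\<Oplus>i\<in>I. hcomp \<alpha> (f i))" by auto
qed

text \<open>Cauchy product; the index set may be any finite set containing the support of \<open>x\<close>.\<close>

lemma hcomp_product:
  assumes "decomposes F x (\<lambda>\<alpha>. hcomp \<alpha> x)" "y \<in> gspan"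
  shows "x \<otimes> y \<in> gspan" "hcomp \<gamma> (x \<otimes> y) = (\<Oplus>\<alpha>\<in>F. hcomp \<alpha> x \<otimes> hcomp (\<gamma> - \<alpha>) y)"
proof -
  have x: "x = (\<Oplus>\<alpha>\<in>F. hcomp \<alpha> x)" and F: "finite F" and c: "\<And>\<alpha>. hcomp \<alpha> x \<in> C \<alpha>"
    using assms(1) unfolding decomposes_def by auto
  have "x \<otimes> y = (\<Oplus>\<alpha>\<in>F. hcomp \<alpha> x) \<otimes> y" using x by simp
  also have "\<dots> = (\<Oplus>\<alpha>\<in>F. hcomp \<alpha> x \<otimes> y)" using F c assms(2) by (intro finsum_ldistr) auto
  finally have e: "x \<otimes> y = (\<Oplus>\<alpha>\<in>F. hcomp \<alpha> x \<otimes> y)" .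
  have g: "hcomp \<alpha> x \<otimes> y \<in> gspan" for \<alpha> using hcomp_mult(1)[OF assms(2) c] .
  show "x \<otimes> y \<in> gspan" unfolding e by (rule hcomp_finsum(1)[OF F g])
  have "hcomp \<gamma> (x \<otimes> y) = (\<Oplus>\<alpha>\<in>F. hcomp \<gamma> (hcomp \<alpha> x \<otimes> y))"
    unfolding e by (rule hcomp_finsum(2)[OF F g])
  also have "\<dots> = (\<Oplus>\<alpha>\<in>F. hcomp \<alpha> x \<otimes> hcomp (\<gamma> - \<alpha>) y)"
    using hcomp_mult(2)[OF assms(2) c] by simp
  finally show "hcomp \<gamma> (x \<otimes> y) = (\<Oplus>\<alpha>\<in>F. hcomp \<alpha> x \<otimes> hcomp (\<gamma> - \<alpha>) y)" .
qed

section \<open>Graded subgroups, subrings and ideals\<close>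

definition homs :: "'a set" where
  "homs = (\<Union>\<alpha>. C \<alpha>)"

text \<open>
  The graded objects are ordinary subsets that contain the components of their elements:
  subgroups, subrings, and ideals and primes of a subring.
\<close>

definition gsub :: "'a set \<Rightarrow> bool" where
  "gsub M \<longleftrightarrow> M \<subseteq> gspan \<and> \<zero> \<in> M \<and> (\<forall>x\<in>M. \<forall>y\<in>M. x \<ominus> y \<in> M) \<and> (\<forall>x\<in>M. \<forall>\<alpha>. hcomp \<alpha> x \<in> M)"

definition gring :: "'a set \<Rightarrow> bool" where
  "gring T \<longleftrightarrow> gsub T \<and> \<one> \<in> T \<and> (\<forall>x\<in>T. \<forall>y\<in>T. x \<otimes> y \<in> T)"

definition gideal :: "'a set \<Rightarrow> 'a set \<Rightarrow> bool" where
  "gideal T I \<longleftrightarrow> gsub I \<and> I \<subseteq> T \<and> (\<forall>t\<in>T. \<forall>x\<in>I. t \<otimes> x \<in> I)"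

definition gprime :: "'a set \<Rightarrow> 'a set \<Rightarrow> bool" where
  "gprime T P \<longleftrightarrow> gideal T P \<and> \<one> \<notin> P \<and> (\<forall>x\<in>T. \<forall>y\<in>T. x \<otimes> y \<in> P \<longrightarrow> x \<in> P \<or> y \<in> P)"

lemma homs_carrier [simp]: "x \<in> homs \<Longrightarrow> x \<in> carrier K"
  unfolding homs_def by auto

lemma homs_mult: "x \<in> homs \<Longrightarrow> y \<in> homs \<Longrightarrow> x \<otimes> y \<in> homs"
  unfolding homs_def using C_mult by blast

lemma homs_one: "\<one> \<in> homs"
  unfolding homs_def using C_one by blast

lemma homs_inv: "x \<in> homs \<Longrightarrow> x \<noteq> \<zero> \<Longrightarrow> inv x \<in> homs"
  unfolding homs_def using C_inv by blast

lemma homs_pow: "x \<in> homs \<Longrightarrow> x [^] (n::nat) \<in> homs"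
  by (induction n) (auto simp: homs_one homs_mult)

lemma gsubI:
  assumes "M \<subseteq> gspan" "\<zero> \<in> M" "\<And>x y. x \<in> M \<Longrightarrow> y \<in> M \<Longrightarrow> x \<ominus> y \<in> M"
    "\<And>x \<alpha>. x \<in> M \<Longrightarrow> hcomp \<alpha> x \<in> M"
  shows "gsub M"
  using assms unfolding gsub_def by blast

lemma gsub_gspan: "gsub M \<Longrightarrow> x \<in> M \<Longrightarrow> x \<in> gspan"
  and gsub_zero: "gsub M \<Longrightarrow> \<zero> \<in> M"
  and gsub_minus: "gsub M \<Longrightarrow> x \<in> M \<Longrightarrow> y \<in> M \<Longrightarrow> x \<ominus> y \<in> M"
  and gsub_hcomp: "gsub M \<Longrightarrow> x \<in> M \<Longrightarrow> hcomp \<alpha> x \<in> M"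
  unfolding gsub_def by blast+

lemma gsub_carrier: "gsub M \<Longrightarrow> x \<in> M \<Longrightarrow> x \<in> carrier K"
  using gsub_gspan by auto

lemma gsub_neg: "gsub M \<Longrightarrow> x \<in> M \<Longrightarrow> \<ominus> x \<in> M"
  using gsub_minus[OF _ gsub_zero, of M x] gsub_carrier by (simp add: a_minus_def)

lemma gsub_add: "gsub M \<Longrightarrow> x \<in> M \<Longrightarrow> y \<in> M \<Longrightarrow> x \<oplus> y \<in> M"
  using gsub_minus[of M x "\<ominus> y"] gsub_neg gsub_carrier by (simp add: a_minus_def)

lemma gsub_finsum:
  assumes "gsub M" shows "finite F \<Longrightarrow> (\<And>i. i \<in> F \<Longrightarrow> f i \<in> M) \<Longrightarrow> (\<Oplus>i\<in>F. f i) \<in> M"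
proof (induction F rule: finite_induct)
  case (insert i F)
  then have "(\<Oplus>i\<in>insert i F. f i) = f i \<oplus> (\<Oplus>i\<in>F. f i)"
    using gsub_carrier[OF assms] by (intro finsum_insert) auto
  then show ?case using insert gsub_add[OF assms] by auto
qed (simp add: gsub_zero[OF assms])

lemma gsub_hcomps_imp_mem:
  assumes "gsub M" "x \<in> gspan" "\<And>\<alpha>. hcomp \<alpha> x \<in> M" shows "x \<in> M"
proof -
  obtain F where "decomposes F x (\<lambda>\<alpha>. hcomp \<alpha> x)" using assms gspan_decomposes by metis
  then show ?thesis using gsub_finsum[OF assms(1), of F "\<lambda>\<alpha>. hcomp \<alpha> x"] assms(3) unfolding decomposes_def by auto
qed

lemma hcomp_homs: "x \<in> gspan \<Longrightarrow> hcomp \<alpha> x \<in> homs"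
  using hcomp_in_C unfolding homs_def by blast

lemma gsub_subset:
  assumes "gsub M" "gsub N" "\<And>x. x \<in> M \<Longrightarrow> x \<in> homs \<Longrightarrow> x \<in> N" shows "M \<subseteq> N"
proof
  fix x assume x: "x \<in> M"
  then have "x \<in> gspan" using assms gsub_gspan by blast
  moreover have "hcomp \<alpha> x \<in> N" for \<alpha>
    using assms x gsub_hcomp hcomp_homs[OF \<open>x \<in> gspan\<close>] by blast
  ultimately show "x \<in> N" using gsub_hcomps_imp_mem[OF assms(2)] by blast
qed

lemma gsub_single: "gsub {\<zero>}"
  by (rule gsubI) (auto simp: gspan_zero a_minus_def)

definition gsum :: "'a set \<Rightarrow> 'a set \<Rightarrow> 'a set" where
  "gsum M N = {x \<oplus> y | x y. x \<in> M \<and> y \<in> N}"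

definition gscale :: "'a \<Rightarrow> 'a set \<Rightarrow> 'a set" where
  "gscale c M = {c \<otimes> x | x. x \<in> M}"

definition colon :: "'a set \<Rightarrow> 'a set \<Rightarrow> 'a \<Rightarrow> 'a set" where
  "colon T M c = {r \<in> T. c \<otimes> r \<in> M}"

text \<open>
  The preimage in \<open>T\<close> of the extension of \<open>M\<close> to the ring of fractions with denominators in \<open>S\<close>.
\<close>

definition sat :: "'a set \<Rightarrow> 'a set \<Rightarrow> 'a set \<Rightarrow> 'a set" where
  "sat T S M = {r \<in> T. \<exists>s\<in>S. s \<otimes> r \<in> M}"

lemma minus_distr: "\<lbrakk>x \<in> carrier K; y \<in> carrier K; x' \<in> carrier K; y' \<in> carrier K\<rbrakk>
   \<Longrightarrow> (x \<oplus> y) \<ominus> (x' \<oplus> y') = (x \<ominus> x') \<oplus> (y \<ominus> y')"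
  by algebra

lemma r_distr_minus: "\<lbrakk>x \<in> carrier K; y \<in> carrier K; c \<in> carrier K\<rbrakk>
   \<Longrightarrow> c \<otimes> (x \<ominus> y) = c \<otimes> x \<ominus> c \<otimes> y"
  by algebra

lemma gsub_gsum:
  assumes "gsub M" "gsub N" shows "gsub (gsum M N)"
proof (rule gsubI)
  note c = gsub_carrier[OF assms(1)] gsub_carrier[OF assms(2)]
  note g = gsub_gspan[OF assms(1)] gsub_gspan[OF assms(2)]
  show "gsum M N \<subseteq> gspan" unfolding gsum_def using g hcomp_add by auto
  have "\<zero> = \<zero> \<oplus> \<zero>" by simp
  then show "\<zero> \<in> gsum M N" unfolding gsum_def using gsub_zero assms by blast
  show "z \<ominus> w \<in> gsum M N" if prems: "z \<in> gsum M N" "w \<in> gsum M N" for z w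
  proof -
    obtain x y x' y' where "z = x \<oplus> y" "w = x' \<oplus> y'" "x \<in> M" "x' \<in> M" "y \<in> N" "y' \<in> N"
      using prems unfolding gsum_def by blast
    moreover from this have "z \<ominus> w = (x \<ominus> x') \<oplus> (y \<ominus> y')" using minus_distr c by simp
    ultimately show ?thesis unfolding gsum_def using assms gsub_minus by blast
  qed
  show "hcomp \<alpha> z \<in> gsum M N" if prems: "z \<in> gsum M N" for z \<alpha>
  proof -
    obtain x y where "z = x \<oplus> y" "x \<in> M" "y \<in> N" using prems unfolding gsum_def by blast
    moreover from this have "hcomp \<alpha> z = hcomp \<alpha> x \<oplus> hcomp \<alpha> y" using hcomp_add g by simp
    ultimately show ?thesis unfolding gsum_def using assms gsub_hcomp by blast
  qed
qed

lemma gsub_gscale: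
  assumes "gsub M" "c \<in> homs" shows "gsub (gscale c M)"
proof (rule gsubI)
  note g = gsub_gspan[OF assms(1)]
  obtain \<delta> where c: "c \<in> C \<delta>" using assms unfolding homs_def by blast
  show "gscale c M \<subseteq> gspan" unfolding gscale_def using g hcomp_mult(1)[OF _ c] by auto
  have "\<zero> = c \<otimes> \<zero>" using c by simp
  then show "\<zero> \<in> gscale c M" unfolding gscale_def using gsub_zero assms by blast
  show "z \<ominus> w \<in> gscale c M" if prems: "z \<in> gscale c M" "w \<in> gscale c M" for z w
  proof -
    obtain x y where "z = c \<otimes> x" "w = c \<otimes> y" "x \<in> M" "y \<in> M"
      using prems unfolding gscale_def by blast
    moreover from this have "z \<ominus> w = c \<otimes> (x \<ominus> y)" using r_distr_minus g assms(2) by simp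
    ultimately show ?thesis unfolding gscale_def using assms gsub_minus by blast
  qed
  show "hcomp \<alpha> z \<in> gscale c M" if prems: "z \<in> gscale c M" for z \<alpha>
  proof -
    obtain x where "z = c \<otimes> x" "x \<in> M" using prems unfolding gscale_def by blast
    moreover from this have "hcomp \<alpha> z = c \<otimes> hcomp (\<alpha> - \<delta>) x" using hcomp_mult(2)[OF _ c] g by simp
    ultimately show ?thesis unfolding gscale_def using assms gsub_hcomp by blast
  qed
qed

lemma hcomp_mult_shift: "c \<in> C \<delta> \<Longrightarrow> x \<in> gspan \<Longrightarrow> c \<otimes> hcomp \<alpha> x = hcomp (\<alpha> + \<delta>) (c \<otimes> x)"
  using hcomp_mult(2)[of x c \<delta> "\<alpha> + \<delta>"] by simp

lemma gsub_colon:
  assumes "gsub T" "gsub M" "c \<in> homs" shows "gsub (colon T M c)"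
proof (rule gsubI)
  obtain \<delta> where c: "c \<in> C \<delta>" using assms unfolding homs_def by blast
  show "colon T M c \<subseteq> gspan" unfolding colon_def using assms gsub_gspan by blast
  show "\<zero> \<in> colon T M c" unfolding colon_def using gsub_zero assms by simp
  show "x \<ominus> y \<in> colon T M c" if "x \<in> colon T M c" "y \<in> colon T M c" for x y
    using that r_distr_minus[of x y c] gsub_minus gsub_carrier assms unfolding colon_def by simp
  show "hcomp \<alpha> x \<in> colon T M c" if "x \<in> colon T M c" for x \<alpha>
    using that hcomp_mult_shift[OF c] gsub_hcomp gsub_gspan assms unfolding colon_def by simp
qed

lemma gsub_sat:
  assumes "gsub T" "gsub M" "S \<subseteq> homs" "\<one> \<in> S" "\<And>s t. s \<in> S \<Longrightarrow> t \<in> S \<Longrightarrow> s \<otimes> t \<in> S"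
    "\<And>s x. s \<in> S \<Longrightarrow> x \<in> M \<Longrightarrow> s \<otimes> x \<in> M"
  shows "gsub (sat T S M)"
proof (rule gsubI)
  show "sat T S M \<subseteq> gspan" unfolding sat_def using assms gsub_gspan by blast
  show "\<zero> \<in> sat T S M" unfolding sat_def using gsub_zero assms by force
  show "x \<ominus> y \<in> sat T S M" if "x \<in> sat T S M" "y \<in> sat T S M" for x y
  proof -
    obtain s t where st: "s \<in> S" "t \<in> S" "s \<otimes> x \<in> M" "t \<otimes> y \<in> M" and xy: "x \<in> T" "y \<in> T"
      using \<open>x \<in> sat T S M\<close> \<open>y \<in> sat T S M\<close> unfolding sat_def by blast
    have k: "s \<in> carrier K" "t \<in> carrier K" "x \<in> carrier K" "y \<in> carrier K"
      using st xy assms gsub_carrier by auto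
    have "(s \<otimes> t) \<otimes> (x \<ominus> y) = t \<otimes> (s \<otimes> x) \<ominus> s \<otimes> (t \<otimes> y)" using k by algebra
    moreover have "t \<otimes> (s \<otimes> x) \<ominus> s \<otimes> (t \<otimes> y) \<in> M"
      by (rule gsub_minus[OF assms(2)]) (use st assms(6) in blast)+
    ultimately have "(s \<otimes> t) \<otimes> (x \<ominus> y) \<in> M" by simp
    then show ?thesis unfolding sat_def using assms(5) st gsub_minus[OF assms(1) xy] by blast
  qed
  show "hcomp \<alpha> x \<in> sat T S M" if "x \<in> sat T S M" for x \<alpha>
  proof -
    obtain s where s: "s \<in> S" "s \<otimes> x \<in> M" and x: "x \<in> T" using \<open>x \<in> sat T S M\<close> unfolding sat_def by blast
    obtain \<delta> where c: "s \<in> C \<delta>" using s assms unfolding homs_def by blast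
    have "s \<otimes> hcomp \<alpha> x \<in> M" using hcomp_mult_shift[OF c] gsub_hcomp gsub_gspan assms s x by simp
    then show ?thesis unfolding sat_def using s x assms gsub_hcomp by blast
  qed
qed

lemma gsub_Int: "gsub M \<Longrightarrow> gsub N \<Longrightarrow> gsub (M \<inter> N)"
  unfolding gsub_def by auto

lemma gsub_Inter: "\<M> \<noteq> {} \<Longrightarrow> (\<And>M. M \<in> \<M> \<Longrightarrow> gsub M) \<Longrightarrow> gsub (\<Inter>\<M>)"
  unfolding gsub_def by blast

lemma gsub_Union_chain:
  assumes ne: "\<M> \<noteq> {}" and g: "\<And>M. M \<in> \<M> \<Longrightarrow> gsub M"
    and tot: "\<And>M N. M \<in> \<M> \<Longrightarrow> N \<in> \<M> \<Longrightarrow> M \<subseteq> N \<or> N \<subseteq> M"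
  shows "gsub (\<Union>\<M>)"
proof (rule gsubI)
  show "\<Union>\<M> \<subseteq> gspan" using g gsub_gspan by blast
  show "\<zero> \<in> \<Union>\<M>" using ne g gsub_zero by blast
  show "x \<ominus> y \<in> \<Union>\<M>" if "x \<in> \<Union>\<M>" "y \<in> \<Union>\<M>" for x y
  proof -
    obtain M where "M \<in> \<M>" "x \<in> M" "y \<in> M" using \<open>x \<in> \<Union>\<M>\<close> \<open>y \<in> \<Union>\<M>\<close> tot by blast
    then show ?thesis using g gsub_minus by blast
  qed
  show "hcomp \<alpha> x \<in> \<Union>\<M>" if "x \<in> \<Union>\<M>" for x \<alpha>
    using that g gsub_hcomp by blast
qed

lemma gringD: "gring T \<Longrightarrow> gsub T" "gring T \<Longrightarrow> \<one> \<in> T" "gring T \<Longrightarrow> x \<in> T \<Longrightarrow> y \<in> T \<Longrightarrow> x \<otimes> y \<in> T"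
  unfolding gring_def by blast+

lemma gring_pow: "gring T \<Longrightarrow> x \<in> T \<Longrightarrow> x [^] (n::nat) \<in> T"
  by (induction n) (auto intro: gringD)

lemma gidealD: "gideal T I \<Longrightarrow> gsub I" "gideal T I \<Longrightarrow> I \<subseteq> T"
  "gideal T I \<Longrightarrow> t \<in> T \<Longrightarrow> x \<in> I \<Longrightarrow> t \<otimes> x \<in> I"
  unfolding gideal_def by blast+

lemma gideal_r: "gring T \<Longrightarrow> gideal T I \<Longrightarrow> t \<in> T \<Longrightarrow> x \<in> I \<Longrightarrow> x \<otimes> t \<in> I"
  using gidealD[of T I] gringD[of T] gsub_carrier m_comm by metis

lemma gprimeD: "gprime T P \<Longrightarrow> gideal T P" "gprime T P \<Longrightarrow> \<one> \<notin> P"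
  "gprime T P \<Longrightarrow> x \<in> T \<Longrightarrow> y \<in> T \<Longrightarrow> x \<otimes> y \<in> P \<Longrightarrow> x \<in> P \<or> y \<in> P"
  unfolding gprime_def by blast+

lemma gideal_zero: "gring T \<Longrightarrow> gideal T {\<zero>}"
  unfolding gideal_def using gsub_single gsub_zero[OF gringD(1)] gsub_carrier[OF gringD(1)] by simp

lemma gprime_zero: "gring T \<Longrightarrow> gprime T {\<zero>}"
  unfolding gprime_def using gideal_zero gsub_carrier[OF gringD(1)] integral by (metis insert_iff empty_iff one_not_zero)

lemma gideal_ring: "gring T \<Longrightarrow> gideal T T"
  unfolding gideal_def using gringD by blast

lemma gideal_gsum:
  assumes "gring T" "gideal T I" "gideal T J" shows "gideal T (gsum I J)"
  unfolding gideal_def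
proof (intro conjI ballI)
  note i = gidealD[OF assms(2)] and j = gidealD[OF assms(3)] and T = gringD[OF assms(1)]
  show "gsub (gsum I J)" using gsub_gsum i j by blast
  show "gsum I J \<subseteq> T" unfolding gsum_def using i j gsub_add[OF T(1)] by blast
  fix t z assume t: "t \<in> T" and "z \<in> gsum I J"
  then obtain x y where z: "z = x \<oplus> y" "x \<in> I" "y \<in> J" unfolding gsum_def by blast
  then have "t \<otimes> z = t \<otimes> x \<oplus> t \<otimes> y" using gsub_carrier i(1) j(1) T(1) t by (auto simp: r_distr)
  then show "t \<otimes> z \<in> gsum I J" unfolding gsum_def using i(3) j(3) z t by blast
qed

lemma gideal_gscale:
  assumes "gring T" "gideal T I" "c \<in> T" "c \<in> homs" shows "gideal T (gscale c I)"
  unfolding gideal_def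
proof (intro conjI ballI)
  note i = gidealD[OF assms(2)] and T = gringD[OF assms(1)]
  show "gsub (gscale c I)" using gsub_gscale i assms by blast
  show "gscale c I \<subseteq> T" unfolding gscale_def using i T(3) assms by blast
  fix t z assume t: "t \<in> T" and "z \<in> gscale c I"
  then obtain x where z: "z = c \<otimes> x" "x \<in> I" unfolding gscale_def by blast
  then have "t \<otimes> z = c \<otimes> (t \<otimes> x)" using gsub_carrier i(1) T(1) t assms by (auto simp: m_lcomm)
  then show "t \<otimes> z \<in> gscale c I" unfolding gscale_def using i(3) z t by blast
qed

lemma gideal_colon:
  assumes "gring T" "gideal T I" "c \<in> homs" "c \<in> T" shows "gideal T (colon T I c)"
  unfolding gideal_def
proof (intro conjI ballI)
  note i = gidealD[OF assms(2)] and T = gringD[OF assms(1)]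
  show "gsub (colon T I c)" using gsub_colon i T assms by blast
  show "colon T I c \<subseteq> T" unfolding colon_def by blast
  fix t x assume t: "t \<in> T" and x: "x \<in> colon T I c"
  then have "c \<otimes> (t \<otimes> x) = t \<otimes> (c \<otimes> x)" 
    using gsub_carrier[OF T(1)] assms unfolding colon_def by (auto simp: m_lcomm)
  then show "t \<otimes> x \<in> colon T I c" using t x i(3) T(3) unfolding colon_def by auto
qed

definition mult_set :: "'a set \<Rightarrow> 'a set \<Rightarrow> bool" where
  "mult_set T S \<longleftrightarrow> S \<subseteq> T \<and> \<one> \<in> S \<and> (\<forall>s\<in>S. \<forall>t\<in>S. s \<otimes> t \<in> S)"

lemma gideal_sat:
  assumes "gring T" "gideal T I" "mult_set T S" "S \<subseteq> homs" shows "gideal T (sat T S I)"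
  unfolding gideal_def
proof (intro conjI ballI)
  note i = gidealD[OF assms(2)] and T = gringD[OF assms(1)]
  show "gsub (sat T S I)" using assms(3,4) i T unfolding mult_set_def by (intro gsub_sat) auto
  show "sat T S I \<subseteq> T" unfolding sat_def by blast
  fix t x assume t: "t \<in> T" and x: "x \<in> sat T S I"
  then obtain s where s: "s \<in> S" "s \<otimes> x \<in> I" "x \<in> T" unfolding sat_def by blast
  then have "s \<otimes> (t \<otimes> x) = t \<otimes> (s \<otimes> x)" 
    using gsub_carrier[OF T(1)] t assms by (auto simp: m_lcomm)
  then have "s \<otimes> (t \<otimes> x) \<in> I" using s t i(3) by simp
  then show "t \<otimes> x \<in> sat T S I" using t s T(3) unfolding sat_def by auto
qed

lemma sat_incr:
  assumes "gideal T I" "mult_set T S" shows "I \<subseteq> sat T S I"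
proof
  fix x assume x: "x \<in> I"
  then have "\<one> \<otimes> x \<in> I" using gsub_carrier[OF gidealD(1)[OF assms(1)]] by simp
  then show "x \<in> sat T S I"
    using x assms(2) gidealD(2)[OF assms(1)] unfolding sat_def mult_set_def by blast
qed

lemma gideal_restrict:
  assumes "gideal T I" "gring R" "R \<subseteq> T" shows "gideal R (I \<inter> R)"
  using assms gsub_Int unfolding gideal_def gring_def by blast

lemma gprime_restrict:
  assumes "gprime T Q" "gring R" "R \<subseteq> T" shows "gprime R (Q \<inter> R)"
proof -
  have "gideal R (Q \<inter> R)" using gideal_restrict gprimeD(1) assms by blast
  then show ?thesis using assms unfolding gprime_def gring_def by blast
qed

lemma C_nontrivial: "C \<alpha> \<noteq> {\<zero>} \<longleftrightarrow> (\<exists>x\<in>C \<alpha>. x \<noteq> \<zero>)"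
  using C_zero[of \<alpha>] by (metis empty_iff insertI1 insert_iff subsetI subset_singletonD)

lemma supports_subgroup: "additive_subgrp {\<alpha>. C \<alpha> \<noteq> {\<zero>}}"
proof -
  have "C 0 \<noteq> {\<zero>}" using C_one one_not_zero by (metis singletonD)
  moreover have "C (\<alpha> + \<beta>) \<noteq> {\<zero>}" if "C \<alpha> \<noteq> {\<zero>}" "C \<beta> \<noteq> {\<zero>}" for \<alpha> \<beta>
  proof -
    obtain x y where "x \<in> C \<alpha>" "x \<noteq> \<zero>" "y \<in> C \<beta>" "y \<noteq> \<zero>"
      using \<open>C \<alpha> \<noteq> {\<zero>}\<close> \<open>C \<beta> \<noteq> {\<zero>}\<close> unfolding C_nontrivial by blast
    then have "x \<otimes> y \<in> C (\<alpha> + \<beta>)" "x \<otimes> y \<noteq> \<zero>" using C_mult integral_iff[of x y] by auto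
    then show ?thesis by auto
  qed
  moreover have "C (- \<alpha>) \<noteq> {\<zero>}" if "C \<alpha> \<noteq> {\<zero>}" for \<alpha>
  proof -
    obtain x where x: "x \<in> C \<alpha>" "x \<noteq> \<zero>" using \<open>C \<alpha> \<noteq> {\<zero>}\<close> unfolding C_nontrivial by blast
    then have "x \<otimes> inv x = \<one>" by (simp add: field_Units)
    then have "inv x \<noteq> \<zero>" using x(1) by auto
    then show ?thesis using C_inv[OF x] by auto
  qed
  ultimately show ?thesis unfolding additive_subgrp_def by simp
qed

text \<open>
  If two elements lie outside the ideal, the degrees of their components outside it have a sum
  that is attained only once.  In that degree the product has exactly one summand outside the
  ideal.
\<close>

lemma gprimeI:
  assumes T: "gring T" and I: "gideal T I" and one: "\<one> \<notin> I"
    and hom: "\<And>x y. \<lbrakk>x \<in> T; y \<in> T; x \<in> homs; y \<in> homs; x \<otimes> y \<in> I\<rbrakk> \<Longrightarrow> x \<in> I \<or> y \<in> I"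
  shows "gprime T I"
  unfolding gprime_def
proof (intro conjI ballI impI I one)
  note i = gidealD[OF I] and t = gringD[OF T]
  fix x y assume x: "x \<in> T" and y: "y \<in> T" and xy: "x \<otimes> y \<in> I"
  show "x \<in> I \<or> y \<in> I"
  proof (rule ccontr)
    assume n: "\<not> ?thesis"
    have g: "x \<in> gspan" "y \<in> gspan" using x y t gsub_gspan by blast+
    obtain F E where F: "decomposes F x (\<lambda>\<alpha>. hcomp \<alpha> x)" and E: "decomposes E y (\<lambda>\<alpha>. hcomp \<alpha> y)"
      using g gspan_decomposes by metis
    let ?F = "{\<alpha>. hcomp \<alpha> x \<notin> I}" and ?E = "{\<alpha>. hcomp \<alpha> y \<notin> I}"
    have sub: "?F \<subseteq> F" "?E \<subseteq> E" using F E gsub_zero[OF i(1)] unfolding decomposes_def by force+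
    then have fin: "finite ?F" "finite ?E" using F E unfolding decomposes_def using finite_subset by blast+
    have ne: "?F \<noteq> {}" "?E \<noteq> {}" using n gsub_hcomps_imp_mem[OF i(1)] g by blast+
    have s: "?F \<subseteq> {\<alpha>. C \<alpha> \<noteq> {\<zero>}}" "?E \<subseteq> {\<alpha>. C \<alpha> \<noteq> {\<zero>}}"
      using hcomp_in_C g gsub_zero[OF i(1)] by (metis (mono_tags, lifting) Collect_mono singletonD)+
    obtain \<alpha> \<beta> where a: "\<alpha> \<in> ?F" and b: "\<beta> \<in> ?E"
      and u: "\<And>\<gamma> \<delta>. \<gamma> \<in> ?F \<Longrightarrow> \<delta> \<in> ?E \<Longrightarrow> \<gamma> + \<delta> = \<alpha> + \<beta> \<Longrightarrow> \<gamma> = \<alpha>"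
      using unique_sum[OF supports_subgroup C_torsion fin(1) ne(1) s(1) fin(2) ne(2) s(2)] by blast
    have aF: "\<alpha> \<in> F" using a sub by blast
    let ?p = "\<lambda>\<gamma>. hcomp \<gamma> x \<otimes> hcomp (\<alpha> + \<beta> - \<gamma>) y"
    have pk: "?p \<gamma> \<in> carrier K" for \<gamma> using g by simp
    have rest: "?p \<gamma> \<in> I" if "\<gamma> \<noteq> \<alpha>" for \<gamma>
    proof (cases "\<gamma> \<in> ?F")
      case True
      then have "\<alpha> + \<beta> - \<gamma> \<notin> ?E" using u[of \<gamma> "\<alpha> + \<beta> - \<gamma>"] that by auto
      then show ?thesis using i(3) gsub_hcomp[OF t(1) x] by blast
    next
      case False
      then show ?thesis using gideal_r[OF T I] gsub_hcomp[OF t(1) y] by blast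
    qed
    have fF: "finite F" using F unfolding decomposes_def by blast
    have "hcomp (\<alpha> + \<beta>) (x \<otimes> y) = (\<Oplus>\<gamma>\<in>F. ?p \<gamma>)" using hcomp_product(2)[OF F g(2)] .
    also have "\<dots> = (\<Oplus>\<gamma>\<in>insert \<alpha> (F - {\<alpha>}). ?p \<gamma>)" using aF by (simp add: insert_absorb)
    also have "\<dots> = ?p \<alpha> \<oplus> (\<Oplus>\<gamma>\<in>F - {\<alpha>}. ?p \<gamma>)"
      by (rule finsum_insert) (use fF pk in blast)+
    finally have e: "hcomp (\<alpha> + \<beta>) (x \<otimes> y) = ?p \<alpha> \<oplus> (\<Oplus>\<gamma>\<in>F - {\<alpha>}. ?p \<gamma>)" .
    have r: "(\<Oplus>\<gamma>\<in>F - {\<alpha>}. ?p \<gamma>) \<in> I" using fF rest by (intro gsub_finsum[OF i(1)]) auto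
    have "hcomp (\<alpha> + \<beta>) (x \<otimes> y) \<ominus> (\<Oplus>\<gamma>\<in>F - {\<alpha>}. ?p \<gamma>) \<in> I"
      using gsub_minus[OF i(1)] gsub_hcomp[OF i(1) xy] r by blast
    moreover have "hcomp (\<alpha> + \<beta>) (x \<otimes> y) \<ominus> (\<Oplus>\<gamma>\<in>F - {\<alpha>}. ?p \<gamma>) = ?p \<alpha>"
    proof -
      have "\<And>p q. p \<in> carrier K \<Longrightarrow> q \<in> carrier K \<Longrightarrow> (p \<oplus> q) \<ominus> q = p" by algebra
      then show ?thesis unfolding e using pk gsub_carrier[OF i(1) r] by blast
    qed
    ultimately have "hcomp \<alpha> x \<otimes> hcomp \<beta> y \<in> I" by simp
    then show False using hom[of "hcomp \<alpha> x" "hcomp \<beta> y"] a b gsub_hcomp[OF t(1)] x y hcomp_homs g by blast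
  qed
qed

text \<open>
  Take a homogeneous ideal that is maximal among those above \<open>J\<close> that avoid \<open>S\<close>.  If it
  contains neither \<open>x\<close> nor \<open>y\<close>, both enlargements meet \<open>S\<close>, hence so does the enlargement by
  \<open>x \<otimes> y\<close>.
\<close>

lemma gprime_exists:
  assumes T: "gring T" and J: "gideal T J" and S: "mult_set T S" and dis: "S \<inter> J = {}"
  shows "\<exists>Q. gprime T Q \<and> J \<subseteq> Q \<and> S \<inter> Q = {}"
proof -
  define Z where "Z = {I. gideal T I \<and> J \<subseteq> I \<and> S \<inter> I = {}}"
  have "\<exists>Q\<in>Z. \<forall>I\<in>Z. Q \<subseteq> I \<longrightarrow> I = Q"
  proof (rule subset_Zorn_nonempty)
    show "Z \<noteq> {}" using J dis unfolding Z_def by blast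
    fix \<C> assume ne: "\<C> \<noteq> {}" and ch: "subset.chain Z \<C>"
    have m: "gideal T I" "J \<subseteq> I" "S \<inter> I = {}" if "I \<in> \<C>" for I
      using ch that unfolding subset_chain_def Z_def by auto
    have tot: "P \<subseteq> Q \<or> Q \<subseteq> P" if "P \<in> \<C>" "Q \<in> \<C>" for P Q
      using ch that unfolding subset_chain_def by auto
    have "gsub (\<Union>\<C>)" by (rule gsub_Union_chain[OF ne gidealD(1)[OF m(1)] tot])
    then have "gideal T (\<Union>\<C>)" using m(1) unfolding gideal_def by blast
    then show "\<Union>\<C> \<in> Z" unfolding Z_def using m ne by blast
  qed
  then obtain Q where Q: "gideal T Q" "J \<subseteq> Q" "S \<inter> Q = {}"
    and max: "\<And>I. gideal T I \<Longrightarrow> Q \<subseteq> I \<Longrightarrow> S \<inter> I = {} \<Longrightarrow> I = Q"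
    unfolding Z_def by auto
  note q = gidealD[OF Q(1)] and t = gringD[OF T]
  have S1: "\<one> \<in> S" and Sm: "\<And>s t. s \<in> S \<Longrightarrow> t \<in> S \<Longrightarrow> s \<otimes> t \<in> S" using S unfolding mult_set_def by auto
  have ext: "\<exists>p\<in>Q. \<exists>r\<in>T. p \<oplus> x \<otimes> r \<in> S" if x: "x \<in> T" "x \<in> homs" "x \<notin> Q" for x
  proof (rule ccontr)
    assume "\<not> ?thesis"
    then have d: "S \<inter> gsum Q (gscale x T) = {}" unfolding gsum_def gscale_def by blast
    have "gideal T (gsum Q (gscale x T))" using gideal_gsum[OF T Q(1) gideal_gscale[OF T gideal_ring[OF T] x(1,2)]] .
    moreover have "Q \<subseteq> gsum Q (gscale x T)"
    proof
      fix p assume p: "p \<in> Q"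
      then have "p = p \<oplus> x \<otimes> \<zero>" using x q(1) gsub_carrier by simp
      then show "p \<in> gsum Q (gscale x T)" unfolding gsum_def gscale_def using p gsub_zero[OF t(1)] by blast
    qed
    ultimately have e: "gsum Q (gscale x T) = Q" using max d by blast
    have "x = \<zero> \<oplus> x \<otimes> \<one>" using x by simp
    then have "x \<in> gsum Q (gscale x T)" unfolding gsum_def gscale_def using gsub_zero[OF q(1)] t(2) by blast
    then show False using e x by blast
  qed
  have "gprime T Q"
  proof (rule gprimeI[OF T Q(1)])
    show "\<one> \<notin> Q" using S1 Q by blast
    fix x y assume x: "x \<in> T" and y: "y \<in> T" "x \<in> homs" "y \<in> homs" and xy: "x \<otimes> y \<in> Q"
    show "x \<in> Q \<or> y \<in> Q"
    proof (rule ccontr)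
      assume "\<not> ?thesis"
      then obtain p r p' r' where pr: "p \<in> Q" "r \<in> T" "p \<oplus> x \<otimes> r \<in> S" "p' \<in> Q" "r' \<in> T" "p' \<oplus> y \<otimes> r' \<in> S"
        using ext x y by metis
      have k: "p \<in> carrier K" "r \<in> carrier K" "p' \<in> carrier K" "r' \<in> carrier K" "x \<in> carrier K" "y \<in> carrier K"
        using pr x y gsub_carrier[OF t(1)] q(2) by auto
      have "(p \<oplus> x \<otimes> r) \<otimes> (p' \<oplus> y \<otimes> r') = ((p' \<oplus> y \<otimes> r') \<otimes> p \<oplus> (x \<otimes> r) \<otimes> p') \<oplus> (r \<otimes> r') \<otimes> (x \<otimes> y)"
        using k by algebra
      moreover have "\<dots> \<in> Q"
        by (intro gsub_add[OF q(1)] q(3)[OF _ xy] q(3)[OF _ pr(1)] q(3)[OF _ pr(4)] t(3)) (use pr x y xy q(2) S in \<open>auto simp: mult_set_def\<close>)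
      ultimately show False using Q(3) Sm pr by (metis disjoint_iff)
    qed
  qed
  then show ?thesis using Q by blast
qed

section \<open>Chain conditions and the principal ideal theorem\<close>

definition gnoeth :: "'a set \<Rightarrow> bool" where
  "gnoeth R \<longleftrightarrow> (\<forall>I :: nat \<Rightarrow> 'a set. (\<forall>n. gideal R (I n) \<and> I n \<subseteq> I (Suc n)) \<longrightarrow>
     (\<exists>N. \<forall>n\<ge>N. I n = I N))"

lemma gnoeth_induct [consumes 2, case_names step]:
  assumes R: "gnoeth R" and I: "gideal R I"
    and step: "\<And>I. gideal R I \<Longrightarrow> (\<And>J. gideal R J \<Longrightarrow> I \<subset> J \<Longrightarrow> \<Phi> J) \<Longrightarrow> \<Phi> I"
  shows "\<Phi> I"
proof -
  let ?r = "{(J, I). gideal R I \<and> gideal R J \<and> I \<subset> J}"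
  have "wf ?r"
    unfolding wf_iff_no_infinite_down_chain
  proof
    assume "\<exists>f. \<forall>i. (f (Suc i), f i) \<in> ?r"
    then obtain f where "\<forall>i. (f (Suc i), f i) \<in> ?r" by (elim exE)
    then have f: "gideal R (f i)" "f i \<subset> f (Suc i)" for i by simp_all
    have "gideal R (f n) \<and> f n \<subseteq> f (Suc n)" for n
      by (intro conjI f(1) psubset_imp_subset f(2))
    then obtain N where N: "\<forall>n\<ge>N. f n = f N" 
      using R unfolding gnoeth_def by (metis (no_types))
    have "f (Suc N) = f N" using N[rule_format, of "Suc N"] le_Suc_eq by blast
    then show False using f(2)[of N] by blast
  qed
  then have "gideal R I \<longrightarrow> \<Phi> I"
  proof (induction I rule: wf_induct_rule)
    case (less I)
    show ?case
    proof
      assume I: "gideal R I"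
      show "\<Phi> I"
      proof (rule step[OF I])
        fix J assume "gideal R J" "I \<subset> J"
        then show "\<Phi> J" using less[of J] I by simp
      qed
    qed
  qed
  then show ?thesis using I by blast
qed

text \<open>
  Denominators for the homogeneous localisation at \<open>P\<close>.
\<close>

definition hcompl :: "'a set \<Rightarrow> 'a set \<Rightarrow> 'a set" where
  "hcompl R P = {s \<in> R. s \<in> homs \<and> s \<notin> P}"

lemma mult_set_hcompl: "gring R \<Longrightarrow> gprime R P \<Longrightarrow> mult_set R (hcompl R P)"
  unfolding mult_set_def hcompl_def
  using gringD[of R] gprimeD[of R P] homs_one homs_mult by blast

lemma hcompl_homs: "hcompl R P \<subseteq> homs"
  unfolding hcompl_def by blast

text \<open>
  These are the contractions to \<open>R\<close> of homogeneous ideals of the localisation at \<open>S\<close>.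
\<close>

definition saturated :: "'a set \<Rightarrow> 'a set \<Rightarrow> 'a set \<Rightarrow> bool" where
  "saturated R S J \<longleftrightarrow> gideal R J \<and> (\<forall>r\<in>R. \<forall>s\<in>S. s \<otimes> r \<in> J \<longrightarrow> r \<in> J)"

lemma saturatedD: "saturated R S J \<Longrightarrow> gideal R J"
  "saturated R S J \<Longrightarrow> r \<in> R \<Longrightarrow> s \<in> S \<Longrightarrow> s \<otimes> r \<in> J \<Longrightarrow> r \<in> J"
  unfolding saturated_def by blast+

lemma saturated_sat:
  assumes R: "gring R" and S: "mult_set R S" "S \<subseteq> homs" and I: "gideal R I"
  shows "saturated R S (sat R S I)"
  unfolding saturated_def
proof (intro conjI ballI impI)
  show "gideal R (sat R S I)" using gideal_sat[OF R I S] .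
  fix r s assume r: "r \<in> R" "s \<in> S" "s \<otimes> r \<in> sat R S I"
  then obtain t where t: "t \<in> S" "t \<otimes> (s \<otimes> r) \<in> I" unfolding sat_def by blast
  then have "(t \<otimes> s) \<otimes> r \<in> I"
    using r S gsub_carrier[OF gringD(1)[OF R]] by (subst m_assoc) auto
  moreover have "t \<otimes> s \<in> S" using S r t unfolding mult_set_def by blast
  ultimately show "r \<in> sat R S I" using r unfolding sat_def by blast
qed

lemma sat_least: "saturated R S J \<Longrightarrow> I \<subseteq> J \<Longrightarrow> sat R S I \<subseteq> J"
  unfolding sat_def saturated_def by blast

lemma sat_mono: "I \<subseteq> J \<Longrightarrow> sat R S I \<subseteq> sat R S J"
  unfolding sat_def by blast

lemma gsum_mono: "I \<subseteq> I' \<Longrightarrow> J \<subseteq> J' \<Longrightarrow> gsum I J \<subseteq> gsum I' J'"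
  unfolding gsum_def by blast

lemma gsum_left: "gsub I \<Longrightarrow> gsub J \<Longrightarrow> I \<subseteq> gsum I J"
proof
  fix x assume "gsub I" "gsub J" "x \<in> I"
  then have "x = x \<oplus> \<zero>" "\<zero> \<in> J" using gsub_carrier gsub_zero by auto
  then show "x \<in> gsum I J" unfolding gsum_def using \<open>x \<in> I\<close> by blast
qed

lemma gsum_right: "gsub I \<Longrightarrow> gsub J \<Longrightarrow> J \<subseteq> gsum I J"
proof
  fix x assume "gsub I" "gsub J" "x \<in> J"
  then have "x = \<zero> \<oplus> x" "\<zero> \<in> I" using gsub_carrier gsub_zero by auto
  then show "x \<in> gsum I J" unfolding gsum_def using \<open>x \<in> J\<close> by blast
qed

lemma gscale_self: "gring R \<Longrightarrow> c \<in> homs \<Longrightarrow> c \<in> gscale c R"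
  unfolding gscale_def using gringD(2)[of R] by force

lemma gscale_subset: "gideal R I \<Longrightarrow> gring R \<Longrightarrow> c \<in> I \<Longrightarrow> gscale c R \<subseteq> I"
  unfolding gscale_def using gideal_r by blast

lemma gideal_one: "gring R \<Longrightarrow> gideal R I \<Longrightarrow> \<one> \<in> I \<Longrightarrow> I = R"
  using gidealD(2,3)[of R I] gsub_carrier[OF gringD(1)[of R]] by (metis r_one subsetI subset_antisym)

text \<open>
  Homogeneous multipliers suffice: if \<open>w\<close> lies outside \<open>P\<close>, so does one of its components, and the
  product of that component with \<open>r\<close> is a component of \<open>w \<otimes> r\<close>.
\<close>

lemma saturated_cancel:
  assumes R: "gring R" and P: "gprime R P" and J: "saturated R (hcompl R P) J"
    and w: "w \<in> R" "w \<notin> P" and r: "r \<in> R" "r \<in> homs" and wr: "w \<otimes> r \<in> J"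
  shows "r \<in> J"
proof -
  have g: "w \<in> gspan" using w gsub_gspan[OF gringD(1)[OF R]] by blast
  obtain \<alpha> where a: "hcomp \<alpha> w \<notin> P"
    using gsub_hcomps_imp_mem[OF gidealD(1)[OF gprimeD(1)[OF P]] g] w by blast
  obtain \<delta> where d: "r \<in> C \<delta>" using r unfolding homs_def by blast
  have c: "hcomp \<alpha> w \<in> hcompl R P"
    unfolding hcompl_def using a hcomp_homs[OF g] gsub_hcomp[OF gringD(1)[OF R] w(1)] by blast
  have "r \<otimes> hcomp \<alpha> w \<in> J"
    using hcomp_mult_shift[OF d g] wr g r gsub_hcomp[OF gidealD(1)[OF saturatedD(1)[OF J]]] m_comm[of r w] by simp
  then have "hcomp \<alpha> w \<otimes> r \<in> J" using m_comm[of r "hcomp \<alpha> w"] g r by simp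
  then show ?thesis using saturatedD(2)[OF J r(1) c] by blast
qed

definition minimal_over :: "'a set \<Rightarrow> 'a set \<Rightarrow> 'a \<Rightarrow> bool" where
  "minimal_over R P a \<longleftrightarrow> gprime R P \<and> a \<in> P \<and> (\<forall>P'. gprime R P' \<and> P' \<subseteq> P \<and> a \<in> P' \<longrightarrow> P' = P)"

lemma saturated_full:
  assumes R: "gring R" and J: "saturated R S J" and S: "s \<in> S" "s \<in> J" "S \<subseteq> homs"
  shows "J = R"
proof -
  have "s \<otimes> \<one> \<in> J" using S by auto
  then have "\<one> \<in> J" using saturatedD(2)[OF J] gringD(2)[OF R] S by blast
  then show ?thesis using gideal_one[OF R saturatedD(1)[OF J]] by blast
qed

lemma saturated_colon:
  assumes R: "gring R" and J: "saturated R S J" and S: "S \<subseteq> R" and x: "x \<in> R" "x \<in> homs"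
  shows "saturated R S (colon R J x)"
  unfolding saturated_def
proof (intro conjI ballI impI)
  show "gideal R (colon R J x)" using gideal_colon[OF R saturatedD(1)[OF J]] x by blast
  fix r s assume r: "r \<in> R" "s \<in> S" "s \<otimes> r \<in> colon R J x"
  then have "x \<otimes> (s \<otimes> r) \<in> J" unfolding colon_def by blast
  moreover have "x \<otimes> (s \<otimes> r) = s \<otimes> (x \<otimes> r)"
    using r x S gsub_carrier[OF gringD(1)[OF R]] by (intro m_lcomm) auto
  ultimately have "x \<otimes> r \<in> J" using saturatedD(2)[OF J] r x gringD(3)[OF R] by metis
  then show "r \<in> colon R J x" unfolding colon_def using r by blast
qed

text \<open>
  Localised at \<open>P\<close>, the ring \<open>R/a\<close> is graded Artinian.  The proof is by Noetherian induction on
  the ideal \<open>I\<close> below the chain.  If \<open>I\<close> is not contained in \<open>P\<close>, every \<open>J n\<close> is \<open>R\<close>.  If \<open>I\<close>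
  is a prime inside \<open>P\<close>, it equals \<open>P\<close>, and only two saturated ideals lie above it.  Otherwise
  there are homogeneous \<open>x\<close> and \<open>y\<close> outside \<open>I\<close> with \<open>x \<otimes> y \<in> I\<close>.  The ideals \<open>J n + x R\<close> lie
  above \<open>I + x R\<close>, and the colon ideals \<open>J n : x\<close> lie above \<open>I : x\<close>, which contains \<open>y\<close>; both
  chains stabilise by induction, and together they determine \<open>J n\<close>.
\<close>

lemma saturated_chain_stabilises:
  assumes R: "gring R" and N: "gnoeth R" and P: "minimal_over R P a"
    and I0: "gideal R I" "a \<in> I"
    and J0: "\<And>n. saturated R (hcompl R P) (J n)" "\<And>n. I \<subseteq> J n" "\<And>n. J (Suc n) \<subseteq> J n"
  shows "\<exists>N. \<forall>n\<ge>N. J n = J N"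
proof -
  let ?S = "hcompl R P"
  have Pp: "gprime R P" using P unfolding minimal_over_def by blast
  have S: "mult_set R ?S" "?S \<subseteq> homs" "?S \<subseteq> R"
    using mult_set_hcompl[OF R Pp] hcompl_homs unfolding hcompl_def by auto
  note t = gringD[OF R]
  define \<Phi> where "\<Phi> = (\<lambda>I. a \<in> I \<longrightarrow> (\<forall>J. (\<forall>n. saturated R ?S (J n) \<and> I \<subseteq> J n \<and> J (Suc n) \<subseteq> J n) \<longrightarrow>
      (\<exists>N::nat. \<forall>n\<ge>N. J n = J N)))"
  have \<Phi>D: "\<exists>N::nat. \<forall>n\<ge>N. J n = J N"
    if "\<Phi> I" "a \<in> I" "\<And>n. saturated R ?S (J n) \<and> I \<subseteq> J n \<and> J (Suc n) \<subseteq> J n" for I J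
    using that(1)[unfolded \<Phi>_def] that(2,3) by simp
  have "\<Phi> I"
    using N I0(1)
  proof (induction rule: gnoeth_induct)
    case (step I)
    show ?case
      unfolding \<Phi>_def
    proof (intro impI allI)
      fix J :: "nat \<Rightarrow> 'a set"
      assume a: "a \<in> I" and J: "\<forall>n. saturated R ?S (J n) \<and> I \<subseteq> J n \<and> J (Suc n) \<subseteq> J n"
      have Js: "saturated R ?S (J n)" and IJ: "I \<subseteq> J n" for n using J by blast+
      have Ji: "gideal R (J n)" for n using saturatedD(1)[OF Js] .
      have dec: "J n \<subseteq> J m" if "m \<le> n" for m n using lift_Suc_antimono_le[of J m n] J that by blast
      have i: "gsub I" "I \<subseteq> R" using gidealD step.hyps by blast+
      have Pg: "gsub P" using gidealD(1)[OF gprimeD(1)[OF Pp]] .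
      show "\<exists>N. \<forall>n\<ge>N. J n = J N"
      proof (cases "I \<subseteq> P")
        case False
        then obtain s where s: "s \<in> I" "s \<in> homs" "s \<notin> P" using gsub_subset[OF i(1) Pg] by blast
        then have "s \<in> ?S" unfolding hcompl_def using i by blast
        then have "J n = R" for n using saturated_full[OF R Js _ _ S(2)] s IJ by blast
        then show ?thesis by blast
      next
        case IP: True
        show ?thesis
        proof (cases "gprime R I")
          case True
          then have IeqP: "I = P" using P IP a unfolding minimal_over_def by blast
          have two: "J n = P \<or> J n = R" for n
          proof (cases "J n \<subseteq> P")
            case True
            then show ?thesis using IJ IeqP by blast
          next
            case False
            then obtain s where s: "s \<in> J n" "s \<in> homs" "s \<notin> P"
              using gsub_subset[OF gidealD(1)[OF Ji] Pg] by blast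
            then have "s \<in> ?S" unfolding hcompl_def using gidealD(2)[OF Ji] by blast
            then show ?thesis using saturated_full[OF R Js _ _ S(2)] s by blast
          qed
          show ?thesis
          proof (cases "\<exists>N. J N = P")
            case True
            then obtain N where N: "J N = P" by blast
            have "J n = J N" if "n \<ge> N" for n using dec[OF that] N IJ[of n] IeqP by blast
            then show ?thesis by blast
          next
            case False
            then have "J n = R" for n using two[of n] by blast
            then show ?thesis by simp
          qed
        next
          case False
          have one: "\<one> \<notin> I" using IP gprimeD(2)[OF Pp] by blast
          obtain x y where xy: "x \<in> R" "y \<in> R" "x \<in> homs" "y \<in> homs" "x \<otimes> y \<in> I" "x \<notin> I" "y \<notin> I"
            using gprimeI[OF R step.hyps one] False by blast
          have xR: "gideal R (gscale x R)" using gideal_gscale[OF R gideal_ring[OF R]] xy by blast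
          have xRg: "gsub (gscale x R)" using gidealD(1)[OF xR] .
          \<comment> \<open>The ideals \<open>I + x R\<close> and \<open>I : x\<close> are both strictly larger than \<open>I\<close>.\<close>
          let ?I1 = "gsum I (gscale x R)" and ?I2 = "colon R I x"
          let ?J1 = "\<lambda>n. sat R ?S (gsum (J n) (gscale x R))" and ?J2 = "\<lambda>n. colon R (J n) x"
          have I1: "gideal R ?I1" using gideal_gsum[OF R step.hyps xR] .
          have "x \<in> ?I1" using gsum_right[OF i(1) xRg] gscale_self[OF R xy(3)] by blast
          then have "I \<subset> ?I1" using gsum_left[OF i(1) xRg] xy by blast
          then have phi1: "\<Phi> ?I1" using step.IH[OF I1] by blast
          have I2: "gideal R ?I2" using gideal_colon[OF R step.hyps] xy by blast
          have "I \<subseteq> ?I2" unfolding colon_def using gidealD(2,3)[OF step.hyps] xy by blast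
          moreover have "y \<in> ?I2" unfolding colon_def using xy by blast
          ultimately have sub2: "I \<subset> ?I2" using xy by blast
          then have phi2: "\<Phi> ?I2" using step.IH[OF I2] by blast
          have "\<exists>N. \<forall>n\<ge>N. ?J1 n = ?J1 N"
          proof -
            have "saturated R ?S (?J1 n) \<and> ?I1 \<subseteq> ?J1 n \<and> ?J1 (Suc n) \<subseteq> ?J1 n" for n
            proof (intro conjI)
              note g = gideal_gsum[OF R Ji xR]
              show "saturated R ?S (?J1 n)" using saturated_sat[OF R S(1,2) g] .
              show "?I1 \<subseteq> ?J1 n" using sat_incr[OF g S(1)] gsum_mono[OF IJ order_refl] by blast
              show "?J1 (Suc n) \<subseteq> ?J1 n" by (intro sat_mono gsum_mono order_refl) (use J in blast)
            qed
            moreover have "a \<in> ?I1" using \<open>I \<subset> ?I1\<close> a by blast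
            ultimately show ?thesis by (intro \<Phi>D[OF phi1])
          qed
          then obtain N1 where N1: "\<And>n. n \<ge> N1 \<Longrightarrow> ?J1 n = ?J1 N1" by blast
          have "\<exists>N. \<forall>n\<ge>N. ?J2 n = ?J2 N"
          proof -
            have "saturated R ?S (?J2 n) \<and> ?I2 \<subseteq> ?J2 n \<and> ?J2 (Suc n) \<subseteq> ?J2 n" for n
            proof (intro conjI)
              show "saturated R ?S (?J2 n)" using saturated_colon[OF R Js S(3) xy(1,3)] .
              show "?I2 \<subseteq> ?J2 n" unfolding colon_def using IJ by blast
              show "?J2 (Suc n) \<subseteq> ?J2 n" unfolding colon_def using J by blast
            qed
            moreover have "a \<in> ?I2" using sub2 a by blast
            ultimately show ?thesis by (intro \<Phi>D[OF phi2])
          qed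
          then obtain N2 where N2: "\<And>n. n \<ge> N2 \<Longrightarrow> ?J2 n = ?J2 N2" by blast
          let ?N = "max N1 N2"
          have "J n = J ?N" if n: "n \<ge> ?N" for n
          proof
            show "J n \<subseteq> J ?N" using dec[OF n] .
            show "J ?N \<subseteq> J n"
            proof
              fix r assume r: "r \<in> J ?N"
              then have rR: "r \<in> R" using gidealD(2)[OF Ji] by blast
              note gN = gidealD[OF Ji[of ?N]] and gn = gidealD[OF Ji[of n]]
              have "r \<in> ?J1 ?N"
                using r sat_incr[OF gideal_gsum[OF R Ji xR] S(1)] gsum_left[OF gN(1) xRg] by blast
              then have "r \<in> ?J1 n" using N1[of n] N1[of ?N] n by simp
              then obtain s j u where s: "s \<in> ?S" "s \<otimes> r = j \<oplus> x \<otimes> u" "j \<in> J n" "u \<in> R"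
                unfolding sat_def gsum_def gscale_def by blast
              have k: "s \<in> carrier K" "r \<in> carrier K" "j \<in> carrier K" "u \<in> carrier K" "x \<in> carrier K"
                using s rR xy S gsub_carrier[OF t(1)] gn(2) by auto
              have "x \<otimes> u = s \<otimes> r \<ominus> j" unfolding s(2) using k by algebra
              moreover have "s \<otimes> r \<in> J ?N" using gN(3) r s S by blast
              moreover have "j \<in> J ?N" using s dec[OF n] by blast
              ultimately have "x \<otimes> u \<in> J ?N" using gsub_minus[OF gN(1)] by simp
              then have "u \<in> ?J2 ?N" unfolding colon_def using s by blast
              then have "u \<in> ?J2 n" using N2[of n] N2[of ?N] n by simp
              then have "x \<otimes> u \<in> J n" unfolding colon_def by blast
              then have "s \<otimes> r \<in> J n" unfolding s(2) using s gsub_add[OF gn(1)] by blast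
              then show "r \<in> J n" using saturatedD(2)[OF Js rR s(1)] by blast
            qed
          qed
          then show ?thesis by blast
        qed
      qed
    qed
  qed
  then show ?thesis by (rule \<Phi>D[OF _ I0(2)]) (intro conjI J0)
qed

lemma pow_nonzero: "c \<in> carrier K \<Longrightarrow> c \<noteq> \<zero> \<Longrightarrow> c [^] (n::nat) \<noteq> \<zero>"
  by (induction n) (auto simp: integral_iff)

lemma gprime_pow: "gring R \<Longrightarrow> gprime R P \<Longrightarrow> x \<in> R \<Longrightarrow> x [^] (n::nat) \<in> P \<Longrightarrow> x \<in> P"
proof (induction n)
  case (Suc n)
  then show ?case using gprimeD(3)[of R P "x [^] n" x] gring_pow[of R x n] by auto
qed (use gprimeD(2) in auto)

text \<open>
  Nakayama's lemma for \<open>J / M\<close> over the localisation at \<open>P\<close>.  Instead of generators of \<open>J\<close> it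
  uses the ascending chain condition: let \<open>L\<close> be a largest saturated ideal with \<open>M \<subseteq> L \<subset> J\<close>.  If
  \<open>a \<otimes> r \<notin> L\<close> for some homogeneous \<open>r \<in> J\<close>, then adjoining \<open>a \<otimes> r\<close> to \<open>L\<close> gives all of \<open>J\<close>, so
  \<open>s \<otimes> r = i \<oplus> a \<otimes> r \<otimes> u\<close> with \<open>i \<in> L\<close> and \<open>s \<notin> P\<close>.  As \<open>s \<ominus> a \<otimes> u\<close> lies outside \<open>P\<close>, this puts
  \<open>r\<close> into \<open>L\<close>, a contradiction.  So \<open>a \<otimes> J \<subseteq> L\<close>, and then \<open>J \<subseteq> L\<close>.
\<close>

lemma graded_nakayama:
  assumes R: "gring R" and N: "gnoeth R" and P: "gprime R P" and a: "a \<in> P" "a \<in> homs"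
    and J: "saturated R (hcompl R P) J" and M: "saturated R (hcompl R P) M" "M \<subseteq> J"
    and gen: "J \<subseteq> sat R (hcompl R P) (gsum M (gscale a J))"
  shows "J = M"
proof -
  let ?S = "hcompl R P"
  have S: "mult_set R ?S" "?S \<subseteq> homs" "?S \<subseteq> R"
    using mult_set_hcompl[OF R P] hcompl_homs unfolding hcompl_def by auto
  note t = gringD[OF R] and j = gidealD[OF saturatedD(1)[OF J]] and p = gidealD[OF gprimeD(1)[OF P]]
  have aR: "a \<in> R" using a p by blast
  define \<Phi> where "\<Phi> = (\<lambda>L. saturated R ?S L \<longrightarrow> M \<subseteq> L \<longrightarrow> L \<subseteq> J \<longrightarrow> L = J)"
  have "\<Phi> M"
    using N saturatedD(1)[OF M(1)]
  proof (induction rule: gnoeth_induct)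
    case (step L)
    show ?case
      unfolding \<Phi>_def
    proof (intro impI)
      assume Ls: "saturated R ?S L" and M_le: "M \<subseteq> L" and LJ: "L \<subseteq> J"
      note l = gidealD[OF step.hyps]
      have aJ: "a \<otimes> r \<in> L" if r: "r \<in> J" "r \<in> homs" for r
      proof (rule ccontr)
        assume ar: "a \<otimes> r \<notin> L"
        have arR: "a \<otimes> r \<in> R" "a \<otimes> r \<in> homs" "a \<otimes> r \<in> J"
          using r a aR j t homs_mult by blast+
        let ?G = "gscale (a \<otimes> r) R"
        have G: "gideal R ?G" using gideal_gscale[OF R gideal_ring[OF R] arR(1,2)] .
        have LG: "gideal R (gsum L ?G)" using gideal_gsum[OF R step.hyps G] .
        have "L \<subseteq> gsum L ?G" "a \<otimes> r \<in> gsum L ?G"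
          using gsum_left[OF l(1) gidealD(1)[OF G]] gsum_right[OF l(1) gidealD(1)[OF G]] gscale_self[OF R arR(2)]
          by blast+
        then have sup: "L \<subset> sat R ?S (gsum L ?G)" using ar sat_incr[OF LG S(1)] by blast
        have "gsum L ?G \<subseteq> J"
          unfolding gsum_def using LJ gscale_subset[OF saturatedD(1)[OF J] R arR(3)] gsub_add[OF j(1)] by blast
        then have "sat R ?S (gsum L ?G) \<subseteq> J" using sat_least[OF J] by blast
        moreover have "\<Phi> (sat R ?S (gsum L ?G))" using step.IH[OF gideal_sat[OF R LG S(1,2)] sup] .
        ultimately have "sat R ?S (gsum L ?G) = J"
          unfolding \<Phi>_def using saturated_sat[OF R S(1,2) LG] sup M_le by blast
        then have "r \<in> sat R ?S (gsum L ?G)" using r by blast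
        then obtain s i u where s: "s \<in> ?S" "s \<otimes> r = i \<oplus> (a \<otimes> r) \<otimes> u" "i \<in> L" "u \<in> R"
          unfolding sat_def gsum_def gscale_def by blast
        have k: "s \<in> carrier K" "r \<in> carrier K" "i \<in> carrier K" "u \<in> carrier K" "a \<in> carrier K"
          using s r a S gsub_carrier[OF t(1)] l(2) by auto
        have "(s \<ominus> a \<otimes> u) \<otimes> r = s \<otimes> r \<ominus> (a \<otimes> r) \<otimes> u" using k by algebra
        also have "\<dots> = i" unfolding s(2) using k by algebra
        finally have e: "(s \<ominus> a \<otimes> u) \<otimes> r \<in> L" using s by simp
        have au: "a \<otimes> u \<in> P" using gideal_r[OF R gprimeD(1)[OF P]] a s by blast
        have sR: "s \<in> R" "s \<notin> P" using s unfolding hcompl_def by blast+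
        have "s = (s \<ominus> a \<otimes> u) \<oplus> a \<otimes> u" using k by algebra
        then have "s \<ominus> a \<otimes> u \<notin> P" using gsub_add[OF p(1) _ au] sR by metis
        moreover have "s \<ominus> a \<otimes> u \<in> R" using gsub_minus[OF t(1) sR(1)] au p(2) by blast
        ultimately have "r \<in> L" using saturated_cancel[OF R P Ls _ _ _ r(2) e] r j by blast
        then show False using ar l aR by blast
      qed
      have "gsub (colon R L a)" using gsub_colon[OF t(1) l(1) a(2)] .
      then have "J \<subseteq> colon R L a"
        using gsub_subset[OF j(1)] aJ j(2) unfolding colon_def by blast
      then have "gscale a J \<subseteq> L" unfolding gscale_def colon_def by blast
      then have "gsum M (gscale a J) \<subseteq> L" unfolding gsum_def using M_le gsub_add[OF l(1)] by blast
      then show "L = J" using gen sat_least[OF Ls] LJ by blast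
    qed
  qed
  then show ?thesis unfolding \<Phi>_def using M by blast
qed

text \<open>
  Krull's proof.  For a nonzero homogeneous \<open>c \<in> Q\<close>, the contractions \<open>J n\<close> of the ideals
  generated by \<open>c\<^sup>n\<close> in the localisation at \<open>Q\<close> play the role of symbolic powers.  The
  chain \<open>J n + a R\<close> stabilises; since \<open>a \<notin> Q\<close>, this gives \<open>J n = J (n + 1) + a J n\<close> locally at
  \<open>P\<close>, and Nakayama yields \<open>J n = J (n + 1)\<close>.  Then \<open>c\<close> is a unit at \<open>Q\<close>, which is absurd.
\<close>

lemma principal_ideal_theorem:
  assumes R: "gring R" and N: "gnoeth R" and P: "minimal_over R P a" and a: "a \<in> homs"
    and Q: "gprime R Q" "Q \<subseteq> P" "a \<notin> Q"
  shows "Q = {\<zero>}"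
proof (rule ccontr)
  assume "Q \<noteq> {\<zero>}"
  note t = gringD[OF R] and q = gidealD[OF gprimeD(1)[OF Q(1)]]
  have Pp: "gprime R P" "a \<in> P" using P unfolding minimal_over_def by blast+
  have aR: "a \<in> R" using gidealD(2)[OF gprimeD(1)[OF Pp(1)]] Pp by blast
  have "\<not> Q \<subseteq> {\<zero>}" using \<open>Q \<noteq> {\<zero>}\<close> gsub_zero[OF q(1)] by blast
  then obtain c where c: "c \<in> Q" "c \<in> homs" "c \<noteq> \<zero>" using gsub_subset[OF q(1) gsub_single] by blast
  have cR: "c \<in> R" using c q by blast
  let ?S = "hcompl R P" and ?S1 = "hcompl R Q"
  have S: "mult_set R ?S" "?S \<subseteq> homs" "?S \<subseteq> R" "mult_set R ?S1" "?S1 \<subseteq> homs" "?S1 \<subseteq> R" "?S \<subseteq> ?S1"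
    using mult_set_hcompl[OF R Pp(1)] mult_set_hcompl[OF R Q(1)] hcompl_homs Q(2) unfolding hcompl_def by auto
  define J where "J = (\<lambda>n::nat. sat R ?S1 (gscale (c [^] n) R))"
  have cn: "gideal R (gscale (c [^] n) R)" for n :: nat
    using gideal_gscale[OF R gideal_ring[OF R]] gring_pow[OF R cR] homs_pow[OF c(2)] by blast
  have J1: "saturated R ?S1 (J n)" for n unfolding J_def using saturated_sat[OF R S(4,5) cn] .
  then have Js: "saturated R ?S (J n)" for n using S(7) unfolding saturated_def by blast
  have Ji: "gideal R (J n)" for n using saturatedD(1)[OF Js] .
  have "gscale (c [^] Suc n) R \<subseteq> gscale (c [^] n) R" for n :: nat
  proof (rule gscale_subset[OF cn R])
    show "c [^] Suc n \<in> gscale (c [^] n) R" unfolding gscale_def using cR by auto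
  qed
  then have Jdec: "J (Suc n) \<subseteq> J n" for n unfolding J_def by (intro sat_mono)
  have aRi: "gideal R (gscale a R)" using gideal_gscale[OF R gideal_ring[OF R] aR a] .
  let ?M = "\<lambda>n. sat R ?S (gsum (J n) (gscale a R))"
  have "\<exists>N. \<forall>n\<ge>N. ?M n = ?M N"
  proof (rule saturated_chain_stabilises[OF R N P aRi gscale_self[OF R a]])
    note g = gideal_gsum[OF R Ji aRi]
    show "saturated R ?S (?M n)" for n using saturated_sat[OF R S(1,2) g] .
    show "gscale a R \<subseteq> ?M n" for n
      using sat_incr[OF g S(1)] gsum_right[OF gidealD(1)[OF Ji] gidealD(1)[OF aRi]] by blast
    show "?M (Suc n) \<subseteq> ?M n" for n using Jdec by (intro sat_mono gsum_mono) auto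
  qed
  then obtain n where n: "?M (Suc n) = ?M n" by (metis le_Suc_eq order_refl)
  have "J n = J (Suc n)"
  proof (rule graded_nakayama[OF R N Pp a Js Js Jdec], rule subsetI)
    fix r assume r: "r \<in> J n"
    note gn = gidealD[OF Ji[of n]]
    have rR: "r \<in> R" using r gn by blast
    have "r \<in> ?M n" using r sat_incr[OF gideal_gsum[OF R Ji aRi] S(1)] gsum_left[OF gn(1) gidealD(1)[OF aRi]] by blast
    then have "r \<in> ?M (Suc n)" using n by simp
    then obtain s j u where s: "s \<in> ?S" "s \<otimes> r = j \<oplus> a \<otimes> u" "j \<in> J (Suc n)" "u \<in> R"
      unfolding sat_def gsum_def gscale_def by blast
    have jn: "j \<in> J n" using s Jdec by blast
    have k: "s \<in> carrier K" "r \<in> carrier K" "j \<in> carrier K" "u \<in> carrier K" "a \<in> carrier K"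
      using s rR aR S gsub_carrier[OF t(1)] gn(2) jn by auto
    have "a \<otimes> u = s \<otimes> r \<ominus> j" unfolding s(2) using k by algebra
    moreover have "s \<otimes> r \<in> J n" using gn(3) r s S by blast
    ultimately have "a \<otimes> u \<in> J n" using gsub_minus[OF gn(1)] jn by simp
    moreover have "a \<in> ?S1" unfolding hcompl_def using a aR Q by blast
    ultimately have "u \<in> J n" using saturatedD(2)[OF J1] s by blast
    then have "s \<otimes> r \<in> gsum (J (Suc n)) (gscale a (J n))" unfolding gsum_def gscale_def using s by blast
    then show "r \<in> sat R ?S (gsum (J (Suc n)) (gscale a (J n)))" unfolding sat_def using s rR by blast
  qed
  moreover have "c [^] n \<in> J n"
    unfolding J_def using sat_incr[OF cn S(4)] gscale_self[OF R homs_pow[OF c(2)]] by blast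
  ultimately have "c [^] n \<in> J (Suc n)" by simp
  then obtain s u where s: "s \<in> ?S1" "u \<in> R" "s \<otimes> c [^] n = c [^] Suc n \<otimes> u"
    unfolding J_def sat_def gscale_def by blast
  have k: "s \<in> carrier K" "u \<in> carrier K" "c \<in> carrier K" using s S c gsub_carrier[OF t(1)] by auto
  have "c [^] n \<otimes> s = c [^] n \<otimes> (c \<otimes> u)" using s(3) k m_comm[of "c [^] n" s] by (simp add: m_assoc)
  then have "s = c \<otimes> u" using m_lcancel[OF pow_nonzero[OF k(3) c(3)]] k by simp
  then have "s \<in> Q" using gideal_r[OF R gprimeD(1)[OF Q(1)] s(2) c(1)] by simp
  then show False using s unfolding hcompl_def by blast
qed

section \<open>Overrings of a one-dimensional graded Noetherian domain\<close>

lemma avoid_imp_subset: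
  assumes "gprime R P" "gideal R I" "hcompl R P \<inter> I = {}"
  shows "I \<subseteq> P"
  by (rule gsub_subset[OF gidealD(1)[OF assms(2)] gidealD(1)[OF gprimeD(1)[OF assms(1)]]])
    (use assms(3) gidealD(2)[OF assms(2)] in \<open>auto simp: hcompl_def\<close>)

text \<open>
  The radical of \<open>c R\<close> in the localisation at \<open>P\<close> is \<open>P\<close>: a prime above \<open>c\<close> that avoids all
  \<open>s \<otimes> a\<^sup>m\<close> would lie inside \<open>P\<close> without containing \<open>a\<close>.
\<close>

lemma power_in_principal:
  assumes R: "gring R" and P: "minimal_over R P c" and c: "c \<in> homs"
    and a: "a \<in> P" "a \<in> homs"
  shows "\<exists>s\<in>hcompl R P. \<exists>m::nat. \<exists>r\<in>R. s \<otimes> a [^] m = c \<otimes> r"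
proof (rule ccontr)
  assume n: "\<not> ?thesis"
  have Pp: "gprime R P" "c \<in> P" using P unfolding minimal_over_def by blast+
  note p = gidealD[OF gprimeD(1)[OF Pp(1)]]
  have R': "a \<in> R" "c \<in> R" using p(2) a Pp by blast+
  note k = gsub_carrier[OF gringD(1)[OF R]]
  let ?S = "{s \<otimes> a [^] m | s (m::nat). s \<in> hcompl R P}"
  have S1: "hcompl R P \<subseteq> R" "\<one> \<in> hcompl R P" and Sm: "\<And>s t. s \<in> hcompl R P \<Longrightarrow> t \<in> hcompl R P \<Longrightarrow> s \<otimes> t \<in> hcompl R P"
    using mult_set_hcompl[OF R Pp(1)] unfolding mult_set_def by auto
  have "mult_set R ?S"
    unfolding mult_set_def
  proof (intro conjI ballI)
    show "?S \<subseteq> R" using S1 gringD(3)[OF R] gring_pow[OF R R'(1)] by blast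
    have "\<one> = \<one> \<otimes> a [^] (0::nat)" by simp
    then show "\<one> \<in> ?S" using S1 by blast
    fix x y assume "x \<in> ?S" "y \<in> ?S"
    then obtain s m t l where st: "s \<in> hcompl R P" "t \<in> hcompl R P" and "x = s \<otimes> a [^] (m::nat)" "y = t \<otimes> a [^] (l::nat)" by blast
    moreover have "x \<otimes> y = (s \<otimes> t) \<otimes> a [^] (m + l)"
    proof -
      have kk: "s \<in> carrier K" "t \<in> carrier K" "a \<in> carrier K" using st S1 k R' by auto
      have "x \<otimes> y = (s \<otimes> t) \<otimes> (a [^] m \<otimes> a [^] l)"
        unfolding \<open>x = _\<close> \<open>y = _\<close> using kk by (simp add: m_ac)
      then show ?thesis using kk by (simp add: nat_pow_mult)
    qed
    ultimately show "x \<otimes> y \<in> ?S" using Sm by blast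
  qed
  moreover have "gideal R (gscale c R)" using gideal_gscale[OF R gideal_ring[OF R] R'(2) c] .
  moreover have "?S \<inter> gscale c R = {}" using n unfolding gscale_def by blast
  ultimately obtain P' where P': "gprime R P'" "gscale c R \<subseteq> P'" "?S \<inter> P' = {}"
    using gprime_exists[OF R] by blast
  have "s \<in> ?S" if s: "s \<in> hcompl R P" for s
  proof -
    have "s = s \<otimes> a [^] (0::nat)" using s unfolding hcompl_def by simp
    then show ?thesis using s by blast
  qed
  then have "hcompl R P \<inter> P' = {}" using P'(3) by blast
  then have "P' \<subseteq> P" using avoid_imp_subset[OF Pp(1) gprimeD(1)[OF P'(1)]] by blast
  moreover have "c \<in> P'" using gscale_self[OF R c] P'(2) by blast
  ultimately have "P' = P" using P P' unfolding minimal_over_def by blast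
  moreover have "a \<in> ?S"
  proof -
    have "a = \<one> \<otimes> a [^] (1::nat)" using a by simp
    then show ?thesis using S1 by blast
  qed
  ultimately show False using P'(3) a by blast
qed

text \<open>
  First step of the Krull--Akizuki theorem, locally at \<open>P\<close>: when every \<open>t \<in> T\<close> is carried into
  \<open>R\<close> by a power of \<open>a\<close>, one power \<open>a\<^sup>N\<close> maps \<open>T\<close> into \<open>R + a\<^sup>N\<^sup>+\<^sup>1 T\<close>, and so
  \<open>T / a T \<cong> a\<^sup>N T / a\<^sup>N\<^sup>+\<^sup>1 T\<close> is a quotient of the ideal \<open>a\<^sup>N T \<inter> R\<close>.  The
  exponent \<open>N\<close> is where the chain of ideals \<open>(a\<^sup>n T \<inter> R) + a R\<close> stabilises.  If \<open>a\<^sup>m t\<close> lies in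
  \<open>R\<close> with \<open>m > N\<close>, it already lies in \<open>a\<^sup>m\<^sup>+\<^sup>1 T + a R\<close>; dividing by \<open>a\<close> shows that
  \<open>a\<^sup>m\<^sup>-\<^sup>1 (t - a t\<^sub>1)\<close> lies in \<open>R\<close>, so changing \<open>t\<close> modulo \<open>a T\<close> lowers \<open>m\<close>.
\<close>

lemma krull_akizuki_approximation:
  assumes R: "gring R" and N: "gnoeth R" and T: "gring T" "R \<subseteq> T" 
    and P: "minimal_over R P a" and a: "a \<in> homs" "a \<noteq> \<zero>"
  obtains N where "\<And>t m s. t \<in> T \<Longrightarrow> s \<in> hcompl R P \<Longrightarrow> s \<otimes> (a [^] (m::nat) \<otimes> t) \<in> R \<Longrightarrow>
    \<exists>s'\<in>hcompl R P. \<exists>r\<in>R. \<exists>t'\<in>T. s' \<otimes> (a [^] (N::nat) \<otimes> t) = a [^] Suc N \<otimes> t' \<oplus> r"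
proof -
  let ?S = "hcompl R P"
  have Pp: "gprime R P" "a \<in> P" using P unfolding minimal_over_def by blast+
  have aR: "a \<in> R" using gidealD(2)[OF gprimeD(1)[OF Pp(1)]] Pp by blast
  then have aT: "a \<in> T" using T by blast
  have S: "mult_set R ?S" "?S \<subseteq> homs" "?S \<subseteq> R" "\<one> \<in> ?S"
    and Sm: "\<And>s t. s \<in> ?S \<Longrightarrow> t \<in> ?S \<Longrightarrow> s \<otimes> t \<in> ?S"
    using mult_set_hcompl[OF R Pp(1)] hcompl_homs unfolding mult_set_def by auto
  note r = gringD[OF R] and t = gringD[OF T(1)]
  have k: "x \<in> carrier K" if "x \<in> T" for x using gsub_carrier[OF t(1) that] .
  have apT: "a [^] (n::nat) \<in> T" for n using gring_pow[OF T(1) aT] .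
  have aRi: "gideal R (gscale a R)" using gideal_gscale[OF R gideal_ring[OF R] aR a(1)] .
  have Ii: "gideal R (gscale (a [^] (n::nat)) T \<inter> R)" for n
    using gideal_restrict[OF gideal_gscale[OF T(1) gideal_ring[OF T(1)] apT homs_pow[OF a(1)]] R T(2)] .
  let ?I = "\<lambda>n::nat. sat R ?S (gsum (gscale (a [^] n) T \<inter> R) (gscale a R))"
  have "\<exists>N. \<forall>n\<ge>N. ?I n = ?I N"
  proof (rule saturated_chain_stabilises[OF R N P aRi gscale_self[OF R a(1)]])
    note g = gideal_gsum[OF R Ii aRi]
    show "saturated R ?S (?I n)" for n using saturated_sat[OF R S(1,2) g] .
    show "gscale a R \<subseteq> ?I n" for n
      using sat_incr[OF g S(1)] gsum_right[OF gidealD(1)[OF Ii] gidealD(1)[OF aRi]] by blast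
    have "gscale (a [^] Suc n) T \<subseteq> gscale (a [^] n) T" for n
    proof (rule gscale_subset[OF gideal_gscale[OF T(1) gideal_ring[OF T(1)] apT homs_pow[OF a(1)]] T(1)])
      show "a [^] Suc n \<in> gscale (a [^] n) T" unfolding gscale_def using aT by auto
    qed
    then show "?I (Suc n) \<subseteq> ?I n" for n by (intro sat_mono gsum_mono) auto
  qed
  then obtain N where stab: "\<And>n. n \<ge> N \<Longrightarrow> ?I n = ?I N" by blast
  show thesis
  proof (rule that[of N])
    fix u m s assume "u \<in> T" "s \<in> ?S" "s \<otimes> (a [^] (m::nat) \<otimes> u) \<in> R"
    then show "\<exists>s'\<in>?S. \<exists>r\<in>R. \<exists>t'\<in>T. s' \<otimes> (a [^] N \<otimes> u) = a [^] Suc N \<otimes> t' \<oplus> r"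
    proof (induction m arbitrary: u s rule: less_induct)
      case (less m)
      note u = less.prems(1) and s = less.prems(2)
      have sk: "s \<in> carrier K" "u \<in> carrier K" "a \<in> carrier K" using s S k u T aT by auto
      show ?case
      proof (cases "m \<le> N")
        case True
        have "a [^] N = a [^] (N - m) \<otimes> a [^] m" using True sk by (simp add: nat_pow_mult)
        then have e: "s \<otimes> (a [^] N \<otimes> u) = a [^] (N - m) \<otimes> (s \<otimes> (a [^] m \<otimes> u))"
          using sk by (simp add: m_assoc m_lcomm)
        have "a [^] (N - m) \<otimes> (s \<otimes> (a [^] m \<otimes> u)) \<in> R"
          using r(3)[OF gring_pow[OF R aR] less.prems(3)] .
        then have "s \<otimes> (a [^] N \<otimes> u) \<in> R" unfolding e .
        moreover have "s \<otimes> (a [^] N \<otimes> u) = a [^] Suc N \<otimes> \<zero> \<oplus> s \<otimes> (a [^] N \<otimes> u)" using sk by simp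
        ultimately show ?thesis using s gsub_zero[OF t(1)] by blast
      next
        case False
        then obtain l where m: "m = Suc l" and l: "N \<le> l" by (cases m) auto
        let ?r = "s \<otimes> (a [^] m \<otimes> u)"
        have "?r = a [^] m \<otimes> (s \<otimes> u)" using sk by (simp add: m_lcomm)
        moreover have "s \<otimes> u \<in> T" using t(3) s u S T by blast
        ultimately have "?r \<in> gscale (a [^] m) T \<inter> R" unfolding gscale_def using less.prems(3) by blast
        then have "?r \<in> ?I m"
          using sat_incr[OF gideal_gsum[OF R Ii aRi] S(1)] gsum_left[OF gidealD(1)[OF Ii] gidealD(1)[OF aRi]] by blast
        then have "?r \<in> ?I (Suc m)" using stab[of m] stab[of "Suc m"] l m by simp
        then obtain s1 t1 r1 where 1: "s1 \<in> ?S" "t1 \<in> T" "r1 \<in> R"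
            "s1 \<otimes> ?r = a [^] Suc m \<otimes> t1 \<oplus> a \<otimes> r1"
          unfolding sat_def gsum_def gscale_def by blast
        have k1: "s1 \<in> carrier K" "t1 \<in> carrier K" "r1 \<in> carrier K" using 1 S k T by auto
        define b where "b = a [^] l"
        have b: "b \<in> carrier K" "a [^] m = b \<otimes> a" "a [^] Suc m = (b \<otimes> a) \<otimes> a" unfolding b_def m using sk by simp_all
        have bp: "a \<otimes> (b \<otimes> ((s1 \<otimes> s) \<otimes> u \<ominus> a \<otimes> t1)) = s1 \<otimes> ?r \<ominus> a [^] Suc m \<otimes> t1"
          unfolding b(2,3) using b(1) sk k1 by algebra
        also have "\<dots> = a \<otimes> r1" unfolding 1(4) b(3) using b(1) sk k1 by algebra
        finally have "b \<otimes> ((s1 \<otimes> s) \<otimes> u \<ominus> a \<otimes> t1) = r1"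
          using m_lcancel[OF a(2)] sk k1 b by simp
        then have low: "\<one> \<otimes> (a [^] l \<otimes> ((s1 \<otimes> s) \<otimes> u \<ominus> a \<otimes> t1)) \<in> R"
          using 1(3) k1 unfolding b_def by simp
        let ?u = "(s1 \<otimes> s) \<otimes> u \<ominus> a \<otimes> t1"
        have ss: "s1 \<otimes> s \<in> ?S" using Sm 1 s by blast
        have uT: "?u \<in> T"
        proof (rule gsub_minus[OF t(1)])
          show "s1 \<otimes> s \<otimes> u \<in> T" using t(3) ss u S T by blast
          show "a \<otimes> t1 \<in> T" using t(3) aT 1 by blast
        qed
        from less.IH[OF _ uT S(4) low] obtain s2 r2 t2 where 2: "s2 \<in> ?S" "r2 \<in> R" "t2 \<in> T"
            "s2 \<otimes> (a [^] N \<otimes> ?u) = a [^] Suc N \<otimes> t2 \<oplus> r2" using m by blast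
        have k2: "s2 \<in> carrier K" "r2 \<in> carrier K" "t2 \<in> carrier K" using 2 S k T by auto
        define d where "d = a [^] N"
        have d: "d \<in> carrier K" "a [^] N = d" "a [^] Suc N = d \<otimes> a" unfolding d_def using sk by simp_all
        have "(s2 \<otimes> (s1 \<otimes> s)) \<otimes> (a [^] N \<otimes> u) = s2 \<otimes> (a [^] N \<otimes> ?u) \<oplus> (d \<otimes> a) \<otimes> (s2 \<otimes> t1)"
          unfolding d(2) using d(1) sk k1 k2 by algebra
        also have "\<dots> = a [^] Suc N \<otimes> (t2 \<oplus> s2 \<otimes> t1) \<oplus> r2"
          unfolding 2(4) d(3) using d(1) sk k1 k2 by algebra
        finally have "(s2 \<otimes> (s1 \<otimes> s)) \<otimes> (a [^] N \<otimes> u) = a [^] Suc N \<otimes> (t2 \<oplus> s2 \<otimes> t1) \<oplus> r2" .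
        moreover have "s2 \<otimes> (s1 \<otimes> s) \<in> ?S" using Sm 2 ss by blast
        moreover have "t2 \<oplus> s2 \<otimes> t1 \<in> T"
          by (intro gsub_add[OF t(1)] t(3)) (use 1 2 S T in auto)
        ultimately show ?thesis using 2(2) by blast
      qed
    qed
  qed
qed

text \<open>
  The zero ideal is always a homogeneous prime, so this says that no chain of homogeneous primes
  has length two; it includes the case that zero is the only homogeneous prime.
\<close>

definition one_dimensional :: "'a set \<Rightarrow> bool" where
  "one_dimensional R \<longleftrightarrow> (\<forall>P\<^sub>0 P. gprime R P\<^sub>0 \<and> gprime R P \<and> P\<^sub>0 \<subset> P \<longrightarrow> P\<^sub>0 = {\<zero>})"

text \<open>
  Let \<open>0 \<noteq> Q1 \<subset> Q2\<close>.  Both contract to the same prime \<open>P\<close> of \<open>R\<close>; choose a homogeneous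
  nonzero \<open>a \<in> Q1 \<inter> R\<close> and a homogeneous \<open>x \<in> Q2 - Q1\<close>.  By the first step, with \<open>d = a\<^sup>N\<close>,
  the element \<open>d x\<^sup>n\<close> is congruent modulo \<open>d a T\<close>, up to a denominator, to an element of \<open>R\<close>,
  and the chain condition for the contractions of \<open>d a T + d x\<^sup>n T\<close> to \<open>R\<close> shows
  \<open>s x\<^sup>n \<in> x\<^sup>n\<^sup>+\<^sup>1 T + a T\<close> for some \<open>n\<close> and some \<open>s \<in> R - P\<close>.  Hence
  \<open>x\<^sup>n (s - x t) \<in> Q1\<close>, so \<open>s - x t \<in> Q1 \<subseteq> Q2\<close> and \<open>s \<in> Q2 \<inter> R = P\<close>, a contradiction.
\<close>

lemma krull_akizuki_one_dimensional:
  assumes R: "gring R" and N: "gnoeth R" and dim: "one_dimensional R"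
    and T: "gring T" "R \<subseteq> T"
    and frac: "\<And>t. t \<in> T \<Longrightarrow> t \<in> homs \<Longrightarrow> \<exists>c\<in>R. c \<in> homs \<and> c \<noteq> \<zero> \<and> c \<otimes> t \<in> R"
  shows "one_dimensional T"
  unfolding one_dimensional_def
proof (intro allI impI)
  fix Q1 Q2 assume Q: "gprime T Q1 \<and> gprime T Q2 \<and> Q1 \<subset> Q2"
  then have Q1: "gprime T Q1" and Q2: "gprime T Q2" and Q12: "Q1 \<subseteq> Q2" "Q1 \<noteq> Q2" by auto
  note r = gringD[OF R] and t = gringD[OF T(1)]
  note q1 = gidealD[OF gprimeD(1)[OF Q1]] and q2 = gidealD[OF gprimeD(1)[OF Q2]]
  show "Q1 = {\<zero>}"
  proof (rule ccontr)
    assume "Q1 \<noteq> {\<zero>}"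
    then have "\<not> Q1 \<subseteq> {\<zero>}" using gsub_zero[OF q1(1)] by blast
    then obtain q where q: "q \<in> Q1" "q \<in> homs" "q \<noteq> \<zero>" using gsub_subset[OF q1(1) gsub_single] by blast
    then obtain c where c: "c \<in> R" "c \<in> homs" "c \<noteq> \<zero>" "c \<otimes> q \<in> R" using frac q1(2) by blast
    define a where "a = c \<otimes> q"
    have a: "a \<in> R" "a \<in> homs" "a \<noteq> \<zero>" "a \<in> Q1"
      unfolding a_def using c q homs_mult integral_iff[of c q] q1(3)[of c q] T by auto
    let ?P = "Q2 \<inter> R"
    have P: "gprime R ?P" and P1: "gprime R (Q1 \<inter> R)" using gprime_restrict[OF _ R T(2)] Q1 Q2 by blast+
    have min: "minimal_over R ?P d" if d: "d \<in> ?P" "d \<noteq> \<zero>" for d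
      unfolding minimal_over_def
    proof (intro conjI allI impI P d(1))
      fix P' assume "gprime R P' \<and> P' \<subseteq> ?P \<and> d \<in> P'"
      then show "P' = ?P" using dim P d(2) unfolding one_dimensional_def by blast
    qed
    have aP: "a \<in> ?P" using a Q12 by blast
    let ?S = "hcompl R ?P"
    have S: "mult_set R ?S" "?S \<subseteq> homs" "?S \<subseteq> R" "\<one> \<in> ?S"
      and Sm: "\<And>s t. s \<in> ?S \<Longrightarrow> t \<in> ?S \<Longrightarrow> s \<otimes> t \<in> ?S"
      using mult_set_hcompl[OF R P] hcompl_homs unfolding mult_set_def by auto
    obtain N' :: nat where approx: "\<And>t m s. t \<in> T \<Longrightarrow> s \<in> ?S \<Longrightarrow> s \<otimes> (a [^] (m::nat) \<otimes> t) \<in> R \<Longrightarrow>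
        \<exists>s'\<in>?S. \<exists>r\<in>R. \<exists>t'\<in>T. s' \<otimes> (a [^] N' \<otimes> t) = a [^] Suc N' \<otimes> t' \<oplus> r"
      using krull_akizuki_approximation[OF R N T min[OF aP a(3)] a(2,3)] by metis
    obtain x where x: "x \<in> Q2" "x \<in> homs" "x \<notin> Q1" using gsub_subset[OF q2(1) q1(1)] Q12 by blast
    have xT: "x \<in> T" and aT: "a \<in> T" using x q2 a T by auto
    have k: "y \<in> carrier K" if "y \<in> T" for y using gsub_carrier[OF t(1) that] .
    \<comment> \<open>The chain below consists of ideals of \<open>R\<close> containing \<open>d a\<close>, a power of \<open>a\<close>, over which
      \<open>P\<close> is minimal as well.\<close>
    define d where "d = a [^] N'"
    have d: "d \<in> T" "d \<in> homs" "d \<noteq> \<zero>" "a [^] Suc N' = d \<otimes> a"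
      unfolding d_def using gring_pow[OF T(1) aT] homs_pow[OF a(2)] pow_nonzero[of a N'] a by auto
    have da: "d \<otimes> a \<in> R" "d \<otimes> a \<in> homs" "d \<otimes> a \<noteq> \<zero>" "d \<otimes> a \<in> T"
      using gring_pow[OF R a(1), of "Suc N'"] d a homs_mult integral_iff[of d a] T by auto
    have daP: "d \<otimes> a \<in> ?P" using q2(3)[OF d(1)] aP da by blast
    let ?E = "\<lambda>n::nat. d \<otimes> x [^] n"
    have E: "?E n \<in> T" "?E n \<in> homs" for n
      using d t(3) gring_pow[OF T(1) xT] homs_mult homs_pow[OF x(2)] by blast+
    let ?G = "\<lambda>n. gsum (gscale (d \<otimes> a) T) (gscale (?E n) T)"
    have Ai: "gideal T (gscale (d \<otimes> a) T)" using gideal_gscale[OF T(1) gideal_ring[OF T(1)] da(4,2)] .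
    have Ei: "gideal T (gscale (?E n) T)" for n using gideal_gscale[OF T(1) gideal_ring[OF T(1)] E] .
    have Gi: "gideal R (?G n \<inter> R)" for n using gideal_restrict[OF gideal_gsum[OF T(1) Ai Ei] R T(2)] .
    have daRi: "gideal R (gscale (d \<otimes> a) R)" using gideal_gscale[OF R gideal_ring[OF R] da(1,2)] .
    let ?L = "\<lambda>n. sat R ?S (?G n \<inter> R)"
    have "\<exists>N. \<forall>n\<ge>N. ?L n = ?L N"
    proof (rule saturated_chain_stabilises[OF R N min[OF daP da(3)] daRi gscale_self[OF R da(2)]])
      show "saturated R ?S (?L n)" for n using saturated_sat[OF R S(1,2) Gi] .
      have "gscale (d \<otimes> a) R \<subseteq> ?G n \<inter> R" for n
      proof (rule gscale_subset[OF Gi R])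
        show "d \<otimes> a \<in> ?G n \<inter> R" using gsum_left[OF gidealD(1)[OF Ai] gidealD(1)[OF Ei]] gscale_self[OF T(1) da(2)] da(1) by blast
      qed
      then show "gscale (d \<otimes> a) R \<subseteq> ?L n" for n using sat_incr[OF Gi S(1)] by blast
      have "gscale (?E (Suc n)) T \<subseteq> gscale (?E n) T" for n
      proof (rule gscale_subset[OF Ei T(1)])
        have "?E (Suc n) = ?E n \<otimes> x" using k xT d by (simp add: m_assoc)
        then show "?E (Suc n) \<in> gscale (?E n) T" unfolding gscale_def using xT by blast
      qed
      then show "?L (Suc n) \<subseteq> ?L n" for n by (intro sat_mono Int_mono gsum_mono order_refl)
    qed
    then obtain n where "\<forall>m\<ge>n. ?L m = ?L n" by blast
    then have stab: "?L (Suc n) = ?L n" by (meson le_SucI order_refl)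
    define y where "y = x [^] n"
    have y: "y \<in> T" "y \<in> homs" "y \<notin> Q1" unfolding y_def
      using gring_pow[OF T(1) xT] homs_pow[OF x(2)] gprime_pow[OF T(1) Q1 xT] x(3) by blast+
    obtain b where b: "b \<in> R" "b \<in> homs" "b \<noteq> \<zero>" "b \<otimes> y \<in> R" using frac[OF y(1,2)] by blast
    \<comment> \<open>A denominator of \<open>y\<close> is a unit at \<open>P\<close>, or it divides a power of \<open>a\<close> there.\<close>
    have "\<exists>s\<in>?S. \<exists>m::nat. s \<otimes> (a [^] m \<otimes> y) \<in> R"
    proof (cases "b \<in> ?P")
      case False
      then have "b \<in> ?S" unfolding hcompl_def using b by blast
      moreover have "b \<otimes> (a [^] (0::nat) \<otimes> y) \<in> R" using b y by simp
      ultimately show ?thesis by blast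
    next
      case True
      obtain s m r where sm: "s \<in> ?S" "r \<in> R" "s \<otimes> a [^] (m::nat) = b \<otimes> r"
        using power_in_principal[OF R min[OF True b(3)] b(2) aP a(2)] by blast
      have kk: "s \<in> carrier K" "r \<in> carrier K" "b \<in> carrier K" "y \<in> carrier K" "a \<in> carrier K"
        using sm S b y a k T by auto
      have "s \<otimes> (a [^] m \<otimes> y) = (s \<otimes> a [^] m) \<otimes> y" using kk by (simp add: m_assoc)
      also have "\<dots> = r \<otimes> (b \<otimes> y)" unfolding sm(3) using kk by (simp add: m_ac)
      finally have "s \<otimes> (a [^] m \<otimes> y) \<in> R" using \<open>r \<in> R\<close> b r(3) by simp
      then show ?thesis using sm by blast
    qed
    then obtain s u v where s: "s \<in> ?S" "v \<in> R" "u \<in> T" "s \<otimes> (d \<otimes> y) = (d \<otimes> a) \<otimes> u \<oplus> v"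
      using approx[OF y(1)] unfolding d(4) d_def[symmetric] by blast
    have ks: "s \<in> carrier K" "v \<in> carrier K" "u \<in> carrier K" "d \<in> carrier K" "a \<in> carrier K" "y \<in> carrier K" "x \<in> carrier K"
      using s S d aT xT y k T by auto
    have "v = (d \<otimes> a) \<otimes> (\<ominus> u) \<oplus> (d \<otimes> y) \<otimes> s"
    proof -
      have "v = s \<otimes> (d \<otimes> y) \<ominus> (d \<otimes> a) \<otimes> u" unfolding s(4) using ks by algebra
      also have "\<dots> = (d \<otimes> a) \<otimes> (\<ominus> u) \<oplus> (d \<otimes> y) \<otimes> s" using ks by algebra
      finally show ?thesis .
    qed
    moreover have "\<ominus> u \<in> T" "s \<in> T" using gsub_neg[OF t(1)] s S T by auto
    ultimately have "v \<in> ?G n \<inter> R" unfolding gsum_def gscale_def y_def using s(2) by blast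
    then have "v \<in> ?L (Suc n)" using sat_incr[OF Gi S(1)] stab by blast
    then obtain s' u1 u2 where s': "s' \<in> ?S" "u1 \<in> T" "u2 \<in> T"
        "s' \<otimes> v = (d \<otimes> a) \<otimes> u1 \<oplus> ?E (Suc n) \<otimes> u2"
      unfolding sat_def gsum_def gscale_def by blast
    have ks': "s' \<in> carrier K" "u1 \<in> carrier K" "u2 \<in> carrier K" using s' S k T by auto
    have e: "?E (Suc n) = d \<otimes> (y \<otimes> x)" unfolding y_def using ks by simp
    have "d \<otimes> (y \<otimes> (s' \<otimes> s \<ominus> x \<otimes> u2)) = s' \<otimes> (s \<otimes> (d \<otimes> y)) \<ominus> (d \<otimes> (y \<otimes> x)) \<otimes> u2"
      using ks ks' by algebra
    also have "\<dots> = ((d \<otimes> a) \<otimes> (s' \<otimes> u) \<oplus> s' \<otimes> v) \<ominus> (d \<otimes> (y \<otimes> x)) \<otimes> u2"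
      unfolding s(4) using ks ks' by algebra
    also have "\<dots> = d \<otimes> (a \<otimes> (s' \<otimes> u \<oplus> u1))"
      unfolding s'(4) e using ks ks' by algebra
    finally have "y \<otimes> (s' \<otimes> s \<ominus> x \<otimes> u2) = a \<otimes> (s' \<otimes> u \<oplus> u1)"
      using m_lcancel[OF d(3)] ks ks' by simp
    moreover have "a \<otimes> (s' \<otimes> u \<oplus> u1) \<in> Q1"
    proof (rule gideal_r[OF T(1) gprimeD(1)[OF Q1] _ a(4)])
      show "s' \<otimes> u \<oplus> u1 \<in> T" by (intro gsub_add[OF t(1)] t(3)) (use s s' S T in auto)
    qed
    ultimately have yq: "y \<otimes> (s' \<otimes> s \<ominus> x \<otimes> u2) \<in> Q1" by simp
    have ss: "s' \<otimes> s \<in> ?S" using Sm s s' by blast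
    have xu: "x \<otimes> u2 \<in> Q2" using gideal_r[OF T(1) gprimeD(1)[OF Q2] s'(3) x(1)] .
    have "s' \<otimes> s \<ominus> x \<otimes> u2 \<in> T"
      using gsub_minus[OF t(1), of "s' \<otimes> s" "x \<otimes> u2"] ss xu q2(2) S(3) T(2) by blast
    then have "s' \<otimes> s \<ominus> x \<otimes> u2 \<in> Q2" using gprimeD(3)[OF Q1 y(1) _ yq] y(3) Q12 by blast
    then have "(s' \<otimes> s \<ominus> x \<otimes> u2) \<oplus> x \<otimes> u2 \<in> Q2" using gsub_add[OF q2(1) _ xu] by blast
    moreover have "(s' \<otimes> s \<ominus> x \<otimes> u2) \<oplus> x \<otimes> u2 = s' \<otimes> s" using ks ks' by algebra
    ultimately have "s' \<otimes> s \<in> Q2" by simp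
    then show False using ss unfolding hcompl_def by blast
  qed
qed

section \<open>Adjoining a homogeneous fraction\<close>

text \<open>
  The values at \<open>u\<close> of polynomials of degree at most \<open>n\<close> with coefficients in \<open>M\<close>.
\<close>

primrec polys :: "'a \<Rightarrow> 'a set \<Rightarrow> nat \<Rightarrow> 'a set" where
  "polys u M 0 = M"
| "polys u M (Suc n) = gsum (polys u M n) (gscale (u [^] Suc n) M)"

lemma gsub_polys: "gsub M \<Longrightarrow> u \<in> homs \<Longrightarrow> gsub (polys u M n)"
proof (induction n)
  case (Suc n)
  then show ?case unfolding polys.simps by (intro gsub_gsum gsub_gscale homs_pow)
qed simp

lemma polys_Suc_subset: "gsub M \<Longrightarrow> u \<in> homs \<Longrightarrow> polys u M n \<subseteq> polys u M (Suc n)"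
  unfolding polys.simps(2) by (intro gsum_left gsub_polys gsub_gscale homs_pow)

lemma polys_mono: "gsub M \<Longrightarrow> u \<in> homs \<Longrightarrow> m \<le> n \<Longrightarrow> polys u M m \<subseteq> polys u M n"
  using lift_Suc_mono_le[of "polys u M" m n] polys_Suc_subset by blast

lemma polys_scalar:
  assumes R: "gring R" and M: "gideal R M" and u: "u \<in> homs" and r: "r \<in> R"
  shows "x \<in> polys u M n \<Longrightarrow> r \<otimes> x \<in> polys u M n"
proof (induction n arbitrary: x)
  case 0
  then show ?case using gidealD(3)[OF M r] by simp
next
  case (Suc n)
  then obtain y m where x: "x = y \<oplus> u [^] Suc n \<otimes> m" "y \<in> polys u M n" "m \<in> M"
    unfolding polys.simps gsum_def gscale_def by blast
  define v where "v = u [^] Suc n"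
  have k: "r \<in> carrier K" "y \<in> carrier K" "m \<in> carrier K" "v \<in> carrier K"
    using gsub_carrier[OF gringD(1)[OF R] r] gsub_carrier[OF gsub_polys[OF gidealD(1)[OF M] u] x(2)]
      gsub_carrier[OF gidealD(1)[OF M] x(3)] u unfolding v_def by auto
  have "r \<otimes> x = r \<otimes> y \<oplus> v \<otimes> (r \<otimes> m)" unfolding x(1) v_def[symmetric] using k by algebra
  moreover have "r \<otimes> y \<in> polys u M n" "r \<otimes> m \<in> M" using Suc.IH[OF x(2)] gidealD(3)[OF M r x(3)] by auto
  ultimately show ?case unfolding polys.simps gsum_def gscale_def v_def by blast
qed

lemma polys_shift1:
  assumes M: "gsub M" and u: "u \<in> homs"
  shows "x \<in> polys u M n \<Longrightarrow> u \<otimes> x \<in> polys u M (Suc n)"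
proof (induction n arbitrary: x)
  case 0
  have "u \<otimes> x = \<zero> \<oplus> u [^] Suc 0 \<otimes> x" using u gsub_carrier[OF M] 0 by simp
  then show ?case using 0 gsub_zero[OF M] unfolding polys.simps gsum_def gscale_def by blast
next
  case (Suc n)
  then obtain y m where x: "x = y \<oplus> u [^] Suc n \<otimes> m" "y \<in> polys u M n" "m \<in> M"
    unfolding polys.simps(2)[of u M n] gsum_def gscale_def by blast
  define v where "v = u [^] Suc n"
  have k: "y \<in> carrier K" "m \<in> carrier K" "v \<in> carrier K" "u \<in> carrier K"
    using gsub_carrier[OF gsub_polys[OF M u] x(2)] gsub_carrier[OF M x(3)] u unfolding v_def by auto
  have "u \<otimes> x = u \<otimes> y \<oplus> (v \<otimes> u) \<otimes> m" unfolding x(1) v_def[symmetric] using k by algebra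
  moreover have "v \<otimes> u = u [^] Suc (Suc n)" unfolding v_def by simp
  moreover have "u \<otimes> y \<in> polys u M (Suc n)" using Suc.IH[OF x(2)] .
  ultimately show ?case using x(3) unfolding polys.simps(2)[of u M "Suc n"] gsum_def gscale_def by auto
qed

lemma polys_shift:
  assumes M: "gsub M" and u: "u \<in> homs"
  shows "x \<in> polys u M n \<Longrightarrow> u [^] k \<otimes> x \<in> polys u M (k + n)"
proof (induction k arbitrary: n x)
  case 0
  then show ?case using gsub_carrier[OF gsub_polys[OF M u]] by simp
next
  case (Suc k)
  have "u [^] Suc k \<otimes> x = u [^] k \<otimes> (u \<otimes> x)"
    using Suc.prems gsub_carrier[OF gsub_polys[OF M u]] u by (simp add: m_assoc)
  then show ?case using Suc.IH[OF polys_shift1[OF M u Suc.prems]] by simp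
qed

lemma polys_mult:
  assumes R: "gring R" and M: "gideal R M" and u: "u \<in> homs" and y: "y \<in> polys u M m"
  shows "x \<in> polys u R n \<Longrightarrow> x \<otimes> y \<in> polys u M (n + m)"
proof (induction n arbitrary: x)
  case 0
  then show ?case using polys_scalar[OF R M u] y by simp
next
  case (Suc n)
  note g = gidealD(1)[OF M]
  obtain z r where x: "x = z \<oplus> u [^] Suc n \<otimes> r" "z \<in> polys u R n" "r \<in> R"
    using Suc.prems unfolding polys.simps gsum_def gscale_def by blast
  define v where "v = u [^] Suc n"
  have k: "z \<in> carrier K" "r \<in> carrier K" "v \<in> carrier K" "y \<in> carrier K"
    using gsub_carrier[OF gsub_polys[OF gringD(1)[OF R] u] x(2)] gsub_carrier[OF gringD(1)[OF R] x(3)]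
      gsub_carrier[OF gsub_polys[OF g u] y] u unfolding v_def by auto
  have "x \<otimes> y = z \<otimes> y \<oplus> v \<otimes> (r \<otimes> y)" unfolding x(1) v_def[symmetric] using k by algebra
  moreover have "z \<otimes> y \<in> polys u M (Suc n + m)"
    using Suc.IH[OF x(2)] polys_mono[OF g u, of "n + m" "Suc n + m"] by auto
  moreover have "v \<otimes> (r \<otimes> y) \<in> polys u M (Suc n + m)"
    unfolding v_def using polys_shift[OF g u polys_scalar[OF R M u x(3) y]] .
  ultimately show ?case using gsub_add[OF gsub_polys[OF g u]] by presburger
qed

definition adjoin :: "'a \<Rightarrow> 'a set \<Rightarrow> 'a set" where
  "adjoin u M = (\<Union>n. polys u M n)"

lemma gsub_adjoin: "gsub M \<Longrightarrow> u \<in> homs \<Longrightarrow> gsub (adjoin u M)"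
  unfolding adjoin_def
  by (rule gsub_Union_chain) (use gsub_polys polys_mono in \<open>auto, metis linear subsetD\<close>)

lemma subset_adjoin: "M \<subseteq> adjoin u M"
  unfolding adjoin_def using polys.simps(1) by blast

lemma gideal_adjoin_aux:
  assumes "gring R" "gideal R M" "u \<in> homs" "x \<in> adjoin u R" "y \<in> adjoin u M"
  shows "x \<otimes> y \<in> adjoin u M"
  using assms(4,5) polys_mult[OF assms(1-3)] unfolding adjoin_def by blast

lemma gring_adjoin:
  assumes R: "gring R" and u: "u \<in> homs" shows "gring (adjoin u R)"
  unfolding gring_def
proof (intro conjI ballI)
  show "gsub (adjoin u R)" using gsub_adjoin[OF gringD(1)[OF R] u] .
  show "\<one> \<in> adjoin u R" using subset_adjoin[of R u] gringD(2)[OF R] by blast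
qed (rule gideal_adjoin_aux[OF R gideal_ring[OF R] u])

lemma polys_subset: "M \<subseteq> R \<Longrightarrow> polys u M n \<subseteq> polys u R n"
proof (induction n)
  case (Suc n)
  have "gscale (u [^] Suc n) M \<subseteq> gscale (u [^] Suc n) R" unfolding gscale_def using Suc.prems by blast
  then show ?case unfolding polys.simps using gsum_mono[OF Suc.IH[OF Suc.prems]] by blast
qed simp

lemma gideal_adjoin:
  assumes R: "gring R" and M: "gideal R M" and u: "u \<in> homs"
  shows "gideal (adjoin u R) (adjoin u M)"
  unfolding gideal_def
proof (intro conjI ballI)
  show "gsub (adjoin u M)" using gsub_adjoin[OF gidealD(1)[OF M] u] .
  show "adjoin u M \<subseteq> adjoin u R"
    unfolding adjoin_def using polys_subset[OF gidealD(2)[OF M], of u] by blast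
qed (rule gideal_adjoin_aux[OF R M u])

lemma adjoin_self: "gring R \<Longrightarrow> u \<in> homs \<Longrightarrow> u \<in> adjoin u R"
  using polys_shift1[OF gringD(1), of R u \<one> 0] gringD(2)[of R] unfolding adjoin_def by (auto simp del: polys.simps(2))

text \<open>
  Multiplying a polynomial in \<open>v = u\<^sup>-\<^sup>1\<close> by a power of \<open>u\<close> reverses its coefficients; its
  constant term \<open>m\<close> becomes the leading one.
\<close>

lemma polys_reverse:
  assumes M: "gsub M" and u: "u \<in> homs" and v: "v \<in> homs" and uv: "u \<otimes> v = \<one>"
  shows "y \<in> polys v M (Suc j) \<Longrightarrow> \<exists>m\<in>M. \<exists>z\<in>polys u M j. u [^] Suc j \<otimes> y = m \<otimes> u [^] Suc j \<oplus> z"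
proof (induction j arbitrary: y)
  case 0
  then obtain m0 m1 where y: "y = m0 \<oplus> v \<otimes> m1" "m0 \<in> M" "m1 \<in> M"
    using v unfolding polys.simps gsum_def gscale_def by auto
  have k: "m0 \<in> carrier K" "m1 \<in> carrier K" "u \<in> carrier K" "v \<in> carrier K"
    using y gsub_carrier[OF M] u v by auto
  have "u \<otimes> (m0 \<oplus> v \<otimes> m1) = m0 \<otimes> u \<oplus> (u \<otimes> v) \<otimes> m1" using k by algebra
  then have "u [^] Suc 0 \<otimes> y = m0 \<otimes> u [^] Suc 0 \<oplus> m1" using uv y k by simp
  then show ?case using y unfolding polys.simps(1) by blast
next
  case (Suc j)
  obtain y' m' where y: "y = y' \<oplus> v [^] Suc (Suc j) \<otimes> m'" "y' \<in> polys v M (Suc j)" "m' \<in> M"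
    using Suc.prems unfolding polys.simps(2)[of v M "Suc j"] gsum_def gscale_def by blast
  obtain m z where mz: "m \<in> M" "z \<in> polys u M j" "u [^] Suc j \<otimes> y' = m \<otimes> u [^] Suc j \<oplus> z"
    using Suc.IH[OF y(2)] by blast
  define w where "w = u [^] Suc j"
  define w' where "w' = v [^] Suc (Suc j)"
  have k: "y' \<in> carrier K" "m' \<in> carrier K" "m \<in> carrier K" "z \<in> carrier K" "u \<in> carrier K" "w \<in> carrier K" "w' \<in> carrier K"
    using gsub_carrier[OF gsub_polys[OF M v] y(2)] gsub_carrier[OF gsub_polys[OF M u] mz(2)]
      gsub_carrier[OF M] y(3) mz(1) u v unfolding w_def w'_def by auto
  have "u [^] n \<otimes> v [^] n = \<one>" for n :: nat
    using uv u v by (metis homs_carrier nat_pow_distrib nat_pow_one)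
  then have one: "(w \<otimes> u) \<otimes> w' = \<one>" unfolding w_def w'_def using u by (metis nat_pow_Suc)
  have "(w \<otimes> u) \<otimes> y = u \<otimes> (w \<otimes> y') \<oplus> ((w \<otimes> u) \<otimes> w') \<otimes> m'"
    unfolding y(1) w'_def[symmetric] using k by algebra
  also have "\<dots> = u \<otimes> (m \<otimes> w \<oplus> z) \<oplus> m'" unfolding one using mz(3) k unfolding w_def by simp
  also have "\<dots> = m \<otimes> (w \<otimes> u) \<oplus> (u \<otimes> z \<oplus> m')" using k by algebra
  finally have "u [^] Suc (Suc j) \<otimes> y = m \<otimes> u [^] Suc (Suc j) \<oplus> (u \<otimes> z \<oplus> m')"
    unfolding w_def by simp
  moreover have "u \<otimes> z \<oplus> m' \<in> polys u M (Suc j)"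
    using gsub_add[OF gsub_polys[OF M u] polys_shift1[OF M u mz(2)], of m'] y(3)
      polys_mono[OF M u, of 0 "Suc j"] by auto
  ultimately show ?case using mz(1) by blast
qed

text \<open>
  If \<open>t = m\<^sub>0 + m\<^sub>1 v + \<dots>\<close> has degree at most that of \<open>s\<close>, then \<open>(t - m\<^sub>0) u\<^sup>j\<^sup>+\<^sup>1\<close> has degree at
  most \<open>j\<close> in \<open>u\<close>, so multiplying the leading term of \<open>s\<close> by \<open>t - m\<^sub>0\<close> lowers its degree; and
  \<open>m\<^sub>0 s\<close> has degree zero because \<open>s\<close> is an element of \<open>R\<close>.
\<close>

lemma degree_reduction:
  assumes R: "gring R" and M: "gideal R M" and u: "u \<in> homs" and v: "v \<in> homs" and uv: "u \<otimes> v = \<one>"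
    and s: "s \<in> R" "s \<in> polys u M (Suc p)" and t: "t \<in> R" "t \<in> polys v M (Suc j)" and jp: "j \<le> p"
  shows "t \<otimes> s \<in> polys u M p"
proof -
  note g = gidealD(1)[OF M]
  note gp = gsub_polys[OF g u]
  obtain x m where x: "s = x \<oplus> u [^] Suc p \<otimes> m" "x \<in> polys u M p" "m \<in> M"
    using s unfolding polys.simps gsum_def gscale_def by blast
  obtain m0 z where mz: "m0 \<in> M" "z \<in> polys u M j" "u [^] Suc j \<otimes> t = m0 \<otimes> u [^] Suc j \<oplus> z"
    using polys_reverse[OF g u v uv t(2)] by blast
  define w where "w = u [^] (p - j)"
  define w' where "w' = u [^] Suc j"
  have ww: "u [^] Suc p = w \<otimes> w'"
  proof -
    have "p - j + Suc j = Suc p" using jp by simp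
    then show ?thesis unfolding w_def w'_def using nat_pow_mult[of u "p - j" "Suc j"] u by simp
  qed
  have k: "x \<in> carrier K" "m \<in> carrier K" "m0 \<in> carrier K" "z \<in> carrier K" "t \<in> carrier K" "w \<in> carrier K" "w' \<in> carrier K" "s \<in> carrier K"
    using gsub_carrier[OF gp x(2)] gsub_carrier[OF gp mz(2)] gsub_carrier[OF g] x(3) mz(1) u
      gsub_carrier[OF gringD(1)[OF R]] s(1) t(1) unfolding w_def w'_def by auto
  have "t \<otimes> s = t \<otimes> x \<oplus> (w \<otimes> m) \<otimes> (w' \<otimes> t)" unfolding x(1) ww using k by algebra
  also have "\<dots> = t \<otimes> x \<oplus> (w \<otimes> m) \<otimes> (m0 \<otimes> w' \<oplus> z)" using mz(3) unfolding w'_def by simp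
  also have "\<dots> = t \<otimes> x \<oplus> (m0 \<otimes> (s \<ominus> x) \<oplus> m \<otimes> (w \<otimes> z))" unfolding x(1) ww using k by algebra
  finally have e: "t \<otimes> s = t \<otimes> x \<oplus> (m0 \<otimes> (s \<ominus> x) \<oplus> m \<otimes> (w \<otimes> z))" .
  have MR: "m \<in> R" "m0 \<in> R" using x mz gidealD(2)[OF M] by blast+
  have 1: "t \<otimes> x \<in> polys u M p" using polys_scalar[OF R M u t(1) x(2)] .
  have "m0 \<otimes> s \<in> M" using gideal_r[OF R M s(1) mz(1)] .
  then have "m0 \<otimes> s \<in> polys u M p" using polys_mono[OF g u, of 0 p] by auto
  then have "m0 \<otimes> s \<ominus> m0 \<otimes> x \<in> polys u M p"
    using gsub_minus[OF gp] polys_scalar[OF R M u MR(2) x(2)] by blast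
  then have 2: "m0 \<otimes> (s \<ominus> x) \<in> polys u M p" using r_distr_minus k by simp
  have "w \<otimes> z \<in> polys u M (p - j + j)" unfolding w_def using polys_shift[OF g u mz(2)] .
  then have 3: "m \<otimes> (w \<otimes> z) \<in> polys u M p" using polys_scalar[OF R M u MR(1)] jp by simp
  show ?thesis unfolding e using gsub_add[OF gp] 1 2 3 by blast
qed

text \<open>
  Otherwise take elements of \<open>S\<close> of least degrees in \<open>u\<close> and in \<open>v\<close>; \<open>degree_reduction\<close> turns
  their product, which lies in \<open>S\<close>, into an element of smaller degree.
\<close>

lemma adjoin_proper_or:
  assumes R: "gring R" and M: "gideal R M" and u: "u \<in> homs" and v: "v \<in> homs" and uv: "u \<otimes> v = \<one>"
    and S: "mult_set R S" "S \<inter> M = {}"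
  shows "S \<inter> adjoin u M = {} \<or> S \<inter> adjoin v M = {}"
proof (rule ccontr)
  assume "\<not> ?thesis"
  then have ex: "\<exists>n. S \<inter> polys u M n \<noteq> {}" "\<exists>n. S \<inter> polys v M n \<noteq> {}" unfolding adjoin_def by blast+
  have vu: "v \<otimes> u = \<one>" using uv m_comm u v by simp
  have "\<exists>p. (\<exists>s\<in>S. s \<in> polys w M (Suc p)) \<and> (\<forall>s\<in>S. s \<notin> polys w M p)"
    if w: "\<exists>n. S \<inter> polys w M n \<noteq> {}" for w
  proof -
    let ?n = "LEAST n. S \<inter> polys w M n \<noteq> {}"
    have n: "S \<inter> polys w M ?n \<noteq> {}" using LeastI_ex[OF w] .
    then have "?n \<noteq> 0" using S(2) by (metis polys.simps(1))
    then obtain p where p: "?n = Suc p" by (cases ?n) auto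
    then have "S \<inter> polys w M p = {}" using not_less_Least[of p "\<lambda>n. S \<inter> polys w M n \<noteq> {}"] by auto
    then show ?thesis using n unfolding p by blast
  qed
  from this[OF ex(1)] this[OF ex(2)] obtain p s j t
    where p: "s \<in> S" "s \<in> polys u M (Suc p)" "\<forall>s\<in>S. s \<notin> polys u M p"
      and j: "t \<in> S" "t \<in> polys v M (Suc j)" "\<forall>s\<in>S. s \<notin> polys v M j" by blast
  have SR: "s \<in> R" "t \<in> R" and st: "t \<otimes> s \<in> S" "s \<otimes> t \<in> S" using S p j unfolding mult_set_def by auto
  show False
  proof (cases "j \<le> p")
    case True
    then show False using degree_reduction[OF R M u v uv SR(1) p(2) SR(2) j(2)] p(3) st by blast
  next
    case False
    then show False using degree_reduction[OF R M v u vu SR(2) j(2) SR(1) p(2)] j(3) st by auto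
  qed
qed

lemma prime_over_if_disjoint:
  assumes R: "gring R" and M: "gprime R M" and u: "u \<in> homs" and d: "hcompl R M \<inter> adjoin u M = {}"
  shows "\<exists>Q. gprime (adjoin u R) Q \<and> Q \<inter> R = M"
proof -
  have T: "gring (adjoin u R)" using gring_adjoin[OF R u] .
  have J: "gideal (adjoin u R) (adjoin u M)" using gideal_adjoin[OF R gprimeD(1)[OF M] u] .
  have S: "mult_set (adjoin u R) (hcompl R M)"
    using mult_set_hcompl[OF R M] subset_adjoin[of R u] unfolding mult_set_def by blast
  obtain Q where Q: "gprime (adjoin u R) Q" "adjoin u M \<subseteq> Q" "hcompl R M \<inter> Q = {}"
    using gprime_exists[OF T J S d] by blast
  have g: "gideal R (Q \<inter> R)" using gideal_restrict[OF gprimeD(1)[OF Q(1)] R subset_adjoin] .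
  have "Q \<inter> R \<subseteq> M" using avoid_imp_subset[OF M g] Q(3) by blast
  moreover have "M \<subseteq> Q \<inter> R" using Q(2) subset_adjoin[of M u] gidealD(2)[OF gprimeD(1)[OF M]] by blast
  ultimately show ?thesis using Q by blast
qed

section \<open>Going down\<close>

definition going_down :: "'a set \<Rightarrow> 'a set \<Rightarrow> bool" where
  "going_down R T \<longleftrightarrow> (\<forall>P\<^sub>0 P Q. gprime R P\<^sub>0 \<and> gprime R P \<and> P\<^sub>0 \<subseteq> P \<and> gprime T Q \<and> Q \<inter> R = P \<longrightarrow>
     (\<exists>Q\<^sub>0. gprime T Q\<^sub>0 \<and> Q\<^sub>0 \<subseteq> Q \<and> Q\<^sub>0 \<inter> R = P\<^sub>0))"

text \<open>
  A prime of \<open>R[y/x]\<close> that contains \<open>x\<close> contains \<open>y = (y/x) x\<close>.  So going-down excludes a prime of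
  \<open>R[y/x]\<close> over \<open>M\<close> as soon as some prime inside \<open>M\<close> contains \<open>x\<close> but not \<open>y\<close>.
\<close>

lemma going_down_primes_comparable:
  assumes R: "gring R"
    and gd: "\<And>a c. \<lbrakk>a \<in> R; a \<in> homs; a \<noteq> \<zero>; c \<in> R; c \<in> homs; c \<noteq> \<zero>\<rbrakk> \<Longrightarrow> going_down R (adjoin (a \<otimes> inv c) R)"
    and M: "gprime R M" and P: "gprime R P" "P \<subseteq> M" and P': "gprime R P'" "P' \<subseteq> M"
  shows "P \<subseteq> P' \<or> P' \<subseteq> P"
proof (rule ccontr)
  assume n: "\<not> ?thesis"
  note p = gidealD[OF gprimeD(1)[OF P(1)]] and p' = gidealD[OF gprimeD(1)[OF P'(1)]]
  obtain c where c: "c \<in> P" "c \<notin> P'" "c \<in> homs" using gsub_subset[OF p(1) p'(1)] n by blast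
  obtain a where a: "a \<in> P'" "a \<notin> P" "a \<in> homs" using gsub_subset[OF p'(1) p(1)] n by blast
  have nz: "a \<noteq> \<zero>" "c \<noteq> \<zero>" using a c gsub_zero[OF p(1)] gsub_zero[OF p'(1)] by blast+
  have acR: "a \<in> R" "c \<in> R" using a c p(2) p'(2) by blast+
  have iv: "inv x \<in> carrier K" "inv x \<otimes> x = \<one>" if "x \<in> homs" "x \<noteq> \<zero>" for x
    using that by (simp_all add: field_Units)
  have no: "\<nexists>Q. gprime (adjoin (y \<otimes> inv x) R) Q \<and> Q \<inter> R = M"
    if x: "x \<in> A" "x \<in> homs" "x \<noteq> \<zero>" and y: "y \<in> R" "y \<notin> A" "y \<in> homs" "y \<noteq> \<zero>"
      and A: "gprime R A" "A \<subseteq> M" for x y A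
  proof
    assume "\<exists>Q. gprime (adjoin (y \<otimes> inv x) R) Q \<and> Q \<inter> R = M"
    moreover have xR: "x \<in> R" using x gidealD(2)[OF gprimeD(1)[OF A(1)]] by blast
    moreover have "y \<otimes> inv x \<in> homs" using homs_mult homs_inv x y by blast
    ultimately obtain Q where Q: "gprime (adjoin (y \<otimes> inv x) R) Q" "Q \<inter> R = A"
      using gd[OF y(1,3,4) xR x(2,3)] M A unfolding going_down_def by blast
    have "(y \<otimes> inv x) \<otimes> x \<in> Q"
      using gidealD(3)[OF gprimeD(1)[OF Q(1)]] adjoin_self[OF R \<open>y \<otimes> inv x \<in> homs\<close>] Q(2) x by blast
    moreover have "(y \<otimes> inv x) \<otimes> x = y" using iv[OF x(2,3)] x y by (simp add: m_assoc)
    ultimately show False using Q(2) y by auto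
  qed
  let ?u = "a \<otimes> inv c" and ?v = "c \<otimes> inv a"
  have uv: "?u \<in> homs" "?v \<in> homs" using homs_mult homs_inv a c nz by blast+
  have "?u \<otimes> ?v = (inv c \<otimes> c) \<otimes> (inv a \<otimes> a)" using iv(1) a c nz by (simp add: m_ac)
  then have one: "?u \<otimes> ?v = \<one>" using iv a c nz by simp
  have "hcompl R M \<inter> M = {}" unfolding hcompl_def by blast
  then have "hcompl R M \<inter> adjoin ?u M = {} \<or> hcompl R M \<inter> adjoin ?v M = {}"
    using adjoin_proper_or[OF R gprimeD(1)[OF M] uv one mult_set_hcompl[OF R M]] by blast
  then show False
    using prime_over_if_disjoint[OF R M] uv no[OF c(1,3) nz(2) acR(1) a(2,3) nz(1) P]
      no[OF a(1,3) nz(1) acR(2) c(2,3) nz(2) P'] by blast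
qed

text \<open>
  As the primes inside \<open>M\<close> form a chain, the intersection of those that contain \<open>a\<close> is again
  prime.
\<close>

lemma going_down_one_dimensional:
  assumes R: "gring R" and N: "gnoeth R"
    and gd: "\<And>a c. \<lbrakk>a \<in> R; a \<in> homs; a \<noteq> \<zero>; c \<in> R; c \<in> homs; c \<noteq> \<zero>\<rbrakk> \<Longrightarrow> going_down R (adjoin (a \<otimes> inv c) R)"
  shows "one_dimensional R"
  unfolding one_dimensional_def
proof (intro allI impI)
  fix P M assume "gprime R P \<and> gprime R M \<and> P \<subset> M"
  then have P: "gprime R P" and M: "gprime R M" and PM: "P \<subseteq> M" "P \<noteq> M" by auto
  note gp = gidealD[OF gprimeD(1)[OF P]] and gm = gidealD[OF gprimeD(1)[OF M]]
  have comp: "A \<subseteq> B \<or> B \<subseteq> A" if "gprime R A" "A \<subseteq> M" "gprime R B" "B \<subseteq> M" for A B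
    using going_down_primes_comparable[OF R gd M that] by blast
  obtain a where a: "a \<in> M" "a \<in> homs" "a \<notin> P" using gsub_subset[OF gm(1) gp(1)] PM by blast
  let ?F = "{A. gprime R A \<and> A \<subseteq> M \<and> a \<in> A}"
  let ?P' = "\<Inter>?F"
  have MF: "M \<in> ?F" using M a by blast
  have P'M: "?P' \<subseteq> M" using MF by blast
  have P': "gprime R ?P'"
    unfolding gprime_def[of R "?P'"]
  proof (intro conjI ballI impI)
    have "gsub ?P'" by (rule gsub_Inter) (use MF in \<open>auto dest: gprimeD(1) gidealD(1)\<close>)
    moreover have "t \<otimes> x \<in> A" if "t \<in> R" "x \<in> ?P'" "A \<in> ?F" for t x A
      using gidealD(3)[OF gprimeD(1), of R A t x] that by blast
    ultimately show "gideal R ?P'" unfolding gideal_def using P'M gm(2) by blast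
    show "\<one> \<notin> ?P'" using P'M gprimeD(2)[OF M] by blast
    fix x y assume xy: "x \<in> R" "y \<in> R" "x \<otimes> y \<in> ?P'"
    show "x \<in> ?P' \<or> y \<in> ?P'"
    proof (rule ccontr)
      assume "\<not> ?thesis"
      then obtain A B where A: "A \<in> ?F" "x \<notin> A" and B: "B \<in> ?F" "y \<notin> B" by blast
      have "A \<subseteq> B \<or> B \<subseteq> A" using comp A(1) B(1) by blast
      then have "(x \<notin> A \<and> y \<notin> A) \<or> (x \<notin> B \<and> y \<notin> B)" using A(2) B(2) by blast
      moreover have "x \<in> A \<or> y \<in> A" using gprimeD(3)[of R A x y] A(1) xy by blast
      moreover have "x \<in> B \<or> y \<in> B" using gprimeD(3)[of R B x y] B(1) xy by blast
      ultimately show False by blast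
    qed
  qed
  have "minimal_over R ?P' a"
    unfolding minimal_over_def using P' P'M by blast
  moreover have "P \<subseteq> ?P'"
  proof
    fix x assume x: "x \<in> P"
    have "x \<in> A" if A: "A \<in> ?F" for A using comp[of P A] P PM A a x by blast
    then show "x \<in> ?P'" by blast
  qed
  ultimately show "P = {\<zero>}" using principal_ideal_theorem[OF R N _ a(2) P _ a(3)] by blast
qed

lemma one_dimensional_going_down:
  assumes T: "one_dimensional T" and T': "gprime T' {\<zero>}" and z: "\<zero> \<in> T"
  shows "going_down T T'"
  unfolding going_down_def
proof (intro allI impI)
  fix P0 P Q assume a: "gprime T P0 \<and> gprime T P \<and> P0 \<subseteq> P \<and> gprime T' Q \<and> Q \<inter> T = P"
  show "\<exists>Q0. gprime T' Q0 \<and> Q0 \<subseteq> Q \<and> Q0 \<inter> T = P0"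
  proof (cases "P0 = P")
    case False
    then have "P0 = {\<zero>}" using a T unfolding one_dimensional_def by blast
    moreover have "\<zero> \<in> Q" using a gsub_zero[OF gidealD(1)[OF gprimeD(1)]] by blast
    ultimately show ?thesis using T' z by blast
  qed (use a in blast)
qed

end

section \<open>The homogeneous quotient field\<close>

lemma (in ring) subring_a_inv:
  assumes "subring T R" "x \<in> T" shows "\<ominus>\<^bsub>R\<lparr>carrier := T\<rparr>\<^esub> x = \<ominus> x"
proof -
  interpret T: ring "R\<lparr>carrier := T\<rparr>" using subring_is_ring[OF assms(1)] .
  have x: "x \<in> carrier (R\<lparr>carrier := T\<rparr>)" using assms by simp
  have "\<ominus>\<^bsub>R\<lparr>carrier := T\<rparr>\<^esub> x \<in> T" using T.a_inv_closed[OF x] by simp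
  moreover have "\<ominus>\<^bsub>R\<lparr>carrier := T\<rparr>\<^esub> x \<oplus> x = \<zero>" using T.l_neg[OF x] by simp
  ultimately show ?thesis using assms subringE(1)[OF assms(1)] minus_equality by (metis subsetD)
qed

lemma (in ring) subring_additive_subgroupI:
  assumes T: "subring T R" and M: "M \<subseteq> T" "\<zero> \<in> M" "\<And>x y. x \<in> M \<Longrightarrow> y \<in> M \<Longrightarrow> x \<ominus> y \<in> M"
  shows "subgroup M (add_monoid (R\<lparr>carrier := T\<rparr>))"
proof -
  have k: "x \<in> carrier R" if "x \<in> M" for x using that M(1) subringE(1)[OF T] by blast
  have neg: "\<ominus> x \<in> M" if "x \<in> M" for x using M(3)[OF M(2) that] k[OF that] by (simp add: a_minus_def)
  have add: "x \<oplus> y \<in> M" if "x \<in> M" "y \<in> M" for x y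
    using M(3)[OF that(1) neg[OF that(2)]] k that by (simp add: a_minus_def)
  show ?thesis
  proof (rule subgroup.intro)
    fix x assume "x \<in> M"
    moreover from this have "inv\<^bsub>add_monoid (R\<lparr>carrier := T\<rparr>)\<^esub> x = \<ominus> x"
      using subring_a_inv[OF T, of x] M(1) unfolding a_inv_def by blast
    ultimately show "inv\<^bsub>add_monoid (R\<lparr>carrier := T\<rparr>)\<^esub> x \<in> M" using neg by simp
  qed (use M add in auto)
qed

lemma (in ring) subring_additive_subgroupD:
  assumes T: "subring T R" and M: "subgroup M (add_monoid (R\<lparr>carrier := T\<rparr>))"
  shows "M \<subseteq> T" "\<zero> \<in> M" "x \<in> M \<Longrightarrow> y \<in> M \<Longrightarrow> x \<ominus> y \<in> M"
proof -
  show MT: "M \<subseteq> T" and "\<zero> \<in> M" using subgroup.subset[OF M] subgroup.one_closed[OF M] by auto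
  assume xy: "x \<in> M" "y \<in> M"
  have "inv\<^bsub>add_monoid (R\<lparr>carrier := T\<rparr>)\<^esub> y = \<ominus> y"
    using subring_a_inv[OF T, of y] MT xy unfolding a_inv_def by blast
  then have "\<ominus> y \<in> M" using subgroup.m_inv_closed[OF M xy(2)] by simp
  then show "x \<ominus> y \<in> M" using subgroup.m_closed[OF M xy(1)] by (simp add: a_minus_def)
qed

lemma subset_quotient_group: "0 \<in> \<Gamma> \<Longrightarrow> \<Gamma> \<subseteq> quotient_group \<Gamma>"
  unfolding quotient_group_def by force

context graded_domain begin

lemma subring_R: "subring R K"
  using subdomain by (simp add: subdomain_def subcring_def)


lemma R_carrier: "x \<in> R \<Longrightarrow> x \<in> carrier K"
  using subringE(1)[OF subring_R] by blast

lemma A_group: "\<alpha> \<in> \<Gamma> \<Longrightarrow> subgroup (A \<alpha>) (add_monoid (K\<lparr>carrier := R\<rparr>))"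
  using direct_sum unfolding direct_sum_def by blast

text \<open>Extending by zero outside \<open>\<Gamma>\<close> removes side conditions on degrees.\<close>

definition comp0 :: "'g \<Rightarrow> 'a set" where
  "comp0 \<alpha> = (if \<alpha> \<in> \<Gamma> then A \<alpha> else {\<zero>})"

lemma comp0_R: "x \<in> comp0 \<alpha> \<Longrightarrow> x \<in> R"
  using subring_additive_subgroupD(1)[OF subring_R A_group] subringE(2)[OF subring_R]
  unfolding comp0_def by (auto split: if_splits)

lemma comp0_carrier: "x \<in> comp0 \<alpha> \<Longrightarrow> x \<in> carrier K"
  using comp0_R R_carrier by blast

lemma comp0_zero: "\<zero> \<in> comp0 \<alpha>"
  using subring_additive_subgroupD(2)[OF subring_R A_group] unfolding comp0_def by auto

lemma comp0_minus: "x \<in> comp0 \<alpha> \<Longrightarrow> y \<in> comp0 \<alpha> \<Longrightarrow> x \<ominus> y \<in> comp0 \<alpha>"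
  using subring_additive_subgroupD(3)[OF subring_R A_group] unfolding comp0_def by (auto split: if_splits simp: a_minus_def)

lemma comp0_mult: 
  assumes "a \<in> comp0 \<alpha>" "b \<in> comp0 \<beta>" shows "a \<otimes> b \<in> comp0 (\<alpha> + \<beta>)"
proof (cases "\<alpha> \<in> \<Gamma> \<and> \<beta> \<in> \<Gamma>")
  case True
  then show ?thesis using component_mult[of \<alpha> \<beta> a b] add_in_monoid[of \<alpha> \<beta>] assms unfolding comp0_def by simp
next
  case False
  then have "a = \<zero> \<or> b = \<zero>" using assms unfolding comp0_def by auto
  then have "a \<otimes> b = \<zero>" using comp0_carrier assms by auto
  then show ?thesis using comp0_zero by simp
qed

lemma comp0_decomposition:
  assumes "x \<in> R"
  shows "\<exists>!f. (\<forall>\<alpha>. f \<alpha> \<in> comp0 \<alpha>) \<and> finite {\<alpha>. f \<alpha> \<noteq> \<zero>} \<and> x = (\<Oplus>\<alpha>\<in>{\<alpha>. f \<alpha> \<noteq> \<zero>}. f \<alpha>)"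
proof -
  have eq: "(\<forall>\<alpha>\<in>\<Gamma>. f \<alpha> \<in> A \<alpha>) \<and> (\<forall>\<alpha>. \<alpha> \<notin> \<Gamma> \<longrightarrow> f \<alpha> = \<zero>) \<and> \<Psi> \<longleftrightarrow> (\<forall>\<alpha>. f \<alpha> \<in> comp0 \<alpha>) \<and> \<Psi>" for f \<Psi>
    unfolding comp0_def by auto
  show ?thesis by (rule direct_sum[unfolded direct_sum_def eq, THEN conjunct2, rule_format, OF assms])
qed

lemma comp0_independent:
  assumes F: "finite F" and f: "\<And>\<alpha>. \<alpha> \<in> F \<Longrightarrow> f \<alpha> \<in> comp0 \<alpha>" and s: "(\<Oplus>\<alpha>\<in>F. f \<alpha>) = \<zero>" and a: "\<alpha> \<in> F"
  shows "f \<alpha> = \<zero>"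
proof -
  define h where "h = (\<lambda>\<alpha>. if \<alpha> \<in> F then f \<alpha> else \<zero>)"
  let ?P = "\<lambda>f. (\<forall>\<alpha>. f \<alpha> \<in> comp0 \<alpha>) \<and> finite {\<alpha>. f \<alpha> \<noteq> \<zero>} \<and> \<zero> = (\<Oplus>\<alpha>\<in>{\<alpha>. f \<alpha> \<noteq> \<zero>}. f \<alpha>)"
  have sub: "{\<alpha>. h \<alpha> \<noteq> \<zero>} \<subseteq> F" unfolding h_def by auto
  have hc: "h \<alpha> \<in> comp0 \<alpha>" for \<alpha> unfolding h_def using f comp0_zero by simp
  have "(\<Oplus>\<alpha>\<in>{\<alpha>. h \<alpha> \<noteq> \<zero>}. h \<alpha>) = (\<Oplus>\<alpha>\<in>F. h \<alpha>)"
    using F sub hc comp0_carrier by (intro add.finprod_mono_neutral_cong_left) auto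
  also have "\<dots> = (\<Oplus>\<alpha>\<in>F. f \<alpha>)"
    using f comp0_carrier by (intro finsum_cong') (auto simp: h_def)
  finally have "?P h" using hc s F finite_subset[OF sub] by simp
  moreover have "?P (\<lambda>_. \<zero>)" using comp0_zero by simp
  moreover have "g = g'" if "\<exists>!g. \<Psi> g" "\<Psi> g" "\<Psi> g'" for \<Psi> and g g' :: "'g \<Rightarrow> 'a" using that by blast
  ultimately have "h = (\<lambda>_. \<zero>)"
    using comp0_decomposition[OF subringE(2)[OF subring_R]] by presburger
  then show ?thesis using a unfolding h_def by meson
qed

lemma nonzero_homogeneous_exists: "\<exists>\<gamma>\<in>\<Gamma>. \<exists>b\<in>A \<gamma>. b \<noteq> \<zero>"
proof (rule ccontr)
  assume n: "\<not> ?thesis"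
  obtain f where f: "\<And>\<alpha>. f \<alpha> \<in> comp0 \<alpha>" "\<one> = (\<Oplus>\<alpha>\<in>{\<alpha>. f \<alpha> \<noteq> \<zero>}. f \<alpha>)"
    using comp0_decomposition[OF subringE(3)[OF subring_R]] by blast
  have "f \<alpha> = \<zero>" for \<alpha> using f(1)[of \<alpha>] n unfolding comp0_def by (auto split: if_splits)
  then have "{\<alpha>. f \<alpha> \<noteq> \<zero>} = {}" by simp
  then show False using f(2) by simp
qed

abbreviation Q :: "'g \<Rightarrow> 'a set" where "Q \<equiv> quotient_component K \<Gamma> A"

text \<open>
  Writing a fraction through its denominator alone, as an \<open>x\<close> with \<open>b \<otimes> x\<close> homogeneous in \<open>R\<close>,
  makes the closure properties of the components of \<open>R\<^sub>H\<close> immediate and covers \<open>x = 0\<close>.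
\<close>

lemma quotient_component_iff:
  "x \<in> Q \<alpha> \<longleftrightarrow> x \<in> carrier K \<and> (\<exists>\<gamma>\<in>\<Gamma>. \<exists>b\<in>A \<gamma>. b \<noteq> \<zero> \<and> b \<otimes> x \<in> comp0 (\<gamma> + \<alpha>))"
proof
  assume x: "x \<in> Q \<alpha>"
  show "x \<in> carrier K \<and> (\<exists>\<gamma>\<in>\<Gamma>. \<exists>b\<in>A \<gamma>. b \<noteq> \<zero> \<and> b \<otimes> x \<in> comp0 (\<gamma> + \<alpha>))"
  proof (cases "x = \<zero>")
    case True
    obtain \<gamma> b where b: "\<gamma> \<in> \<Gamma>" "b \<in> A \<gamma>" "b \<noteq> \<zero>" using nonzero_homogeneous_exists by blast
    then have "b \<otimes> x = \<zero>" using True comp0_carrier[of b \<gamma>] unfolding comp0_def by simp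
    then show ?thesis using b True comp0_zero by (metis zero_closed)
  next
    case False
    then obtain a b \<beta> \<gamma> where x: "x = a \<otimes> inv b" and a: "\<beta> \<in> \<Gamma>" "a \<in> A \<beta>" and b: "\<gamma> \<in> \<Gamma>" "b \<in> A \<gamma>" "b \<noteq> \<zero>" "\<beta> - \<gamma> = \<alpha>"
      using x unfolding quotient_component_def by blast
    have k: "a \<in> carrier K" "b \<in> carrier K"
      using a b comp0_carrier[of a \<beta>] comp0_carrier[of b \<gamma>] unfolding comp0_def by auto
    have u: "b \<in> Units K" using k b by (simp add: field_Units)
    have "b \<otimes> x = a \<otimes> (b \<otimes> inv b)" unfolding x using k u by (simp add: m_lcomm del: Units_r_inv)
    then have "b \<otimes> x = a" using u k by simp
    moreover have "\<gamma> + \<alpha> = \<beta>" using b by auto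
    ultimately have "b \<otimes> x \<in> comp0 (\<gamma> + \<alpha>)" using a unfolding comp0_def by simp
    moreover have "x \<in> carrier K" unfolding x using k u by simp
    ultimately show ?thesis using b by blast
  qed
next
  assume "x \<in> carrier K \<and> (\<exists>\<gamma>\<in>\<Gamma>. \<exists>b\<in>A \<gamma>. b \<noteq> \<zero> \<and> b \<otimes> x \<in> comp0 (\<gamma> + \<alpha>))"
  then obtain \<gamma> b where x: "x \<in> carrier K" and b: "\<gamma> \<in> \<Gamma>" "b \<in> A \<gamma>" "b \<noteq> \<zero>" "b \<otimes> x \<in> comp0 (\<gamma> + \<alpha>)" by blast
  have k: "b \<in> carrier K" using b comp0_carrier[of b \<gamma>] unfolding comp0_def by auto
  have u: "b \<in> Units K" using k b by (simp add: field_Units)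
  show "x \<in> Q \<alpha>"
  proof (cases "x = \<zero>")
    case False
    then have nz: "b \<otimes> x \<noteq> \<zero>" using b(3) k x integral by blast
    then have d: "\<gamma> + \<alpha> \<in> \<Gamma>" "b \<otimes> x \<in> A (\<gamma> + \<alpha>) - {\<zero>}" using b(4) unfolding comp0_def by (auto split: if_splits)
    have "(b \<otimes> x) \<otimes> inv b = x \<otimes> (b \<otimes> inv b)" using k x u by (simp add: m_ac del: Units_r_inv)
    then have "x = (b \<otimes> x) \<otimes> inv b" using u x by simp
    moreover have "(\<gamma> + \<alpha>) - \<gamma> = \<alpha>" by simp
    ultimately show ?thesis unfolding quotient_component_def using d b(1-3) by blast
  qed (simp add: quotient_component_def)
qed

lemma comp0_subset_Q: "comp0 \<alpha> \<subseteq> Q \<alpha>"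
proof
  fix x assume x: "x \<in> comp0 \<alpha>"
  obtain \<gamma> b where b: "\<gamma> \<in> \<Gamma>" "b \<in> A \<gamma>" "b \<noteq> \<zero>" using nonzero_homogeneous_exists by blast
  then have "b \<otimes> x \<in> comp0 (\<gamma> + \<alpha>)" using comp0_mult[of b \<gamma> x \<alpha>] x unfolding comp0_def[of \<gamma>] by simp
  then show "x \<in> Q \<alpha>" unfolding quotient_component_iff using b x comp0_carrier by blast
qed

lemma denominators_mult:
  assumes "\<gamma> \<in> \<Gamma>" "b \<in> A \<gamma>" "b \<noteq> \<zero>" "\<delta> \<in> \<Gamma>" "c \<in> A \<delta>" "c \<noteq> \<zero>"
  shows "\<gamma> + \<delta> \<in> \<Gamma>" "b \<otimes> c \<in> A (\<gamma> + \<delta>)" "b \<otimes> c \<noteq> \<zero>" "b \<in> carrier K" "c \<in> carrier K"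
proof -
  show k: "b \<in> carrier K" "c \<in> carrier K"
    using assms comp0_carrier[of b \<gamma>] comp0_carrier[of c \<delta>] unfolding comp0_def by auto
  show "\<gamma> + \<delta> \<in> \<Gamma>" "b \<otimes> c \<in> A (\<gamma> + \<delta>)" "b \<otimes> c \<noteq> \<zero>"
    using assms add_in_monoid component_mult integral[OF _ k] by blast+
qed

lemma common_denominator:
  assumes "finite F" "\<And>\<alpha>. \<alpha> \<in> F \<Longrightarrow> f \<alpha> \<in> Q \<alpha>"
  shows "\<exists>\<delta>\<in>\<Gamma>. \<exists>d\<in>A \<delta>. d \<noteq> \<zero> \<and> (\<forall>\<alpha>\<in>F. d \<otimes> f \<alpha> \<in> comp0 (\<delta> + \<alpha>))"
  using assms
proof (induction F rule: finite_induct)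
  case empty
  then show ?case using nonzero_homogeneous_exists by blast
next
  case (insert \<beta> F)
  then obtain \<delta> d where d: "\<delta> \<in> \<Gamma>" "d \<in> A \<delta>" "d \<noteq> \<zero>" "\<And>\<alpha>. \<alpha> \<in> F \<Longrightarrow> d \<otimes> f \<alpha> \<in> comp0 (\<delta> + \<alpha>)" by auto
  have "f \<beta> \<in> Q \<beta>" using insert.prems by blast
  then obtain \<gamma> b where x: "f \<beta> \<in> carrier K" and b: "\<gamma> \<in> \<Gamma>" "b \<in> A \<gamma>" "b \<noteq> \<zero>" "b \<otimes> f \<beta> \<in> comp0 (\<gamma> + \<beta>)"
    unfolding quotient_component_iff by blast
  note m = denominators_mult[OF b(1-3) d(1-3)]
  have bB: "b \<in> comp0 \<gamma>" "d \<in> comp0 \<delta>" unfolding comp0_def using b d by auto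
  have "(b \<otimes> d) \<otimes> f \<alpha> \<in> comp0 (\<gamma> + \<delta> + \<alpha>)" if a: "\<alpha> \<in> insert \<beta> F" for \<alpha>
  proof (cases "\<alpha> = \<beta>")
    case True
    have "(b \<otimes> d) \<otimes> f \<beta> = d \<otimes> (b \<otimes> f \<beta>)" using m x by (simp add: m_ac)
    moreover have "\<gamma> + \<delta> + \<beta> = \<delta> + (\<gamma> + \<beta>)" by (simp add: algebra_simps)
    ultimately show ?thesis using comp0_mult[OF bB(2) b(4)] True by (simp only:)
  next
    case False
    then have aF: "\<alpha> \<in> F" using a by blast
    have "f \<alpha> \<in> carrier K" using insert.prems[of \<alpha>] a quotient_component_iff by blast
    then have "(b \<otimes> d) \<otimes> f \<alpha> = b \<otimes> (d \<otimes> f \<alpha>)" using m by (simp add: m_assoc)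
    then show ?thesis using comp0_mult[OF bB(1) d(4)[OF aF]] by (simp add: add.assoc)
  qed
  then show ?case using m(1-3) by blast
qed

lemma quotient_gr_field: "gr_field K Q"
proof (intro gr_field.intro gr_field_axioms.intro field_axioms)
  show "Q \<alpha> \<subseteq> carrier K" for \<alpha> using quotient_component_iff by blast
  show "\<zero> \<in> Q \<alpha>" for \<alpha> by (simp add: quotient_component_def)
  show "x \<ominus> y \<in> Q \<alpha>" if xy: "x \<in> Q \<alpha>" "y \<in> Q \<alpha>" for x y \<alpha>
  proof -
    obtain \<gamma> b where b: "x \<in> carrier K" "\<gamma> \<in> \<Gamma>" "b \<in> A \<gamma>" "b \<noteq> \<zero>" "b \<otimes> x \<in> comp0 (\<gamma> + \<alpha>)"
      using xy(1) unfolding quotient_component_iff by blast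
    obtain \<delta> c where c: "y \<in> carrier K" "\<delta> \<in> \<Gamma>" "c \<in> A \<delta>" "c \<noteq> \<zero>" "c \<otimes> y \<in> comp0 (\<delta> + \<alpha>)"
      using xy(2) unfolding quotient_component_iff by blast
    note m = denominators_mult[OF b(2-4) c(2-4)]
    have bB: "b \<in> comp0 \<gamma>" "c \<in> comp0 \<delta>" unfolding comp0_def using b c by auto
    have "\<delta> + (\<gamma> + \<alpha>) = \<gamma> + \<delta> + \<alpha>" "\<gamma> + (\<delta> + \<alpha>) = \<gamma> + \<delta> + \<alpha>" by (simp_all add: algebra_simps)
    then have "c \<otimes> (b \<otimes> x) \<in> comp0 (\<gamma> + \<delta> + \<alpha>)" "b \<otimes> (c \<otimes> y) \<in> comp0 (\<gamma> + \<delta> + \<alpha>)"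
      using comp0_mult[OF bB(2) b(5)] comp0_mult[OF bB(1) c(5)] by (simp_all only:)
    then have "c \<otimes> (b \<otimes> x) \<ominus> b \<otimes> (c \<otimes> y) \<in> comp0 (\<gamma> + \<delta> + \<alpha>)" by (rule comp0_minus)
    moreover have "(b \<otimes> c) \<otimes> (x \<ominus> y) = c \<otimes> (b \<otimes> x) \<ominus> b \<otimes> (c \<otimes> y)"
      using m(4,5) b(1) c(1) by algebra
    ultimately have "(b \<otimes> c) \<otimes> (x \<ominus> y) \<in> comp0 (\<gamma> + \<delta> + \<alpha>)" by (simp only:)
    then show ?thesis unfolding quotient_component_iff using m(1-3) minus_closed[OF b(1) c(1)] by blast
  qed
  show "\<one> \<in> Q 0"
  proof -
    obtain \<gamma> b where b: "\<gamma> \<in> \<Gamma>" "b \<in> A \<gamma>" "b \<noteq> \<zero>" using nonzero_homogeneous_exists by blast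
    then have bB: "b \<in> comp0 \<gamma>" unfolding comp0_def by simp
    then have "b \<otimes> \<one> \<in> comp0 (\<gamma> + 0)" using comp0_carrier by simp
    then show ?thesis unfolding quotient_component_iff using b by blast
  qed
  show "x \<otimes> y \<in> Q (\<alpha> + \<beta>)" if "x \<in> Q \<alpha>" "y \<in> Q \<beta>" for x y \<alpha> \<beta>
    using quotient_component_mult[OF graded_domain_axioms that] .
  show "inv x \<in> Q (- \<alpha>)" if x: "x \<in> Q \<alpha>" "x \<noteq> \<zero>" for x \<alpha>
  proof -
    obtain \<gamma> b where b: "x \<in> carrier K" "\<gamma> \<in> \<Gamma>" "b \<in> A \<gamma>" "b \<noteq> \<zero>" "b \<otimes> x \<in> comp0 (\<gamma> + \<alpha>)"
      using x(1) unfolding quotient_component_iff by blast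
    have bB: "b \<in> comp0 \<gamma>" unfolding comp0_def using b by simp
    have k: "b \<in> carrier K" using comp0_carrier[OF bB] .
    have u: "x \<in> Units K" using b(1) x(2) by (simp add: field_Units)
    have nz: "b \<otimes> x \<noteq> \<zero>" using b(1,4) k x(2) integral by blast
    then have d: "\<gamma> + \<alpha> \<in> \<Gamma>" "b \<otimes> x \<in> A (\<gamma> + \<alpha>)" using b(5) unfolding comp0_def by (auto split: if_splits)
    have "(b \<otimes> x) \<otimes> inv x = b \<otimes> (x \<otimes> inv x)" using k u b(1) by (intro m_assoc) auto
    then have "(b \<otimes> x) \<otimes> inv x = b" using k u by simp
    moreover have "\<gamma> + \<alpha> + - \<alpha> = \<gamma>" by simp
    ultimately show ?thesis unfolding quotient_component_iff using d nz u bB by (metis Units_inv_closed)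
  qed
  show "f \<alpha> = \<zero>" if F: "finite F" and f: "\<And>\<alpha>. \<alpha> \<in> F \<Longrightarrow> f \<alpha> \<in> Q \<alpha>" and s: "(\<Oplus>\<alpha>\<in>F. f \<alpha>) = \<zero>" and a: "\<alpha> \<in> F" for F f \<alpha>
  proof -
    obtain \<delta> d where d: "\<delta> \<in> \<Gamma>" "d \<in> A \<delta>" "d \<noteq> \<zero>" "\<And>\<alpha>. \<alpha> \<in> F \<Longrightarrow> d \<otimes> f \<alpha> \<in> comp0 (\<delta> + \<alpha>)"
      using common_denominator[OF F, of f] f by blast
    have k: "d \<in> carrier K" using denominators_mult(4)[OF d(1-3) d(1-3)] .
    have fk: "f \<alpha> \<in> carrier K" if "\<alpha> \<in> F" for \<alpha> using f[OF that] quotient_component_iff by blast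
    let ?g = "\<lambda>\<beta>. d \<otimes> f (\<beta> - \<delta>)"
    have "(\<Oplus>\<beta>\<in>(+) \<delta> ` F. ?g \<beta>) = (\<Oplus>\<alpha>\<in>F. ?g (\<delta> + \<alpha>))"
      using k fk by (intro finsum_reindex) auto
    also have "\<dots> = d \<otimes> (\<Oplus>\<alpha>\<in>F. f \<alpha>)"
      using finsum_rdistr[OF F k, of f] fk by auto
    also have "\<dots> = \<zero>" using s k by simp
    finally have s0: "(\<Oplus>\<beta>\<in>(+) \<delta> ` F. ?g \<beta>) = \<zero>" .
    have "?g (\<delta> + \<alpha>) = \<zero>"
    proof (rule comp0_independent[OF _ _ s0])
      show "?g \<beta> \<in> comp0 \<beta>" if "\<beta> \<in> (+) \<delta> ` F" for \<beta> using that d(4) by auto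
    qed (use F a in auto)
    then show "f \<alpha> = \<zero>" using d(3) k fk[OF a] integral by auto
  qed
  show "torsion_free {\<alpha>. Q \<alpha> \<noteq> {\<zero>}}"
    unfolding torsion_free_def
  proof (intro ballI allI impI)
    fix \<alpha> and n :: nat assume "\<alpha> \<in> {\<alpha>. Q \<alpha> \<noteq> {\<zero>}}" and n: "0 < n" "nmult n \<alpha> = 0"
    then obtain \<beta> \<gamma> where bc: "\<beta> \<in> \<Gamma>" "\<gamma> \<in> \<Gamma>" "\<beta> - \<gamma> = \<alpha>" unfolding quotient_component_def by blast
    have "nmult n \<beta> = nmult n (\<alpha> + \<gamma>)" using bc(3) by auto
    also have "\<dots> = nmult n \<alpha> + nmult n \<gamma>" unfolding nmult_def by (simp add: sum.distrib)
    finally have "\<beta> = \<gamma>" using monoid_torsionless n bc unfolding torsionless_def nmult_def by auto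
    then show "\<alpha> = 0" using bc by simp
  qed
qed

end

sublocale graded_domain \<subseteq> q: gr_field K "quotient_component K \<Gamma> A"
  by (rule quotient_gr_field)

section \<open>Homogeneous overrings, ideals and primes\<close>

context graded_domain begin

abbreviation G :: "'g set" where "G \<equiv> quotient_group \<Gamma>"

lemma Q_outside: "\<alpha> \<notin> G \<Longrightarrow> Q \<alpha> = {\<zero>}"
  unfolding quotient_component_def quotient_group_def by blast

lemma homogeneous_quotient_field_eq: "homogeneous_quotient_field K \<Gamma> R A = q.gspan"
proof
  show "homogeneous_quotient_field K \<Gamma> R A \<subseteq> q.gspan"
  proof
    fix x assume "x \<in> homogeneous_quotient_field K \<Gamma> R A"
    then obtain a b \<gamma> where x: "x = a \<otimes> inv b" "a \<in> R" "\<gamma> \<in> \<Gamma>" "b \<in> A \<gamma>" "b \<noteq> \<zero>"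
      unfolding homogeneous_quotient_field_def nonzero_homogeneous_def by blast
    have "b \<in> comp0 \<gamma>" using x unfolding comp0_def by simp
    then have ib: "inv b \<in> Q (- \<gamma>)" using q.C_inv x(5) comp0_subset_Q by blast
    obtain f where f: "\<And>\<alpha>. f \<alpha> \<in> comp0 \<alpha>" "finite {\<alpha>. f \<alpha> \<noteq> \<zero>}" "a = (\<Oplus>\<alpha>\<in>{\<alpha>. f \<alpha> \<noteq> \<zero>}. f \<alpha>)"
      using comp0_decomposition[OF x(2)] by blast
    have fQ: "f \<alpha> \<in> Q \<alpha>" for \<alpha> using f(1) comp0_subset_Q by blast
    have "a \<in> q.gspan" unfolding f(3) using q.hcomp_finsum(1)[OF f(2), of f] q.C_gspan[OF fQ] by blast
    then have "inv b \<otimes> a \<in> q.gspan" using q.hcomp_mult(1)[OF _ ib] by blast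
    then show "x \<in> q.gspan" unfolding x(1) using m_comm[OF R_carrier[OF x(2)] q.C_in[OF ib]] by simp
  qed
  show "q.gspan \<subseteq> homogeneous_quotient_field K \<Gamma> R A"
  proof
    fix x assume "x \<in> q.gspan"
    then obtain F where F: "q.decomposes F x (\<lambda>\<alpha>. q.hcomp \<alpha> x)" using q.gspan_decomposes by metis
    let ?f = "\<lambda>\<alpha>. q.hcomp \<alpha> x"
    have fin: "finite F" and fQ: "\<And>\<alpha>. ?f \<alpha> \<in> Q \<alpha>" and x: "x = (\<Oplus>\<alpha>\<in>F. ?f \<alpha>)"
      using F unfolding q.decomposes_def by auto
    obtain \<delta> d where d: "\<delta> \<in> \<Gamma>" "d \<in> A \<delta>" "d \<noteq> \<zero>" "\<And>\<alpha>. \<alpha> \<in> F \<Longrightarrow> d \<otimes> ?f \<alpha> \<in> comp0 (\<delta> + \<alpha>)"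
      using common_denominator[OF fin fQ] by blast
    have k: "d \<in> carrier K" using denominators_mult(4)[OF d(1-3) d(1-3)] .
    have u: "d \<in> Units K" using k d by (simp add: field_Units)
    have fk: "?f \<alpha> \<in> carrier K" for \<alpha> using q.C_in[OF fQ] .
    have xk: "x \<in> carrier K" using q.decomposes_carrier[OF F] .
    have dx: "d \<otimes> x = (\<Oplus>\<alpha>\<in>F. d \<otimes> ?f \<alpha>)" 
      using finsum_rdistr[OF fin k, of ?f] fk x[symmetric] by simp
    have "(\<Oplus>\<alpha>\<in>E. d \<otimes> ?f \<alpha>) \<in> R" if "finite E" "E \<subseteq> F" for E
      using that
    proof (induction E rule: finite_induct)
      case empty
      then show ?case using subringE(2)[OF subring_R] by simp
    next
      case (insert \<alpha> E)
      have "(\<Oplus>\<alpha>\<in>insert \<alpha> E. d \<otimes> ?f \<alpha>) = d \<otimes> ?f \<alpha> \<oplus> (\<Oplus>\<alpha>\<in>E. d \<otimes> ?f \<alpha>)"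
        using insert.hyps k fk by (intro finsum_insert) auto
      moreover have "d \<otimes> ?f \<alpha> \<in> R" using d(4)[of \<alpha>] insert.prems comp0_R by blast
      ultimately show ?case using insert subringE(7)[OF subring_R] by simp
    qed
    then have "d \<otimes> x \<in> R" unfolding dx using fin by blast
    moreover have "x = (d \<otimes> x) \<otimes> inv d"
    proof -
      have "(d \<otimes> x) \<otimes> inv d = x \<otimes> (d \<otimes> inv d)" using k xk u by (simp add: m_ac del: Units_r_inv)
      then show ?thesis using u xk by simp
    qed
    moreover have "d \<in> nonzero_homogeneous K \<Gamma> A" unfolding nonzero_homogeneous_def using d by blast
    ultimately show "x \<in> homogeneous_quotient_field K \<Gamma> R A" unfolding homogeneous_quotient_field_def by blast
  qed
qed

lemma gring_subring: "q.gring T \<Longrightarrow> subring T K"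
proof (rule subringI)
  assume T: "q.gring T"
  note t = q.gringD[OF T]
  show "T \<subseteq> carrier K" using q.gsub_carrier[OF t(1)] by blast
  show "\<one> \<in> T" using t(2) .
qed (auto intro: q.gringD q.gsub_neg q.gsub_add)

lemma gringI:
  assumes "subring T K" "T \<subseteq> q.gspan" "\<And>x \<alpha>. x \<in> T \<Longrightarrow> q.hcomp \<alpha> x \<in> T"
  shows "q.gring T"
proof -
  have "x \<ominus> y \<in> T" if "x \<in> T" "y \<in> T" for x y
    using that subringE(5,7)[OF assms(1)] by (simp add: a_minus_def)
  then have "q.gsub T" using assms(2,3) subringE(2)[OF assms(1)] by (intro q.gsubI) auto
  then show ?thesis unfolding q.gring_def using subringE(3,6)[OF assms(1)] by simp
qed

lemma decomposesI: 
  assumes f: "\<And>\<alpha>. f \<alpha> \<in> Q \<alpha>" "finite {\<alpha>. f \<alpha> \<noteq> \<zero>}" "x = (\<Oplus>\<alpha>\<in>{\<alpha>. f \<alpha> \<noteq> \<zero>}. f \<alpha>)"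
  shows "q.decomposes {\<alpha>. f \<alpha> \<noteq> \<zero>} x f"
  unfolding q.decomposes_def using f by auto

lemma R_hcomp: "x \<in> R \<Longrightarrow> q.hcomp \<alpha> x \<in> comp0 \<alpha>"
proof -
  assume x: "x \<in> R"
  obtain f where f: "\<And>\<alpha>. f \<alpha> \<in> comp0 \<alpha>" "finite {\<alpha>. f \<alpha> \<noteq> \<zero>}" "x = (\<Oplus>\<alpha>\<in>{\<alpha>. f \<alpha> \<noteq> \<zero>}. f \<alpha>)"
    using comp0_decomposition[OF x] by blast
  have fQ: "f \<alpha> \<in> Q \<alpha>" for \<alpha> using f(1) comp0_subset_Q by blast
  show ?thesis using q.hcomp_eq[OF decomposesI[OF fQ f(2,3)]] f(1) by simp
qed

lemma gring_R: "q.gring R"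
proof (rule gringI[OF subring_R])
  show "R \<subseteq> q.gspan"
  proof
    fix x assume x: "x \<in> R"
    obtain f where f: "\<And>\<alpha>. f \<alpha> \<in> comp0 \<alpha>" "finite {\<alpha>. f \<alpha> \<noteq> \<zero>}" "x = (\<Oplus>\<alpha>\<in>{\<alpha>. f \<alpha> \<noteq> \<zero>}. f \<alpha>)"
      using comp0_decomposition[OF x] by blast
    have fQ: "f \<alpha> \<in> Q \<alpha>" for \<alpha> using f(1) comp0_subset_Q by blast
    show "x \<in> q.gspan" using decomposesI[OF fQ f(2,3)] unfolding q.gspan_def by blast
  qed
  show "q.hcomp \<alpha> x \<in> R" if "x \<in> R" for x \<alpha> using R_hcomp[OF that] comp0_R by blast
qed

lemma R_Int_Q: "R \<inter> Q \<alpha> = comp0 \<alpha>"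
proof
  show "R \<inter> Q \<alpha> \<subseteq> comp0 \<alpha>"
  proof
    fix x assume x: "x \<in> R \<inter> Q \<alpha>"
    then have "q.hcomp \<alpha> x = x" using q.hcomp_C[of x \<alpha> \<alpha>] by simp
    then show "x \<in> comp0 \<alpha>" using R_hcomp[of x \<alpha>] x by simp
  qed
qed (use comp0_R comp0_subset_Q in blast)

lemma homogeneous_overring_iff: "homogeneous_overring K \<Gamma> R A T \<longleftrightarrow> q.gring T \<and> R \<subseteq> T"
proof
  assume h: "homogeneous_overring K \<Gamma> R A T"
  then have s: "subring T K" "R \<subseteq> T" "T \<subseteq> q.gspan" and
    d: "direct_sum K G T (overring_component K \<Gamma> A T)"
    unfolding homogeneous_overring_def homogeneous_quotient_field_eq by auto
  have "q.hcomp \<alpha> x \<in> T" if x: "x \<in> T" for x \<alpha>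
  proof -
    obtain f where f: "\<And>\<alpha>. \<alpha> \<in> G \<Longrightarrow> f \<alpha> \<in> T \<inter> Q \<alpha>" "\<And>\<alpha>. \<alpha> \<notin> G \<Longrightarrow> f \<alpha> = \<zero>"
       "finite {\<alpha>. f \<alpha> \<noteq> \<zero>}" "x = (\<Oplus>\<alpha>\<in>{\<alpha>. f \<alpha> \<noteq> \<zero>}. f \<alpha>)"
      using d[unfolded direct_sum_def overring_component_def, THEN conjunct2, rule_format, OF x] by blast
    have fT: "f \<alpha> \<in> T \<inter> Q \<alpha>" for \<alpha>
      using f(1,2)[of \<alpha>] subringE(2)[OF s(1)] q.C_zero by (cases "\<alpha> \<in> G") auto
    then show ?thesis using q.hcomp_eq[OF decomposesI[OF _ f(3,4)]] by auto
  qed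
  then show "q.gring T \<and> R \<subseteq> T" using gringI s by blast
next
  assume h: "q.gring T \<and> R \<subseteq> T"
  then have T: "q.gring T" and RT: "R \<subseteq> T" by auto
  note t = q.gringD[OF T] and s = gring_subring[OF T]
  have "direct_sum K G T (overring_component K \<Gamma> A T)"
    unfolding direct_sum_def overring_component_def
  proof (intro conjI ballI)
    show "subgroup (T \<inter> Q \<alpha>) (add_monoid (K\<lparr>carrier := T\<rparr>))" for \<alpha>
    proof (rule subring_additive_subgroupI[OF s])
      show "x \<ominus> y \<in> T \<inter> Q \<alpha>" if "x \<in> T \<inter> Q \<alpha>" "y \<in> T \<inter> Q \<alpha>" for x y
        using that q.C_minus q.gsub_minus[OF t(1)] by blast
    qed (use q.gsub_zero[OF t(1)] q.C_zero in auto)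
    fix x assume x: "x \<in> T"
    have g: "x \<in> q.gspan" using q.gsub_gspan[OF t(1) x] .
    let ?h = "\<lambda>\<alpha>. q.hcomp \<alpha> x"
    show "\<exists>!f. (\<forall>\<alpha>\<in>G. f \<alpha> \<in> T \<inter> Q \<alpha>) \<and> (\<forall>\<alpha>. \<alpha> \<notin> G \<longrightarrow> f \<alpha> = \<zero>) \<and>
        finite {\<alpha>. f \<alpha> \<noteq> \<zero>} \<and> x = (\<Oplus>\<alpha>\<in>{\<alpha>. f \<alpha> \<noteq> \<zero>}. f \<alpha>)"
    proof (rule ex1I[of _ ?h])
      obtain F where F: "q.decomposes F x ?h" using q.gspan_decomposes[OF g] by metis
      have sub: "{\<alpha>. ?h \<alpha> \<noteq> \<zero>} \<subseteq> F" using F unfolding q.decomposes_def by auto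
      have fin: "finite F" using F unfolding q.decomposes_def by blast
      have "(\<Oplus>\<alpha>\<in>{\<alpha>. ?h \<alpha> \<noteq> \<zero>}. ?h \<alpha>) = (\<Oplus>\<alpha>\<in>F. ?h \<alpha>)"
        using sub fin q.hcomp_carrier[OF g] by (intro add.finprod_mono_neutral_cong_left) auto
      then have "x = (\<Oplus>\<alpha>\<in>{\<alpha>. ?h \<alpha> \<noteq> \<zero>}. ?h \<alpha>)" using F unfolding q.decomposes_def by simp
      moreover have "?h \<alpha> = \<zero>" if "\<alpha> \<notin> G" for \<alpha> using q.hcomp_in_C[OF g, of \<alpha>] Q_outside[OF that] by simp
      moreover have "?h \<alpha> \<in> T \<inter> Q \<alpha>" for \<alpha> using q.hcomp_in_C[OF g] q.gsub_hcomp[OF t(1) x] by blast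
      ultimately show "(\<forall>\<alpha>\<in>G. ?h \<alpha> \<in> T \<inter> Q \<alpha>) \<and> (\<forall>\<alpha>. \<alpha> \<notin> G \<longrightarrow> ?h \<alpha> = \<zero>) \<and>
        finite {\<alpha>. ?h \<alpha> \<noteq> \<zero>} \<and> x = (\<Oplus>\<alpha>\<in>{\<alpha>. ?h \<alpha> \<noteq> \<zero>}. ?h \<alpha>)"
        using finite_subset[OF sub fin] by blast
      fix f assume f: "(\<forall>\<alpha>\<in>G. f \<alpha> \<in> T \<inter> Q \<alpha>) \<and> (\<forall>\<alpha>. \<alpha> \<notin> G \<longrightarrow> f \<alpha> = \<zero>) \<and>
        finite {\<alpha>. f \<alpha> \<noteq> \<zero>} \<and> x = (\<Oplus>\<alpha>\<in>{\<alpha>. f \<alpha> \<noteq> \<zero>}. f \<alpha>)"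
      have "f \<alpha> \<in> Q \<alpha>" for \<alpha> using f q.C_zero by (cases "\<alpha> \<in> G") auto
      then have "q.decomposes {\<alpha>. f \<alpha> \<noteq> \<zero>} x f" using f by (intro decomposesI) auto
      then show "f = ?h" using q.hcomp_eq by (intro ext) simp
    qed
  qed
  moreover have "T \<subseteq> q.gspan" using q.gsub_gspan[OF t(1)] by blast
  ultimately show "homogeneous_overring K \<Gamma> R A T"
    unfolding homogeneous_overring_def homogeneous_quotient_field_eq using s RT by blast
qed

lemma ideal_iff:
  assumes T: "subring T K"
  shows "ideal I (K\<lparr>carrier := T\<rparr>) \<longleftrightarrow>
    I \<subseteq> T \<and> \<zero> \<in> I \<and> (\<forall>x\<in>I. \<forall>y\<in>I. x \<ominus> y \<in> I) \<and> (\<forall>t\<in>T. \<forall>x\<in>I. t \<otimes> x \<in> I)"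
proof
  assume "ideal I (K\<lparr>carrier := T\<rparr>)"
  then interpret I: ideal I "K\<lparr>carrier := T\<rparr>" .
  note s = subring_additive_subgroupD[OF T I.a_subgroup]
  show "I \<subseteq> T \<and> \<zero> \<in> I \<and> (\<forall>x\<in>I. \<forall>y\<in>I. x \<ominus> y \<in> I) \<and> (\<forall>t\<in>T. \<forall>x\<in>I. t \<otimes> x \<in> I)"
    using s I.I_l_closed by auto
next
  assume a: "I \<subseteq> T \<and> \<zero> \<in> I \<and> (\<forall>x\<in>I. \<forall>y\<in>I. x \<ominus> y \<in> I) \<and> (\<forall>t\<in>T. \<forall>x\<in>I. t \<otimes> x \<in> I)"
  show "ideal I (K\<lparr>carrier := T\<rparr>)"
  proof (rule idealI[OF subring_is_ring[OF T]])
    show "subgroup I (add_monoid (K\<lparr>carrier := T\<rparr>))" using a by (intro subring_additive_subgroupI[OF T]) auto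
    fix x t assume x: "x \<in> I" and t: "t \<in> carrier (K\<lparr>carrier := T\<rparr>)"
    show "t \<otimes>\<^bsub>K\<lparr>carrier := T\<rparr>\<^esub> x \<in> I" using a x t by simp
    moreover have "x \<in> carrier K" "t \<in> carrier K" using x t a subringE(1)[OF T] by auto
    ultimately show "x \<otimes>\<^bsub>K\<lparr>carrier := T\<rparr>\<^esub> t \<in> I" using m_comm by simp
  qed
qed

text \<open>
  An ideal generated by homogeneous elements contains the components of its elements, because
  the elements with all components in the ideal form an ideal.  The grading enters only through
  its set of nonzero homogeneous elements, so the same equivalence serves for the grading of
  \<open>R\<close> by \<open>\<Gamma>\<close> and for that of an overring by the quotient group.
\<close>

lemma homogeneous_ideal_iff:
  assumes T: "q.gring T" and nh: "nonzero_homogeneous K \<Gamma>' A' = T \<inter> q.homs - {\<zero>}"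
  shows "homogeneous_ideal K \<Gamma>' T A' I \<longleftrightarrow> q.gideal T I"
proof
  note s = gring_subring[OF T] and t = q.gringD[OF T]
  note ii = ideal_iff[OF s]
  interpret RT: ring "K\<lparr>carrier := T\<rparr>" using subring_is_ring[OF s] .
  {
    assume "homogeneous_ideal K \<Gamma>' T A' I"
    then obtain S where I: "ideal I (K\<lparr>carrier := T\<rparr>)" and S: "S \<subseteq> T \<inter> q.homs" "I = Idl\<^bsub>K\<lparr>carrier := T\<rparr>\<^esub> S"
      unfolding homogeneous_ideal_def nh by blast
    note i = I[unfolded ii]
    have IT: "I \<subseteq> T" and I0: "\<zero> \<in> I" and Im: "\<And>x y. x \<in> I \<Longrightarrow> y \<in> I \<Longrightarrow> x \<ominus> y \<in> I"
      and It: "\<And>t x. t \<in> T \<Longrightarrow> x \<in> I \<Longrightarrow> t \<otimes> x \<in> I" using i by auto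
    have k: "x \<in> carrier K" if "x \<in> I" for x using that IT q.gsub_carrier[OF t(1)] by blast
    have Ia: "x \<oplus> y \<in> I" if "x \<in> I" "y \<in> I" for x y
      using Im[OF that(1) Im[OF I0 that(2)]] k[OF that(1)] k[OF that(2)] by (simp add: a_minus_def)
    have Is: "(\<Oplus>i\<in>F. f i) \<in> I" if "finite F" "\<And>i. i \<in> F \<Longrightarrow> f i \<in> I" for F and f :: "'g \<Rightarrow> 'a"
      using that
    proof (induction F rule: finite_induct)
      case (insert i F)
      then have "(\<Oplus>i\<in>insert i F. f i) = f i \<oplus> (\<Oplus>i\<in>F. f i)" using k by (intro finsum_insert) auto
      then show ?case using insert Ia by auto
    qed (simp add: I0)
    let ?J = "{x \<in> I. \<forall>\<alpha>. q.hcomp \<alpha> x \<in> I}"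
    have g: "x \<in> q.gspan" if "x \<in> T" for x using q.gsub_gspan[OF t(1) that] .
    have gI: "x \<in> q.gspan" if "x \<in> I" for x using g IT that by blast
    have "ideal ?J (K\<lparr>carrier := T\<rparr>)"
      unfolding ii
    proof (intro conjI ballI)
      show "?J \<subseteq> T" using IT by blast
      show "\<zero> \<in> ?J" using I0 q.gspan_zero by simp
      show "x \<ominus> y \<in> ?J" if "x \<in> ?J" "y \<in> ?J" for x y
        using that Im q.hcomp_minus(2)[OF gI gI, of x y] by auto
      show "u \<otimes> x \<in> ?J" if u: "u \<in> T" and x: "x \<in> ?J" for u x
      proof -
        obtain F where F: "q.decomposes F u (\<lambda>\<alpha>. q.hcomp \<alpha> u)" using q.gspan_decomposes[OF g[OF u]] by metis
        then have fin: "finite F" unfolding q.decomposes_def by blast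
        have xI: "x \<in> I" "\<And>\<alpha>. q.hcomp \<alpha> x \<in> I" using x by blast+
        have "q.hcomp \<alpha> u \<otimes> q.hcomp (\<gamma> - \<alpha>) x \<in> I" for \<alpha> \<gamma>
          by (rule It[OF q.gsub_hcomp[OF t(1) u] xI(2)])
        then have "q.hcomp \<gamma> (u \<otimes> x) \<in> I" for \<gamma>
          unfolding q.hcomp_product(2)[OF F gI[OF xI(1)]] by (intro Is[OF fin])
        then show ?thesis using It[OF u] x by blast
      qed
    qed
    moreover have "S \<subseteq> ?J"
    proof
      fix x assume x: "x \<in> S"
      have "S \<subseteq> I" unfolding S(2) using S(1) by (intro RT.genideal_self) auto
      moreover obtain \<delta> where "x \<in> Q \<delta>" using x S(1) unfolding q.homs_def by blast
      ultimately show "x \<in> ?J" using x I0 q.hcomp_C[of x \<delta>] by auto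
    qed
    ultimately have "I \<subseteq> ?J" unfolding S(2) by (rule RT.genideal_minimal)
    then show "q.gideal T I" unfolding q.gideal_def q.gsub_def using gI I0 Im It IT by blast
  next
    assume I: "q.gideal T I"
    note i = q.gidealD[OF I]
    have id: "ideal I (K\<lparr>carrier := T\<rparr>)"
      unfolding ii using i(2,3) q.gsub_zero[OF i(1)] q.gsub_minus[OF i(1)] by blast
    let ?S = "I \<inter> q.homs - {\<zero>}"
    let ?J = "Idl\<^bsub>K\<lparr>carrier := T\<rparr>\<^esub> ?S"
    have ST: "?S \<subseteq> carrier (K\<lparr>carrier := T\<rparr>)" using i(2) by auto
    have J: "ideal ?J (K\<lparr>carrier := T\<rparr>)" using RT.genideal_ideal[OF ST] .
    have SJ: "?S \<subseteq> ?J" using RT.genideal_self[OF ST] .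
    have J0: "\<zero> \<in> ?J" and Jm: "\<And>x y. x \<in> ?J \<Longrightarrow> y \<in> ?J \<Longrightarrow> x \<ominus> y \<in> ?J" and JT: "?J \<subseteq> T"
      using J[unfolded ii] by auto
    have k: "x \<in> carrier K" if "x \<in> ?J" for x using that JT q.gsub_carrier[OF t(1)] by blast
    have Ja: "x \<oplus> y \<in> ?J" if "x \<in> ?J" "y \<in> ?J" for x y
      using Jm[OF that(1) Jm[OF J0 that(2)]] k[OF that(1)] k[OF that(2)] by (simp add: a_minus_def)
    have "I \<subseteq> ?J"
    proof
      fix x assume x: "x \<in> I"
      have g: "x \<in> q.gspan" using q.gsub_gspan[OF i(1) x] .
      have c: "q.hcomp \<alpha> x \<in> ?J" for \<alpha>
      proof (cases "q.hcomp \<alpha> x = \<zero>")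
        case False
        then have "q.hcomp \<alpha> x \<in> ?S" using q.hcomp_homs[OF g] q.gsub_hcomp[OF i(1) x] by simp
        then show ?thesis using SJ by (rule subsetD[rotated])
      qed (simp only: J0)
      obtain F where F: "q.decomposes F x (\<lambda>\<alpha>. q.hcomp \<alpha> x)" using q.gspan_decomposes[OF g] by metis
      then have "finite F" unfolding q.decomposes_def by blast
      then have "(\<Oplus>\<alpha>\<in>F. q.hcomp \<alpha> x) \<in> ?J"
      proof (induction F rule: finite_induct)
        case (insert \<alpha> F)
        then have "(\<Oplus>\<alpha>\<in>insert \<alpha> F. q.hcomp \<alpha> x) = q.hcomp \<alpha> x \<oplus> (\<Oplus>\<alpha>\<in>F. q.hcomp \<alpha> x)"
          using q.hcomp_carrier[OF g] by (intro finsum_insert) auto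
        then show ?case using Ja[OF c insert.IH] by simp
      qed (simp add: J0)
      then show "x \<in> ?J" using F unfolding q.decomposes_def by auto
    qed
    moreover have "?J \<subseteq> I" by (rule RT.genideal_minimal[OF id]) blast
    ultimately have "I = ?J" by (rule subset_antisym)
    moreover have "?S \<subseteq> nonzero_homogeneous K \<Gamma>' A'" unfolding nh using i(2) by blast
    ultimately show "homogeneous_ideal K \<Gamma>' T A' I" unfolding homogeneous_ideal_def using id by blast
  }
qed

lemma homogeneous_prime_iff:
  assumes T: "q.gring T" and nh: "nonzero_homogeneous K \<Gamma>' A' = T \<inter> q.homs - {\<zero>}"
  shows "homogeneous_prime K \<Gamma>' T A' P \<longleftrightarrow> q.gprime T P"
proof
  note s = gring_subring[OF T] and t = q.gringD[OF T]
  {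
    assume "homogeneous_prime K \<Gamma>' T A' P"
    then have P: "q.gideal T P" and pr: "primeideal P (K\<lparr>carrier := T\<rparr>)"
      unfolding homogeneous_prime_def homogeneous_ideal_iff[OF T nh] by auto
    interpret P: primeideal P "K\<lparr>carrier := T\<rparr>" using pr .
    have "\<one> \<notin> P" using P.I_notcarr q.gideal_one[OF T P] by auto
    then show "q.gprime T P" unfolding q.gprime_def using P P.I_prime by auto
  next
    assume P: "q.gprime T P"
    have hi: "homogeneous_ideal K \<Gamma>' T A' P" using homogeneous_ideal_iff[OF T nh] q.gprimeD(1)[OF P] by blast
    have "primeideal P (K\<lparr>carrier := T\<rparr>)"
    proof (rule primeidealI)
      show "ideal P (K\<lparr>carrier := T\<rparr>)" using hi unfolding homogeneous_ideal_def by blast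
      show "cring (K\<lparr>carrier := T\<rparr>)" using subring_is_domain[OF s] unfolding domain_def by blast
      show "carrier (K\<lparr>carrier := T\<rparr>) \<noteq> P" using q.gprimeD(2)[OF P] t(2) by auto
    qed (use q.gprimeD(3)[OF P] in auto)
    then show "homogeneous_prime K \<Gamma>' T A' P" unfolding homogeneous_prime_def using hi by blast
  }
qed

lemma nonzero_homogeneous_R: "nonzero_homogeneous K \<Gamma> A = R \<inter> q.homs - {\<zero>}"
proof -
  have "A \<alpha> = R \<inter> Q \<alpha>" if "\<alpha> \<in> \<Gamma>" for \<alpha> unfolding R_Int_Q comp0_def using that by simp
  moreover have "R \<inter> Q \<alpha> = {\<zero>}" if "\<alpha> \<notin> \<Gamma>" for \<alpha> unfolding R_Int_Q comp0_def using that by simp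
  ultimately show ?thesis unfolding nonzero_homogeneous_def q.homs_def by blast
qed

lemma nonzero_homogeneous_overring:
  "nonzero_homogeneous K G (overring_component K \<Gamma> A T) = T \<inter> q.homs - {\<zero>}"
  unfolding nonzero_homogeneous_def q.homs_def overring_component_def using Q_outside by blast

lemma R_prime_iff: "homogeneous_prime K \<Gamma> R A P \<longleftrightarrow> q.gprime R P"
  using homogeneous_prime_iff[OF gring_R nonzero_homogeneous_R] .

lemma satisfies_gGD_iff:
  assumes "q.gring T"
  shows "satisfies_gGD K \<Gamma> R A T \<longleftrightarrow> q.going_down R T"
  unfolding satisfies_gGD_def Let_def R_prime_iff q.going_down_def
    homogeneous_prime_iff[OF assms nonzero_homogeneous_overring] ..

lemma gGD_domain_iff: "gGD_domain K \<Gamma> R A \<longleftrightarrow> (\<forall>T. q.gring T \<and> R \<subseteq> T \<longrightarrow> q.going_down R T)"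
  unfolding gGD_domain_def homogeneous_overring_iff using satisfies_gGD_iff by blast

lemma gr_Noetherian_iff: "gr_Noetherian K \<Gamma> R A \<longleftrightarrow> q.gnoeth R"
  unfolding gr_Noetherian_def q.gnoeth_def homogeneous_ideal_iff[OF gring_R nonzero_homogeneous_R] ..

text \<open>
  Passing to an overring does not change the ambient graded field, so the notions for \<open>R\<close> and
  for its overrings refer to the same components.
\<close>

lemma quotient_component_overring:
  assumes T: "q.gring T" "R \<subseteq> T"
  shows "quotient_component K G (overring_component K \<Gamma> A T) = Q"
proof (rule ext, rule subset_antisym)
  fix \<alpha>
  show "quotient_component K G (overring_component K \<Gamma> A T) \<alpha> \<subseteq> Q \<alpha>"
  proof
    fix x assume x: "x \<in> quotient_component K G (overring_component K \<Gamma> A T) \<alpha>"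
    show "x \<in> Q \<alpha>"
    proof (cases "x = \<zero>")
      case False
      then obtain a b \<beta> \<gamma> where "x = a \<otimes> inv b" "a \<in> Q \<beta>" "b \<in> Q \<gamma>" "b \<noteq> \<zero>" "\<beta> - \<gamma> = \<alpha>"
        using x unfolding quotient_component_def[of K G] overring_component_def by blast
      then show ?thesis using q.C_mult[of a \<beta> "inv b" "- \<gamma>"] q.C_inv[of b \<gamma>] by auto
    qed (simp add: q.C_zero)
  qed
  show "Q \<alpha> \<subseteq> quotient_component K G (overring_component K \<Gamma> A T) \<alpha>"
  proof
    fix x assume x: "x \<in> Q \<alpha>"
    show "x \<in> quotient_component K G (overring_component K \<Gamma> A T) \<alpha>"
    proof (cases "x = \<zero>")
      case False
      then obtain a b \<beta> \<gamma> where a: "x = a \<otimes> inv b" "\<beta> \<in> \<Gamma>" "\<gamma> \<in> \<Gamma>" "a \<in> A \<beta> - {\<zero>}" "b \<in> A \<gamma> - {\<zero>}" "\<beta> - \<gamma> = \<alpha>"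
        using x unfolding quotient_component_def by blast
      have "A \<delta> \<subseteq> overring_component K \<Gamma> A T \<delta>" if "\<delta> \<in> \<Gamma>" for \<delta>
        using R_Int_Q[of \<delta>] that T(2) unfolding overring_component_def comp0_def by auto
      then have "a \<in> overring_component K \<Gamma> A T \<beta> - {\<zero>}" "b \<in> overring_component K \<Gamma> A T \<gamma> - {\<zero>}" using a by blast+
      moreover have "\<beta> \<in> G" "\<gamma> \<in> G" using a subset_quotient_group[OF zero_in_monoid] by blast+
      ultimately show ?thesis unfolding quotient_component_def[of K G] using a(1,6) by blast
    qed (simp add: quotient_component_def)
  qed
qed

lemma gGD_domain_overring_iff:
  assumes T: "q.gring T" "R \<subseteq> T"
  shows "gGD_domain K G T (overring_component K \<Gamma> A T) \<longleftrightarrow>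
    (\<forall>T'. q.gring T' \<and> T \<subseteq> T' \<longrightarrow> q.going_down T T')"
proof -
  have "homogeneous_overring K \<Gamma> R A T" using homogeneous_overring_iff T by blast
  then have "graded_domain K G T (overring_component K \<Gamma> A T)"
    using graded_domain_overring[OF graded_domain_axioms] by blast
  from graded_domain.gGD_domain_iff[OF this] show ?thesis
    unfolding quotient_component_overring[OF T] .
qed

lemma h_dim_le_1_iff: "h_dim K \<Gamma> R A \<le> 1 \<longleftrightarrow> q.one_dimensional R"
proof -
  let ?chain = "\<lambda>P n C. C 0 = P \<and> (\<forall>i\<le>n. q.gprime R (C i)) \<and> (\<forall>i<n. C (Suc i) \<subset> C i)"
  have "h_dim K \<Gamma> R A \<le> 1 \<longleftrightarrow> (\<forall>P. q.gprime R P \<longrightarrow> (\<forall>n. (\<exists>C. ?chain P n C) \<longrightarrow> n \<le> 1))"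
  proof -
    have "Sup {enat n | n. \<Psi> n} \<le> 1 \<longleftrightarrow> (\<forall>n. \<Psi> n \<longrightarrow> n \<le> 1)" for \<Psi>
      unfolding complete_lattice_class.Sup_le_iff by (auto simp: one_enat_def)
    then show ?thesis unfolding h_dim_def h_height_def R_prime_iff SUP_le_iff by simp
  qed
  also have "\<dots> \<longleftrightarrow> q.one_dimensional R"
  proof
    assume h: "\<forall>P. q.gprime R P \<longrightarrow> (\<forall>n. (\<exists>C. ?chain P n C) \<longrightarrow> n \<le> 1)"
    show "q.one_dimensional R"
      unfolding q.one_dimensional_def
    proof (intro allI impI, rule ccontr)
      fix P0 P assume p: "q.gprime R P0 \<and> q.gprime R P \<and> P0 \<subset> P" and n: "P0 \<noteq> {\<zero>}"
      let ?C = "\<lambda>i::nat. if i = 0 then P else if i = 1 then P0 else {\<zero>}"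
      have z: "\<zero> \<in> P0" using p q.gsub_zero[OF q.gidealD(1)[OF q.gprimeD(1)]] by blast
      have "q.gprime R (?C i)" for i using p q.gprime_zero[OF gring_R] by simp
      moreover have "?C (Suc i) \<subset> ?C i" if "i < 2" for i
      proof -
        have "i = 0 \<or> i = 1" using that by auto
        moreover have "{\<zero>} \<subset> P0" using z n by blast
        ultimately show ?thesis using p by auto
      qed
      ultimately have "?chain P 2 ?C" by simp
      then have ex: "\<exists>C. ?chain P 2 C" by (rule exI[of _ ?C])
      have "(2::nat) \<le> 1" by (rule h[rule_format, OF _ ex]) (use p in simp)
      then show False by simp
    qed
  next
    assume d: "q.one_dimensional R"
    show "\<forall>P. q.gprime R P \<longrightarrow> (\<forall>n. (\<exists>C. ?chain P n C) \<longrightarrow> n \<le> 1)"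
    proof (intro allI impI, rule ccontr)
      fix P n assume "q.gprime R P" "\<exists>C. ?chain P n C" and n: "\<not> n \<le> 1"
      then obtain C where c: "\<And>i. i \<le> n \<Longrightarrow> q.gprime R (C i)" "\<And>i. i < n \<Longrightarrow> C (Suc i) \<subset> C i" by blast
      have "q.gprime R (C 1)" "q.gprime R (C 0)" "C 1 \<subset> C 0" using c(1)[of 0] c(1)[of 1] c(2)[of 0] n by simp_all
      then have "C 1 = {\<zero>}" using d unfolding q.one_dimensional_def by blast
      then have "C (Suc 1) \<subset> {\<zero>}" using c(2)[of 1] n by simp
      moreover have "\<zero> \<in> C (Suc 1)"
        using q.gsub_zero[OF q.gidealD(1)[OF q.gprimeD(1)[OF c(1)[of "Suc 1"]]]] n by simp
      ultimately show False by blast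
    qed
  qed
  finally show ?thesis .
qed

lemma homogeneous_fraction:
  assumes "t \<in> q.homs" shows "\<exists>c\<in>R. c \<in> q.homs \<and> c \<noteq> \<zero> \<and> c \<otimes> t \<in> R"
proof -
  obtain \<alpha> where "t \<in> Q \<alpha>" using assms unfolding q.homs_def by blast
  then obtain \<gamma> b where b: "\<gamma> \<in> \<Gamma>" "b \<in> A \<gamma>" "b \<noteq> \<zero>" "b \<otimes> t \<in> comp0 (\<gamma> + \<alpha>)"
    unfolding quotient_component_iff by blast
  have "b \<in> R \<inter> Q \<gamma>" unfolding R_Int_Q comp0_def using b by simp
  then show ?thesis using b comp0_R unfolding q.homs_def by blast
qed

end

theorem proposition3p13:
  fixes K :: "('a, 'm) ring_scheme"
    and \<Gamma> :: "'g::ab_group_add set"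
    and R :: "'a set"
    and A :: "'g \<Rightarrow> 'a set"
  assumes "graded_domain K \<Gamma> R A"
    and "gr_Noetherian K \<Gamma> R A"
  shows "(h_dim K \<Gamma> R A \<le> 1 \<longleftrightarrow>
      (\<forall>T. homogeneous_overring K \<Gamma> R A T \<longrightarrow>
        gGD_domain K (quotient_group \<Gamma>) T (overring_component K \<Gamma> A T))) \<and>
    ((\<forall>T. homogeneous_overring K \<Gamma> R A T \<longrightarrow>
        gGD_domain K (quotient_group \<Gamma>) T (overring_component K \<Gamma> A T)) \<longleftrightarrow>
      gGD_domain K \<Gamma> R A)"
proof -
  interpret graded_domain K \<Gamma> R A by fact
  have N: "q.gnoeth R" using assms(2) gr_Noetherian_iff by blast
  note z = q.gsub_zero[OF q.gringD(1)]
  have 12: "gGD_domain K G T (overring_component K \<Gamma> A T)"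
    if d: "q.one_dimensional R" and h: "homogeneous_overring K \<Gamma> R A T" for T
  proof -
    have T: "q.gring T" "R \<subseteq> T" using h homogeneous_overring_iff by auto
    have "q.one_dimensional T"
      using q.krull_akizuki_one_dimensional[OF gring_R N d T] homogeneous_fraction by blast
    then show ?thesis
      unfolding gGD_domain_overring_iff[OF T]
      using q.one_dimensional_going_down q.gprime_zero z[OF T(1)] by blast
  qed
  have 23: "gGD_domain K \<Gamma> R A"
    if h: "\<forall>T. homogeneous_overring K \<Gamma> R A T \<longrightarrow> gGD_domain K G T (overring_component K \<Gamma> A T)"
  proof -
    have "gGD_domain K G R (overring_component K \<Gamma> A R)"
      using h homogeneous_overring_iff gring_R by blast
    then show ?thesis unfolding gGD_domain_overring_iff[OF gring_R order_refl] gGD_domain_iff .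
  qed
  have 31: "q.one_dimensional R" if h: "gGD_domain K \<Gamma> R A"
  proof (rule q.going_down_one_dimensional[OF gring_R N])
    fix a c assume "a \<in> R" "a \<in> q.homs" "a \<noteq> \<zero>\<^bsub>K\<^esub>" "c \<in> R" "c \<in> q.homs" "c \<noteq> \<zero>\<^bsub>K\<^esub>"
    then have "a \<otimes>\<^bsub>K\<^esub> inv\<^bsub>K\<^esub> c \<in> q.homs" using q.homs_mult q.homs_inv by blast
    then have "q.gring (q.adjoin (a \<otimes>\<^bsub>K\<^esub> inv\<^bsub>K\<^esub> c) R)" using q.gring_adjoin[OF gring_R] by blast
    then show "q.going_down R (q.adjoin (a \<otimes>\<^bsub>K\<^esub> inv\<^bsub>K\<^esub> c) R)"
      using h q.subset_adjoin unfolding gGD_domain_iff by blast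
  qed
  show ?thesis unfolding h_dim_le_1_iff using 12 23 31 by blast
qed

end
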